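(* Let $(X,T,\mu)$ and $(X',T',\mu')$ be ergodic invertible measure-preserving transformations of non-atomic Lebesgue probability spaces. If $T$ and $T'$ have the same rational spectrum, then $\mathrm P(X,T,\mu)=\mathrm P(X',T',\mu')$.
   Context: Let $\mathbb T=\mathbb R/\mathbb Z$ (written additively). For $p(t)=\sum_k a_kt^k\in\mathbb Z[t]$ and a measurable $f:X\to\mathbb T$, let $p(T)[f]:X\to\mathbb T$ be $\sum_k a_k\, f\circ T^k$. Define $$\mathrm P(X,T,\mu)=\{p\in\mathbb Z[t]: p\text{ is irreducible over }\mathbb Z\text{ and there is a non-constant measurable } f:X\to\mathbb T\text{ with } p(T)[f]=0\ \mu\text{-a.e.}\},$$ where non-constant means not $\mu$-a.e. equal to a constant. The rational spectrum of $T$ is the set of roots of unity that are eigenvalues of the Koopman operator $g\mapsto g\circ T$ on $L^2(\mu)$; equivalently (for ergodic $T$), it records the set $R(T)$ of integers $m\ge1$ such that $(X,T,\mu)$ has the rotation $t\mapsto t+1\bmod m$ on $\{0,\dots,m-1\}$ with normalized counting measure as a factor. *)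

theory Defs
  imports
    "HOL-Probability.Probability"
    "HOL-Computational_Algebra.Computational_Algebra"
begin

quotient_type circle = real / "\<lambda>x y. x - y \<in> \<int>"
proof (rule equivpI)
  show "reflp (\<lambda>x y::real. x - y \<in> \<int>)"
    by (simp add: reflp_def)
  show "symp (\<lambda>x y::real. x - y \<in> \<int>)"
    by (metis (no_types, lifting) Ints_minus minus_diff_eq sympI)
  show "transp (\<lambda>x y::real. x - y \<in> \<int>)"
  proof (rule transpI)
    fix x y z :: real
    assume "x - y \<in> \<int>" "y - z \<in> \<int>"
    then have "(x - y) + (y - z) \<in> \<int>" by (rule Ints_add)
    then show "x - z \<in> \<int>" by simp
  qed
qed

instantiation circle :: ab_group_add
begin

lift_definition zero_circle :: circle is 0 .

lift_definition plus_circle :: "circle \<Rightarrow> circle \<Rightarrow> circle" is "(+)"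
  by (metis Ints_add add_diff_add)

lift_definition uminus_circle :: "circle \<Rightarrow> circle" is uminus
  by (metis Ints_minus minus_diff_commute minus_diff_eq minus_diff_minus)

lift_definition minus_circle :: "circle \<Rightarrow> circle \<Rightarrow> circle" is "(-)"
  by (metis Ints_diff diff_diff_add add_diff_add diff_add_eq diff_diff_eq2
      add.commute diff_add_eq_diff_diff_swap)

instance
  by (standard; transfer; simp add: algebra_simps)

end

text \<open>The quotient topology; \<^const>\<open>borel\<close> at this type is the Borel sigma-algebra it
  generates.\<close>

instantiation circle :: topological_space
begin

definition open_circle :: "circle set \<Rightarrow> bool"
  where "open_circle U \<longleftrightarrow> open (abs_circle -` U)"

instance
  by standard (auto simp: open_circle_def vimage_Union)

end

lift_definition int_scale :: "int \<Rightarrow> circle \<Rightarrow> circle" is "\<lambda>a x. of_int a * x"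
  by (metis Ints_mult Ints_of_int right_diff_distrib)

text \<open>Invertibility is understood modulo null sets, so only an almost everywhere inverse is
  required. It preserves the measures automatically. On \<open>{x. \<psi> (\<phi> x) = x}\<close> the map \<open>\<phi>\<close> is a
  bijection onto \<open>{y. \<phi> (\<psi> y) = y}\<close>, so this is the usual isomorphism between conull sets.\<close>

definition iso_mod_null :: "'a measure \<Rightarrow> 'b measure \<Rightarrow> ('a \<Rightarrow> 'b) \<Rightarrow> bool"
  where "iso_mod_null M N \<phi> \<longleftrightarrow>
    \<phi> \<in> measurable M N \<and> distr M N \<phi> = N \<and>
    (\<exists>\<psi>\<in>measurable N M. (AE x in M. \<psi> (\<phi> x) = x) \<and> (AE y in N. \<phi> (\<psi> y) = y))"

text \<open>Passing to the completion of \<open>M\<close> admits both conventions for Lebesgue spaces: complete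
  measures in the sense of Rokhlin, and Borel measures on standard Borel spaces.\<close>

definition nonatomic_lebesgue_prob_space :: "'a measure \<Rightarrow> bool"
  where "nonatomic_lebesgue_prob_space M \<longleftrightarrow>
    prob_space M \<and> (\<exists>\<phi>. iso_mod_null (completion M) (lebesgue_on {0..1::real}) \<phi>)"

definition invertible_mpt :: "'a measure \<Rightarrow> ('a \<Rightarrow> 'a) \<Rightarrow> bool"
  where "invertible_mpt M T \<longleftrightarrow> iso_mod_null M M T"

definition ergodic :: "'a measure \<Rightarrow> ('a \<Rightarrow> 'a) \<Rightarrow> bool"
  where "ergodic M T \<longleftrightarrow>
    (\<forall>A\<in>sets M. T -` A \<inter> space M = A \<longrightarrow> measure M A = 0 \<or> measure M A = 1)"

definition koopman_eigenvalue :: "'a measure \<Rightarrow> ('a \<Rightarrow> 'a) \<Rightarrow> complex \<Rightarrow> bool"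
  where "koopman_eigenvalue M T z \<longleftrightarrow>
    (\<exists>g\<in>borel_measurable M. integrable M (\<lambda>x. (norm (g x))\<^sup>2) \<and>
      \<not> (AE x in M. g x = 0) \<and> (AE x in M. g (T x) = z * g x))"

definition rational_spectrum :: "'a measure \<Rightarrow> ('a \<Rightarrow> 'a) \<Rightarrow> complex set"
  where "rational_spectrum M T = {z. (\<exists>n\<ge>1. z ^ n = 1) \<and> koopman_eigenvalue M T z}"

definition poly_action :: "int poly \<Rightarrow> ('a \<Rightarrow> 'a) \<Rightarrow> ('a \<Rightarrow> circle) \<Rightarrow> 'a \<Rightarrow> circle"
  where "poly_action p T f x = (\<Sum>k\<le>degree p. int_scale (coeff p k) (f ((T ^^ k) x)))"

text \<open>Irreducibility is in the ring of integer polynomials, so prime constants are included.\<close>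

definition P_set :: "'a measure \<Rightarrow> ('a \<Rightarrow> 'a) \<Rightarrow> int poly set"
  where "P_set M T = {p. irreducible p \<and>
    (\<exists>f\<in>measurable M (borel :: circle measure).
      \<not> (\<exists>c. AE x in M. f x = c) \<and> (AE x in M. poly_action p T f x = 0))}"

end

theory Submission
  imports Defs
begin

text \<open>
  If \<open>p\<close> divides some \<open>t ^ n - 1\<close>, a solution of \<open>p(T)[f] = 0\<close> is invariant under \<open>T ^ n\<close>, hence
  factors through a cyclic rotation of some order \<open>d\<close>; the rational spectrum decides whether
  \<open>T'\<close> has the same factor, and the solution can be copied. Prime constants always have
  solutions, \<open>t\<close> never does.

  In all remaining cases every nonatomic ergodic \<open>T\<close> has a nonconstant solution. Passing to the
  inverse, let \<open>p\<close> have a nonempty set \<open>R\<close> of roots of modulus at most 1. One looks for a real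
  \<open>f\<close> with \<open>p(T) f\<close> integer valued. By partial fractions this amounts to \<open>u(T x) = z u(x) + g(T x)\<close>
  for every root \<open>z\<close>, with a common integer-valued \<open>g\<close>. Roots outside the closed unit disc are
  solved by a series in the future of \<open>g\<close>. For \<open>R\<close>, since no root is a root of unity, recurrence of
  the powers shows that the integer polynomials evaluated on \<open>R\<close> are dense; so one can start with
  a tiny constant vector on a set \<open>B 0\<close>, propagate it by multiplication with \<open>z\<close>, and repair the errors
  at the successive returns to nested sets \<open>B n\<close> by jumps in this dense group, up to errors
  \<open>v0 / 2 ^ (n + 2)\<close>. The sets \<open>B n\<close> shrink so fast that the jumps, which are polynomials of unbounded
  degree, can be emitted in advance as integer inputs \<open>g\<close> with a convergent sum. On a part of \<open>B 0\<close> the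
  resulting \<open>f\<close> is so small that being constant modulo 1 would make it vanish, contradicting the
  starting vector. Gaussian integers replace the integers throughout, so that no
  conjugation symmetry has to be tracked; real or imaginary parts are taken at the end.
\<close>

section \<open>Roots of irreducible integer polynomials\<close>

text \<open>An input emitted \<open>i\<close> steps ahead contributes \<open>z ^ i\<close> to the
  coordinate of every root \<open>z\<close>. A polynomial jump is therefore realised by emitting its
  \<open>i\<close>-th coefficient \<open>i\<close> steps early: its degree is the time of
  anticipation, and degree, coefficient size and rarity of the jumps have to be balanced. Degree and
  size at level \<open>n\<close> depend only on the tolerance, so they are known before the sets are
  chosen, and the measure of \<open>B (Suc n)\<close> can be adapted to level \<open>Suc n\<close>.
  Level 0 resists this: the integral of its cost is a fixed multiple of the measure of
  \<open>B 0\<close>, and so is the amount that can be tolerated on \<open>B 0\<close>. It is tamed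
  by a long return time instead: seen from \<open>B 0\<close>, the next visit is so far away that
  little of it is anticipated. The point of making the cost small is discreteness. On a good part of
  \<open>B 0\<close> the inputs at the times from 1 to the degree of \<open>p\<close> are Gaussian
  integers of modulus below 1, so they vanish and each coordinate evolves by pure multiplication
  with \<open>z\<close>.\<close>

abbreviation cpoly :: "int poly \<Rightarrow> complex poly"
  where "cpoly p \<equiv> map_poly of_int p"

lemma cpoly_mult: "cpoly (p * q) = cpoly p * cpoly q"
  by (intro poly_eqI) (simp add: coeff_map_poly coeff_mult)

lemma cpoly_add: "cpoly (p + q) = cpoly p + cpoly q"
  by (intro poly_eqI) (simp add: coeff_map_poly)

lemma cpoly_smult: "cpoly (smult c p) = smult (of_int c) (cpoly p)"
  by (intro poly_eqI) (simp add: coeff_map_poly)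

lemma cpoly_pderiv: "cpoly (pderiv p) = pderiv (cpoly p)"
  by (intro poly_eqI) (simp add: coeff_map_poly coeff_pderiv)

lemma degree_cpoly [simp]: "degree (cpoly p) = degree p"
  by (rule degree_map_poly) auto

lemma cpoly_eq_0_iff [simp]: "cpoly p = 0 \<longleftrightarrow> p = 0"
  by (subst map_poly_eq_0_iff) auto

lemma poly_cpoly_altdef: "poly (cpoly p) z = (\<Sum>k\<le>degree p. of_int (coeff p k) * z ^ k)"
  by (simp add: poly_altdef coeff_map_poly)

text \<open>Let \<open>h\<close> be a polynomial of least degree vanishing at \<open>z\<close>. By
  pseudo-division, \<open>h\<close> divides a nonzero integer multiple of every polynomial vanishing
  at \<open>z\<close>. Since \<open>p\<close> is prime in the factorial ring of integer polynomials,
  it divides \<open>h\<close> and then \<open>q\<close>; the alternatives would make a nonzero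
  constant vanish at \<open>z\<close>.\<close>

lemma irreducible_dvd_if_common_root:
  fixes p q :: "int poly"
  assumes p: "irreducible p" and pz: "poly (cpoly p) z = 0" and qz: "poly (cpoly q) z = 0"
  shows "p dvd q"
proof -
  have p0: "p \<noteq> 0" using p by auto
  have prime: "prime_elem p" using p by (rule irreducible_imp_prime_elem)
  define P where "P = (\<lambda>n. \<exists>h::int poly. h \<noteq> 0 \<and> poly (cpoly h) z = 0 \<and> degree h = n)"
  have ex: "P (degree p)" using p0 pz by (auto simp: P_def)
  define n where "n = (LEAST n. P n)"
  have "P n" unfolding n_def by (rule LeastI[of P, OF ex])
  then obtain h where h: "h \<noteq> 0" "poly (cpoly h) z = 0" "degree h = n"
    by (auto simp: P_def)
  have least: "degree r \<ge> n" if "r \<noteq> 0" "poly (cpoly r) z = 0" for r :: "int poly"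
    unfolding n_def by (rule Least_le) (use that in \<open>auto simp: P_def\<close>)
  have div: "\<exists>c s. c \<noteq> 0 \<and> smult c r = h * s" if r: "poly (cpoly r) z = 0" for r :: "int poly"
  proof -
    obtain c s where cs: "c \<noteq> 0" "smult c r = h * s + pseudo_mod r h"
      using pseudo_mod(1)[OF h(1), of r] by blast
    have "pseudo_mod r h = 0"
    proof (rule ccontr)
      assume nz: "pseudo_mod r h \<noteq> 0"
      have "cpoly (smult c r) = cpoly h * cpoly s + cpoly (pseudo_mod r h)"
        by (simp only: cs(2) cpoly_add cpoly_mult)
      then have "poly (cpoly (smult c r)) z = poly (cpoly (pseudo_mod r h)) z"
        using h(2) by simp
      then have "poly (cpoly (pseudo_mod r h)) z = 0"
        using r by (simp add: cpoly_smult)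
      then show False using pseudo_mod(2)[OF h(1), of r] least[OF nz] h(3) nz by simp
    qed
    then show ?thesis using cs by auto
  qed
  obtain c s where cs: "c \<noteq> 0" "smult c p = h * s" using div[OF pz] by blast
  have "p dvd h * s" by (metis cs(2) dvd_smult dvd_refl)
  then consider "p dvd h" | "p dvd s" using prime prime_elem_dvd_multD by blast
  then have ph: "p dvd h"
  proof cases
    case 2
    then obtain t where "s = p * t" by auto
    then have "p * [:c:] = p * (h * t)" using cs(2) by (simp add: algebra_simps)
    then have eq: "[:c:] = h * t" using p0 mult_left_cancel by blast
    then have "poly (cpoly [:c:]) z = 0" using h(2) by (simp only: eq cpoly_mult) simp
    then show ?thesis using cs(1) by (simp add: map_poly_pCons)
  qed
  obtain c' s' where cs': "c' \<noteq> 0" "smult c' q = h * s'" using div[OF qz] by blast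
  have "p dvd [:c':] * q" using cs'(2) ph by simp
  then consider "p dvd [:c':]" | "p dvd q" using prime prime_elem_dvd_multD by blast
  then show ?thesis
  proof cases
    case 1
    then obtain t where eq: "[:c':] = p * t" by auto
    then have "poly (cpoly [:c':]) z = 0" using pz by (simp only: eq cpoly_mult) simp
    then show ?thesis using cs'(1) by (simp add: map_poly_pCons)
  qed
qed

text \<open>A double root would be shared with the derivative, which would then be a nonzero
  multiple of \<open>p\<close> of smaller degree.\<close>

lemma irreducible_imp_rsquarefree_cpoly:
  assumes p: "irreducible p" and d: "degree p > 0"
  shows "rsquarefree (cpoly p)"
  unfolding rsquarefree_roots
proof (intro allI notI)
  fix a assume a: "poly (cpoly p) a = 0 \<and> poly (pderiv (cpoly p)) a = 0"
  then have "p dvd pderiv p"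
    using irreducible_dvd_if_common_root[OF p, of a "pderiv p"] by (simp add: cpoly_pderiv)
  moreover have "pderiv p \<noteq> 0" using d by (simp add: pderiv_eq_0_iff)
  ultimately have "degree p \<le> degree (pderiv p)" by (rule dvd_imp_degree_le)
  then show False using d by (simp add: degree_pderiv)
qed

lemma card_roots_cpoly:
  assumes p: "irreducible p" and d: "degree p > 0"
  shows "finite {z. poly (cpoly p) z = 0}" "card {z. poly (cpoly p) z = 0} = degree p"
proof -
  have p0: "cpoly p \<noteq> 0" using d by auto
  show fin: "finite {z. poly (cpoly p) z = 0}" using p0 by (rule poly_roots_finite)
  have "cpoly p = smult (lead_coeff (cpoly p)) (\<Prod>z|poly (cpoly p) z = 0. [:-z, 1:])"
    using complex_poly_decompose_rsquarefree[OF irreducible_imp_rsquarefree_cpoly[OF assms]] by simp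
  then have "degree (cpoly p) = degree (\<Prod>z|poly (cpoly p) z = 0. [:-z, 1:])"
    using p0 by (metis degree_smult_eq leading_coeff_0_iff)
  also have "\<dots> = card {z. poly (cpoly p) z = 0}"
    by (subst degree_prod_sum_eq) auto
  finally show "card {z. poly (cpoly p) z = 0} = degree p" by simp
qed

section \<open>Lagrange interpolation and the partial fractions of 1 / p\<close>

definition lagrange_basis :: "complex set \<Rightarrow> complex \<Rightarrow> complex poly"
  where "lagrange_basis Z a = (\<Prod>b\<in>Z - {a}. smult (1 / (a - b)) [:- b, 1:])"

lemma poly_lagrange_basis:
  assumes "finite Z" "b \<in> Z"
  shows "poly (lagrange_basis Z a) b = (if a = b then 1 else 0)"
proof (cases "a = b")
  case True
  have "poly (lagrange_basis Z b) b = (\<Prod>c\<in>Z - {b}. 1)"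
    unfolding lagrange_basis_def poly_prod by (intro prod.cong) (auto simp: field_simps)
  then show ?thesis using True by simp
next
  case False
  then show ?thesis using assms
    by (auto simp: lagrange_basis_def poly_prod intro!: prod_zero bexI[of _ b])
qed

lemma degree_lagrange_basis:
  assumes "finite Z" "a \<in> Z"
  shows "degree (lagrange_basis Z a) = card Z - 1"
proof -
  have "degree (lagrange_basis Z a) = (\<Sum>b\<in>Z - {a}. degree (smult (1 / (a - b)) [:- b, 1:]))"
    unfolding lagrange_basis_def by (intro degree_prod_sum_eq) auto
  also have "\<dots> = (\<Sum>b\<in>Z - {a}. 1)" by (intro sum.cong) auto
  finally show ?thesis using assms by simp
qed

lemma lagrange_interpolation:
  assumes Z: "finite Z" and h: "degree h < card Z"
  shows "h = (\<Sum>a\<in>Z. smult (poly h a) (lagrange_basis Z a))" (is "_ = ?r")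
proof (rule ccontr)
  assume ne: "h \<noteq> ?r"
  have "degree ?r \<le> card Z - 1"
    by (intro degree_sum_le Z order.trans[OF degree_smult_le]) (simp add: degree_lagrange_basis Z)
  then have deg: "degree (h - ?r) < card Z"
    using h by (intro le_less_trans[OF degree_diff_le_max]) auto
  have "poly (h - ?r) a = 0" if "a \<in> Z" for a
    using that Z by (simp add: poly_sum poly_lagrange_basis if_distrib[of "(*) _"] sum.If_cases)
  then have "Z \<subseteq> {a. poly (h - ?r) a = 0}" by auto
  then have "card Z \<le> card {a. poly (h - ?r) a = 0}"
    using ne by (intro card_mono poly_roots_finite) auto
  also have "\<dots> \<le> degree (h - ?r)" using ne by (intro card_poly_roots_bound) auto
  finally show False using deg by simp
qed

text \<open>The weights are the residues 1 / p'(z) of 1 / p: the leading coefficient of the Lagrange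
  basis polynomial is the inverse of the product of the differences \<open>z - b\<close>. Their
  power sums are read off by interpolating \<open>t ^ i\<close> and comparing the coefficients at
  \<open>degree p - 1\<close>.\<close>

lemma partial_fraction_weights:
  assumes p: "irreducible p" and d: "degree p > 0"
  defines "Z \<equiv> {z. poly (cpoly p) z = 0}"
  shows "\<exists>\<alpha>. (\<forall>z\<in>Z. \<alpha> z \<noteq> 0) \<and> (\<forall>i<degree p.
      of_int (lead_coeff p) * (\<Sum>z\<in>Z. \<alpha> z * z ^ i) = (if Suc i = degree p then 1 else 0))"
proof (intro exI[of _ "\<lambda>z. coeff (lagrange_basis Z z) (degree p - 1) / of_int (lead_coeff p)"]
    conjI ballI allI impI)
  let ?\<alpha> = "\<lambda>z. coeff (lagrange_basis Z z) (degree p - 1) / of_int (lead_coeff p)"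
  have Z: "finite Z" "card Z = degree p" using card_roots_cpoly[OF p d] by (auto simp: Z_def)
  have l0: "lead_coeff p \<noteq> 0" using d by auto
  show "?\<alpha> z \<noteq> 0" if "z \<in> Z" for z
  proof -
    have "lagrange_basis Z z \<noteq> 0"
      using poly_lagrange_basis[OF Z(1) that, of z] by auto
    then have "coeff (lagrange_basis Z z) (degree p - 1) \<noteq> 0"
      using degree_lagrange_basis[OF Z(1) that] Z(2) by (metis leading_coeff_0_iff)
    then show ?thesis using l0 by simp
  qed
  show "of_int (lead_coeff p) * (\<Sum>z\<in>Z. ?\<alpha> z * z ^ i) = (if Suc i = degree p then 1 else 0)"
    if i: "i < degree p" for i
  proof -
    have "monom (1::complex) i = (\<Sum>a\<in>Z. smult (poly (monom 1 i) a) (lagrange_basis Z a))"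
      by (rule lagrange_interpolation) (use Z i in \<open>simp_all add: degree_monom_eq\<close>)
    then have "coeff (monom (1::complex) i) (degree p - 1) =
        (\<Sum>z\<in>Z. z ^ i * coeff (lagrange_basis Z z) (degree p - 1))"
      by (simp add: coeff_sum poly_monom)
    moreover have "of_int (lead_coeff p) * (\<Sum>z\<in>Z. ?\<alpha> z * z ^ i) =
        (\<Sum>z\<in>Z. z ^ i * coeff (lagrange_basis Z z) (degree p - 1))"
      using l0 by (simp add: sum_distrib_left mult_ac)
    moreover have "i = degree p - 1 \<longleftrightarrow> Suc i = degree p" using i by auto
    ultimately show ?thesis by (simp only: coeff_monom)
  qed
qed

lemma affine_recurrence_closed_form:
  fixes u g :: "nat \<Rightarrow> complex"
  assumes "\<And>k. u (Suc k) = z * u k + g (Suc k)"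
  shows "u k = z ^ k * u 0 + (\<Sum>j=1..k. z ^ (k - j) * g j)"
proof (induction k)
  case (Suc k)
  have "(\<Sum>j=1..Suc k. z ^ (Suc k - j) * g j) = g (Suc k) + (\<Sum>j=1..k. z ^ (Suc k - j) * g j)"
    by simp
  also have "(\<Sum>j=1..k. z ^ (Suc k - j) * g j) = z * (\<Sum>j=1..k. z ^ (k - j) * g j)"
    unfolding sum_distrib_left by (intro sum.cong) (auto simp: Suc_diff_le)
  finally show ?case using Suc assms[of k] by (simp add: algebra_simps)
qed simp

text \<open>Applying \<open>p\<close> to the weighted sum kills the homogeneous parts, since each
  \<open>z\<close> is a root. Among the remaining powers \<open>z ^ (k - j)\<close> the weights
  select the exponent \<open>degree p - 1\<close>, which leaves only the input \<open>g 1\<close>.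
  Hence an integer-valued input makes \<open>p(T)\<close> of the sum integer valued.\<close>

lemma partial_fraction_solution:
  fixes \<alpha> :: "complex \<Rightarrow> complex" and u :: "complex \<Rightarrow> nat \<Rightarrow> complex"
  assumes d: "degree p > 0"
  defines "Z \<equiv> {z. poly (cpoly p) z = 0}"
  assumes \<alpha>: "\<And>i. i < degree p \<Longrightarrow>
      of_int (lead_coeff p) * (\<Sum>z\<in>Z. \<alpha> z * z ^ i) = (if Suc i = degree p then 1 else 0)"
    and u: "\<And>z k. z \<in> Z \<Longrightarrow> u z (Suc k) = z * u z k + g (Suc k)"
  shows "(\<Sum>k\<le>degree p. of_int (coeff p k) * (\<Sum>z\<in>Z. \<alpha> z * u z k)) = g 1"
proof -
  let ?d = "degree p"
  have "(\<Sum>k\<le>?d. of_int (coeff p k) * (\<Sum>z\<in>Z. \<alpha> z * u z k)) =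
     (\<Sum>k\<le>?d. of_int (coeff p k) * (\<Sum>z\<in>Z. \<alpha> z * (z ^ k * u z 0 + (\<Sum>j=1..k. z ^ (k - j) * g j))))"
    by (intro sum.cong refl arg_cong2[of _ _ _ _ "(*)"] affine_recurrence_closed_form u)
  also have "\<dots> = (\<Sum>k\<le>?d. \<Sum>z\<in>Z. of_int (coeff p k) * \<alpha> z * z ^ k * u z 0) +
      (\<Sum>k\<le>?d. \<Sum>z\<in>Z. \<Sum>j=1..k. of_int (coeff p k) * \<alpha> z * z ^ (k - j) * g j)"
    by (simp add: sum_distrib_left sum.distrib distrib_left mult_ac)
  also have "(\<Sum>k\<le>?d. \<Sum>z\<in>Z. of_int (coeff p k) * \<alpha> z * z ^ k * u z 0) =
      (\<Sum>z\<in>Z. \<alpha> z * u z 0 * poly (cpoly p) z)"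
    by (subst sum.swap) (simp add: poly_cpoly_altdef sum_distrib_left mult_ac)
  also have "\<dots> = 0" by (simp add: Z_def)
  also have "(\<Sum>k\<le>?d. \<Sum>z\<in>Z. \<Sum>j=1..k. of_int (coeff p k) * \<alpha> z * z ^ (k - j) * g j) =
      (\<Sum>k\<le>?d. \<Sum>j=1..k. of_int (coeff p k) * g j * (\<Sum>z\<in>Z. \<alpha> z * z ^ (k - j)))"
    by (subst sum.swap) (simp add: sum_distrib_left mult_ac)
  also have "\<dots> = (\<Sum>k\<le>?d. if k = ?d then g 1 else 0)"
  proof (intro sum.cong refl)
    fix k assume k: "k \<in> {..?d}"
    have l0: "of_int (lead_coeff p) \<noteq> (0::complex)" using d by auto
    have S: "(\<Sum>z\<in>Z. \<alpha> z * z ^ i) = (if Suc i = ?d then 1 / of_int (lead_coeff p) else 0)"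
      if "i < ?d" for i using \<alpha>[OF that] l0 by (auto simp: field_simps split: if_splits)
    have "(\<Sum>j=1..k. of_int (coeff p k) * g j * (\<Sum>z\<in>Z. \<alpha> z * z ^ (k - j))) =
        (\<Sum>j=1..k. if j = 1 \<and> k = ?d then g j else 0)"
    proof (intro sum.cong refl)
      fix j assume j: "j \<in> {1..k}"
      have "Suc (k - j) = ?d \<longleftrightarrow> j = 1 \<and> k = ?d" using j k by auto
      then show "of_int (coeff p k) * g j * (\<Sum>z\<in>Z. \<alpha> z * z ^ (k - j)) =
          (if j = 1 \<and> k = ?d then g j else 0)"
        using S[of "k - j"] j k l0 by (cases "k - j < ?d") auto
    qed
    also have "\<dots> = (if k = ?d then g 1 else 0)"
      using d by (auto simp: sum.delta)
    finally show "(\<Sum>j=1..k. of_int (coeff p k) * g j * (\<Sum>z\<in>Z. \<alpha> z * z ^ (k - j))) =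
      (if k = ?d then g 1 else 0)" .
  qed
  also have "\<dots> = g 1" by simp
  finally show ?thesis by simp
qed

text \<open>The Vandermonde matrix is invertible: pairing the power sums with the coefficients of a
  Lagrange basis polynomial isolates \<open>w b\<close>.\<close>

lemma power_sums_zero_imp_zero:
  fixes w :: "complex \<Rightarrow> complex"
  assumes Z: "finite Z" and z: "\<And>k. k < card Z \<Longrightarrow> (\<Sum>a\<in>Z. w a * a ^ k) = 0" and b: "b \<in> Z"
  shows "w b = 0"
proof -
  have "w b = (\<Sum>a\<in>Z. w a * poly (lagrange_basis Z b) a)"
    using Z b by (simp add: poly_lagrange_basis if_distrib[of "(*) _"] sum.delta' cong: if_cong)
  also have "\<dots> = (\<Sum>k\<le>card Z - 1. coeff (lagrange_basis Z b) k * (\<Sum>a\<in>Z. w a * a ^ k))"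
    using degree_lagrange_basis[OF Z b]
    by (subst sum_distrib_left, subst sum.swap) (simp add: poly_altdef sum_distrib_left mult_ac)
  also have "\<dots> = 0"
  proof (intro sum.neutral ballI)
    fix k assume "k \<in> {..card Z - 1}"
    moreover have "card Z > 0" using Z b card_gt_0_iff by blast
    ultimately have "k < card Z" by auto
    then show "coeff (lagrange_basis Z b) k * (\<Sum>a\<in>Z. w a * a ^ k) = 0" by (simp add: z)
  qed
  finally show ?thesis .
qed

section \<open>Approximation by Gaussian integer combinations of powers\<close>

definition gauss_round :: "complex \<Rightarrow> complex"
  where "gauss_round z = Complex (of_int \<lfloor>Re z\<rfloor>) (of_int \<lfloor>Im z\<rfloor>)"

definition gauss_int :: "complex set"
  where "gauss_int = {z. Re z \<in> \<int> \<and> Im z \<in> \<int>}"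

lemma gauss_int_0 [simp]: "0 \<in> gauss_int" by (simp add: gauss_int_def)

lemma gauss_int_diff: "x \<in> gauss_int \<Longrightarrow> y \<in> gauss_int \<Longrightarrow> x - y \<in> gauss_int"
  by (simp add: gauss_int_def)

lemma gauss_int_sum: "(\<And>i. i \<in> A \<Longrightarrow> f i \<in> gauss_int) \<Longrightarrow> sum f A \<in> gauss_int"
  by (auto simp: gauss_int_def intro!: Ints_sum)

lemma gauss_int_small: "z \<in> gauss_int \<Longrightarrow> norm z < 1 \<Longrightarrow> z = 0"
proof -
  assume z: "z \<in> gauss_int" "norm z < 1"
  then have "\<bar>Re z\<bar> < 1" "\<bar>Im z\<bar> < 1"
    using abs_Re_le_cmod[of z] abs_Im_le_cmod[of z] by linarith+
  then have "Re z = 0" "Im z = 0"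
    using z Ints_nonzero_abs_less1 by (auto simp: gauss_int_def)
  then show ?thesis by (simp add: complex_eq_iff)
qed

lemma gauss_round_in: "gauss_round z \<in> gauss_int"
  by (simp add: gauss_round_def gauss_int_def)

lemma norm_diff_gauss_round: "norm (z - gauss_round z) \<le> 2"
proof -
  have "norm (z - gauss_round z) \<le> \<bar>Re (z - gauss_round z)\<bar> + \<bar>Im (z - gauss_round z)\<bar>"
    by (rule cmod_le)
  also have "\<dots> \<le> 1 + 1"
    by (intro add_mono) (simp_all add: gauss_round_def, linarith+)
  finally show ?thesis by simp
qed

lemma measurable_gauss_round [measurable]: "gauss_round \<in> borel_measurable borel"
  unfolding gauss_round_def complex_eq_iff by (subst borel_measurable_complex_iff) simp

text \<open>Pigeonhole on the grid cells of side \<open>1 / N\<close> that contain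
  \<open>z ^ i\<close>, taken for all \<open>z\<close> in \<open>R\<close> at once, so that
  \<open>a\<close> and \<open>b\<close> are common to all roots. The closed disc confines the powers
  to finitely many cells.\<close>

lemma powers_recur:
  assumes R: "finite R" "\<And>z. z \<in> R \<Longrightarrow> norm z \<le> (1::real)" and e: "e > 0"
  obtains a b :: nat where "a < b" "\<And>z::complex. z \<in> R \<Longrightarrow> norm (z ^ b - z ^ a) < e"
proof -
  obtain N :: nat where N: "2 / e < real N" using reals_Archimedean2 by blast
  then have N0: "real N > 0" using e by (smt (verit) divide_pos_pos)
  define box where "box = (\<lambda>i. \<lambda>z\<in>R. (\<lfloor>real N * Re (z ^ i)\<rfloor>, \<lfloor>real N * Im (z ^ i)\<rfloor>))"
  have fl: "\<lfloor>real N * t\<rfloor> \<in> {- int N..int N}" if "\<bar>t\<bar> \<le> 1" for t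
  proof -
    have "real N * t \<le> real N * 1" "real N * (- 1) \<le> real N * t"
      using that by (intro mult_left_mono; simp)+
    then show ?thesis by (auto simp: floor_le_iff le_floor_iff)
  qed
  have "box i \<in> PiE R (\<lambda>_. {- int N..int N} \<times> {- int N..int N})" for i
    unfolding box_def
  proof (intro restrict_PiE_iff[THEN iffD2] ballI)
    fix z assume "z \<in> R"
    then have "norm (z ^ i) \<le> 1" using R(2) by (simp add: norm_power power_le_one)
    then show "(\<lfloor>real N * Re (z ^ i)\<rfloor>, \<lfloor>real N * Im (z ^ i)\<rfloor>) \<in> {- int N..int N} \<times> {- int N..int N}"
      using fl abs_Re_le_cmod[of "z ^ i"] abs_Im_le_cmod[of "z ^ i"] by fastforce
  qed
  then have "range box \<subseteq> PiE R (\<lambda>_. {- int N..int N} \<times> {- int N..int N})" by blast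
  moreover have "finite (PiE R (\<lambda>_. {- int N..int N} \<times> {- int N..int N}))"
    using R(1) by (intro finite_PiE) auto
  ultimately have "finite (range box)" by (rule finite_subset)
  then have "\<not> inj box" using finite_imageD infinite_UNIV_nat by blast
  then obtain a b where ab: "a < b" "box a = box b"
    by (metis injI linorder_neqE_nat)
  show ?thesis
  proof (rule that[OF ab(1)])
    fix z assume z: "z \<in> R"
    have *: "\<bar>s - t\<bar> < 1 / real N" if "\<lfloor>real N * s\<rfloor> = \<lfloor>real N * t\<rfloor>" for s t
    proof -
      have "\<bar>real N * s - real N * t\<bar> < 1" using that by linarith
      then have "real N * \<bar>s - t\<bar> < 1" using N0 by (simp add: abs_mult flip: right_diff_distrib)
      then show ?thesis using N0 by (simp add: field_simps)
    qed
    have "box a z = box b z" using ab(2) by simp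
    then have "\<bar>Re (z ^ b - z ^ a)\<bar> < 1 / real N" "\<bar>Im (z ^ b - z ^ a)\<bar> < 1 / real N"
      using z * unfolding box_def by auto
    then have "norm (z ^ b - z ^ a) < 2 / real N"
      using cmod_le[of "z ^ b - z ^ a"] by simp
    also have "\<dots> < e" using N N0 e by (simp add: field_simps)
    finally show "norm (z ^ b - z ^ a) < e" .
  qed
qed

text \<open>The small nonzero polynomial \<open>t ^ b - t ^ a\<close> of \<open>powers_recur\<close> generates,
  together with its multiples by powers of \<open>t\<close>, a subgroup that is dense up to the chosen error,
  because multiplication by \<open>t\<close> does not expand any coordinate in \<open>R\<close>.\<close>

lemma steering:
  assumes R: "finite R" "\<And>z. z \<in> R \<Longrightarrow> norm z \<le> (1::real)"
    and nz: "\<And>z. z \<in> R \<Longrightarrow> z \<noteq> 0" and nru: "\<And>z n. z \<in> R \<Longrightarrow> n > 0 \<Longrightarrow> z ^ n \<noteq> 1"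
    and e: "e > 0"
  obtains \<kappa> :: "nat \<Rightarrow> (complex \<Rightarrow> complex) \<Rightarrow> complex" and m :: nat and H :: real
  where "\<And>i w. \<kappa> i w \<in> gauss_int"
    and "\<And>i. \<kappa> i \<in> borel_measurable (PiM R (\<lambda>_. borel))"
    and "\<And>i w. i \<ge> m \<Longrightarrow> \<kappa> i w = 0"
    and "H > 0" "\<And>i w. (\<And>z. z \<in> R \<Longrightarrow> norm (w z) \<le> 4) \<Longrightarrow> norm (\<kappa> i w) \<le> H"
    and "\<And>w z. z \<in> R \<Longrightarrow> norm (w z - (\<Sum>i<m. \<kappa> i w * z ^ i)) \<le> e"
proof -
  define r where "r = card R"
  \<comment> \<open>There are \<open>r\<close> coefficients to round, each with an error of at most
    2, so a factor \<open>q z\<close> of modulus below \<open>e'\<close> keeps the total error below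
    \<open>e\<close>.\<close>
  define e' where "e' = e / (2 * r + 1)"
  have e': "e' > 0" using e by (simp add: e'_def)
  obtain a b where ab: "a < b" and small: "\<And>z. z \<in> R \<Longrightarrow> norm (z ^ b - z ^ a) < e'"
    using powers_recur[OF R e'] by metis
  define q where "q = (\<lambda>z::complex. z ^ b - z ^ a)"
  have q0: "q z \<noteq> 0" if "z \<in> R" for z
  proof
    assume "q z = 0"
    then have "z ^ a * z ^ (b - a) = z ^ a * 1" using ab by (simp add: q_def flip: power_add)
    then have "z ^ (b - a) = 1" using nz[OF that] by simp
    then show False using nru[OF that, of "b - a"] ab by simp
  qed
  \<comment> \<open>The \<open>c i w\<close> are the coefficients of the polynomial that
    interpolates \<open>w / q\<close> on \<open>R\<close>. Rounding them and multiplying by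
    \<open>t ^ b - t ^ a\<close> gives the coefficients \<open>\<kappa>\<close>.\<close>
  define c where "c = (\<lambda>i (w::complex \<Rightarrow> complex). \<Sum>z\<in>R. w z / q z * coeff (lagrange_basis R z) i)"
  define \<kappa> where "\<kappa> = (\<lambda>i w. (if b \<le> i \<and> i < b + r then gauss_round (c (i - b) w) else 0)
      - (if a \<le> i \<and> i < a + r then gauss_round (c (i - a) w) else 0))"
  define C where "C = (\<lambda>i. \<Sum>z\<in>R. norm (4 / q z * coeff (lagrange_basis R z) i))"
  define H where "H = 2 * ((\<Sum>i<r. C i) + 2) + 1"
  have C0: "C i \<ge> 0" for i by (simp add: C_def sum_nonneg)
  have interp: "(\<Sum>i<r. c i w * z ^ i) = w z / q z" if z: "z \<in> R" for w z
  proof -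
    have r: "r > 0" using R(1) z by (auto simp: r_def card_gt_0_iff)
    have "(\<Sum>i<r. c i w * z ^ i) = (\<Sum>x\<in>R. w x / q x * (\<Sum>i<r. coeff (lagrange_basis R x) i * z ^ i))"
      unfolding c_def by (simp add: sum_distrib_left sum_distrib_right mult_ac, subst sum.swap, rule refl)
    also have "\<dots> = (\<Sum>x\<in>R. w x / q x * poly (lagrange_basis R x) z)"
    proof (intro sum.cong refl arg_cong2[of _ _ _ _ "(*)"])
      fix x assume "x \<in> R"
      then have "{..degree (lagrange_basis R x)} = {..<r}"
        using r R(1) by (auto simp: degree_lagrange_basis r_def)
      then show "(\<Sum>i<r. coeff (lagrange_basis R x) i * z ^ i) = poly (lagrange_basis R x) z"
        by (simp add: poly_altdef)
    qed
    also have "\<dots> = w z / q z"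
      using R(1) z by (simp add: poly_lagrange_basis if_distrib[of "(*) _"] cong: if_cong)
    finally show ?thesis .
  qed
  have eval: "(\<Sum>i<b + r. \<kappa> i w * z ^ i) = q z * (\<Sum>i<r. gauss_round (c i w) * z ^ i)" for w z
  proof -
    have sh: "(\<Sum>i<b + r. (if s \<le> i \<and> i < s + r then gauss_round (c (i - s) w) else 0) * z ^ i) =
        z ^ s * (\<Sum>i<r. gauss_round (c i w) * z ^ i)" if "s \<le> b" for s
    proof -
      have "(\<Sum>i<b + r. (if s \<le> i \<and> i < s + r then gauss_round (c (i - s) w) else 0) * z ^ i) =
          (\<Sum>i\<in>{s..<s + r}. gauss_round (c (i - s) w) * z ^ i)"
        using that by (intro sum.mono_neutral_cong_right) auto
      also have "\<dots> = (\<Sum>i<r. gauss_round (c i w) * z ^ (i + s))"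
        by (rule sum.reindex_bij_witness[of _ "\<lambda>i. i + s" "\<lambda>i. i - s"]) auto
      finally show ?thesis by (simp add: sum_distrib_left power_add mult_ac)
    qed
    show ?thesis
      unfolding \<kappa>_def left_diff_distrib sum_subtractf q_def using sh[of b] sh[of a] ab by simp
  qed
  show ?thesis
  proof (rule that[of \<kappa> "b + r" H])
    show "\<kappa> i w \<in> gauss_int" for i w
      unfolding \<kappa>_def by (intro gauss_int_diff) (simp_all add: gauss_round_in)
    have c [measurable]: "c i \<in> borel_measurable (PiM R (\<lambda>_. borel))" for i
      unfolding c_def by measurable
    show "\<kappa> i \<in> borel_measurable (PiM R (\<lambda>_. borel))" for i
      unfolding \<kappa>_def by measurable
    show "\<kappa> i w = 0" if "i \<ge> b + r" for i w using that ab by (auto simp: \<kappa>_def)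
    have S0: "(\<Sum>i<r. C i) \<ge> 0" by (intro sum_nonneg C0)
    then show "H > 0" by (simp add: H_def)
    show "norm (\<kappa> i w) \<le> H" if w: "\<And>z. z \<in> R \<Longrightarrow> norm (w z) \<le> 4" for i w
    proof -
      have "norm (c i w) \<le> C i" for i
        unfolding c_def C_def
      proof (intro sum_norm_le)
        fix z assume "z \<in> R"
        then show "norm (w z / q z * coeff (lagrange_basis R z) i) \<le> norm (4 / q z * coeff (lagrange_basis R z) i)"
          using w by (simp add: norm_mult norm_divide divide_right_mono mult_right_mono)
      qed
      moreover have "C i \<le> (\<Sum>i<r. C i)" if "i < r" for i
        using that C0 by (intro member_le_sum) auto
      moreover have "norm (gauss_round z) \<le> norm z + 2" for z
        using norm_diff_gauss_round[of z] norm_triangle_ineq2[of "gauss_round z" z]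
        by (simp add: norm_minus_commute)
      ultimately have g: "norm (gauss_round (c i w)) \<le> (\<Sum>i<r. C i) + 2" if "i < r" for i
        using that by (meson add_right_mono order_trans)
      have B: "norm (if s \<le> i \<and> i < s + r then gauss_round (c (i - s) w) else 0) \<le> (\<Sum>i<r. C i) + 2" for s
        using g[of "i - s"] S0 by auto
      have "norm (\<kappa> i w) \<le> ((\<Sum>i<r. C i) + 2) + ((\<Sum>i<r. C i) + 2)"
        unfolding \<kappa>_def by (rule order_trans[OF norm_triangle_ineq4 add_mono[OF B B]])
      then show ?thesis by (simp add: H_def)
    qed
    show "norm (w z - (\<Sum>i<b + r. \<kappa> i w * z ^ i)) \<le> e" if z: "z \<in> R" for w z
    proof -
      have "w z - (\<Sum>i<b + r. \<kappa> i w * z ^ i) = q z * (\<Sum>i<r. (c i w - gauss_round (c i w)) * z ^ i)"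
        unfolding eval left_diff_distrib sum_subtractf interp[OF z] right_diff_distrib
        using q0[OF z] by simp
      also have "norm \<dots> \<le> e' * (\<Sum>i<r. 2 * 1)"
        unfolding norm_mult
      proof (intro mult_mono sum_norm_le)
        show "norm (q z) \<le> e'" using small[OF z] by (simp add: q_def)
        show "norm ((c i w - gauss_round (c i w)) * z ^ i) \<le> 2 * 1" for i
          unfolding norm_mult norm_power
          by (intro mult_mono norm_diff_gauss_round power_le_one R(2)[OF z]) auto
      qed (use e' in auto)
      also have "\<dots> \<le> e" using e by (simp add: e'_def field_simps)
      finally show ?thesis .
    qed
  qed
qed

section \<open>Ergodic transformations\<close>

text \<open>The almost everywhere inverse \<open>S\<close> is a parameter of the locale, so that
  time reversal is the exchange of \<open>T\<close> and \<open>S\<close>.\<close>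

locale ergodic_mpt = prob_space M for M :: "'a measure" +
  fixes T S :: "'a \<Rightarrow> 'a"
  assumes T [measurable]: "T \<in> measurable M M" and S [measurable]: "S \<in> measurable M M"
    and distr_T: "distr M M T = M"
    and ST: "AE x in M. S (T x) = x" and TS: "AE x in M. T (S x) = x"
    and ergodic: "ergodic M T"
begin

lemma funpow_T [measurable]: "(T ^^ k) \<in> measurable M M"
proof (induction k)
  case (Suc k)
  then show ?case unfolding funpow.simps by (rule measurable_comp[OF _ T])
qed (simp add: id_def)

lemma funpow_S [measurable]: "(S ^^ k) \<in> measurable M M"
proof (induction k)
  case (Suc k)
  then show ?case unfolding funpow.simps by (rule measurable_comp[OF _ S])
qed (simp add: id_def)

lemma distr_S: "distr M M S = M"
proof -
  have "distr M M S = distr (distr M M T) M S" by (simp add: distr_T)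
  also have "\<dots> = distr M M (S \<circ> T)" by (rule distr_distr) auto
  also have "\<dots> = distr M M (\<lambda>x. x)" using ST by (intro distr_cong_AE) auto
  finally show ?thesis by (simp add: distr_id)
qed

lemma AE_T: "AE x in M. P x \<Longrightarrow> AE x in M. P (T x)"
  using AE_distrD[OF T, of P] unfolding distr_T .

lemma AE_S: "AE x in M. P x \<Longrightarrow> AE x in M. P (S x)"
  using AE_distrD[OF S, of P] unfolding distr_S .

lemma AE_funpow_T: "AE x in M. P x \<Longrightarrow> AE x in M. P ((T ^^ k) x)"
proof (induction k arbitrary: P)
  case (Suc k)
  from Suc.IH[OF AE_T[OF Suc.prems]] show ?case by simp
qed simp

lemma AE_all_funpow_T: "AE x in M. P x \<Longrightarrow> AE x in M. \<forall>k. P ((T ^^ k) x)"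
  by (simp add: AE_all_countable AE_funpow_T)

lemma distr_funpow_T: "distr M M (T ^^ k) = M"
proof (induction k)
  case (Suc k)
  have "distr M M (T ^^ Suc k) = distr (distr M M (T ^^ k)) M T"
    unfolding funpow.simps by (rule distr_distr[symmetric]) auto
  then show ?case unfolding Suc distr_T .
qed (simp add: distr_id id_def)

lemma prob_funpow_T:
  assumes "A \<in> sets M"
  shows "prob ((T ^^ k) -` A \<inter> space M) = prob A"
  using measure_distr[OF funpow_T assms, of k] by (simp add: distr_funpow_T)

text \<open>Ergodicity is formulated for strictly invariant sets. The set \<open>A'\<close> of
  points that visit \<open>A\<close> infinitely often is strictly invariant and agrees with
  \<open>A\<close> almost everywhere.\<close>

lemma zero_one_of_AE_invariant:
  assumes A [measurable]: "A \<in> sets M" and inv: "AE x in M. T x \<in> A \<longleftrightarrow> x \<in> A"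
  shows "prob A = 0 \<or> prob A = 1"
proof -
  define A' where "A' = {x \<in> space M. \<forall>n. \<exists>k\<ge>n. (T ^^ k) x \<in> A}"
  have A' [measurable]: "A' \<in> sets M" unfolding A'_def by measurable
  have "T x \<in> A' \<longleftrightarrow> x \<in> A'" if x: "x \<in> space M" for x
  proof -
    have "(\<forall>n. \<exists>k\<ge>n. (T ^^ Suc k) x \<in> A) \<longleftrightarrow> (\<forall>n. \<exists>k\<ge>n. (T ^^ k) x \<in> A)"
      by (metis Suc_le_D Suc_le_mono le_SucI)
    then show ?thesis
      using x measurable_space[OF T] by (simp add: A'_def funpow_swap1)
  qed
  then have "T -` A' \<inter> space M = A'" by (auto simp: A'_def)
  then have "prob A' = 0 \<or> prob A' = 1" using ergodic A' by (simp add: ergodic_def)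
  moreover have "AE x in M. x \<in> A \<longleftrightarrow> x \<in> A'"
    using AE_all_funpow_T[OF inv]
  proof eventually_elim
    case (elim x)
    have "(T ^^ k) x \<in> A \<longleftrightarrow> x \<in> A" for k
      using elim by (induction k) auto
    then show ?case using sets.sets_into_space[OF A] by (auto simp: A'_def)
  qed
  then have "prob A = prob A'" by (intro measure_eq_AE) auto
  ultimately show ?thesis by simp
qed

text \<open>A set contained in its preimage up to null sets has the same measure as the preimage,
  because \<open>T\<close> preserves the measure; so the two agree up to null sets.\<close>

lemma zero_one_of_AE_subinvariant:
  assumes A [measurable]: "A \<in> sets M" and inv: "AE x in M. x \<in> A \<longrightarrow> T x \<in> A"
  shows "prob A = 0 \<or> prob A = 1"
proof (rule zero_one_of_AE_invariant[OF A])
  let ?TA = "T -` A \<inter> space M"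
  have "prob ?TA = prob A" using prob_funpow_T[OF A, of 1] by simp
  moreover have "prob (A \<inter> ?TA) = prob A"
    using inv sets.sets_into_space[OF A] by (intro measure_eq_AE) auto
  moreover have "prob (?TA - A \<inter> ?TA) = prob ?TA - prob (A \<inter> ?TA)"
    by (intro finite_measure_Diff) auto
  ultimately have "prob (?TA - A \<inter> ?TA) = 0" by simp
  then have "AE x in M. x \<notin> ?TA - A \<inter> ?TA"
    by (simp add: prob_eq_0)
  then show "AE x in M. T x \<in> A \<longleftrightarrow> x \<in> A"
    using inv AE_space by eventually_elim auto
qed

text \<open>At each rational threshold one alternative holds almost everywhere on \<open>A\<close>.
  Together these countably many decisions form a cut, realised by some point \<open>x0\<close> of
  \<open>A\<close>; almost every point of \<open>A\<close> has the same cut and therefore the same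
  value.\<close>

lemma AE_const_on_of_zero_one:
  fixes h :: "'a \<Rightarrow> real"
  assumes "\<And>t. (AE x in M. x \<in> A \<longrightarrow> h x \<le> t) \<or> (AE x in M. x \<in> A \<longrightarrow> t < h x)"
  shows "\<exists>c. AE x in M. x \<in> A \<longrightarrow> h x = c"
proof (cases "AE x in M. x \<notin> A")
  case True
  then show ?thesis by auto
next
  case False
  define Q where "Q = {q::rat. AE x in M. x \<in> A \<longrightarrow> h x \<le> of_rat q}"
  have "AE x in M. x \<in> A \<longrightarrow> (q \<in> Q \<longleftrightarrow> h x \<le> of_rat q)" for q
    using assms[of "of_rat q"]
  proof
    assume a: "AE x in M. x \<in> A \<longrightarrow> h x \<le> of_rat q"
    then have "q \<in> Q" by (simp add: Q_def)
    then show ?thesis using a by simp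
  next
    assume a: "AE x in M. x \<in> A \<longrightarrow> of_rat q < h x"
    have "q \<notin> Q"
    proof
      assume "q \<in> Q"
      then have "AE x in M. x \<in> A \<longrightarrow> h x \<le> of_rat q" by (simp add: Q_def)
      with a have "AE x in M. x \<notin> A" by eventually_elim auto
      then show False using False by blast
    qed
    from a show ?thesis by eventually_elim (use \<open>q \<notin> Q\<close> in auto)
  qed
  then have sep: "AE x in M. \<forall>q. x \<in> A \<longrightarrow> (q \<in> Q \<longleftrightarrow> h x \<le> of_rat q)"
    by (subst AE_all_countable) blast
  have "\<exists>x. x \<in> A \<and> (\<forall>q. q \<in> Q \<longleftrightarrow> h x \<le> of_rat q)"
  proof (rule ccontr)
    assume no: "\<not> ?thesis"
    from sep have "AE x in M. x \<notin> A" by eventually_elim (use no in blast)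
    then show False using False by blast
  qed
  then obtain x0 where x0: "\<And>q. q \<in> Q \<longleftrightarrow> h x0 \<le> of_rat q" by blast
  have "AE x in M. x \<in> A \<longrightarrow> h x = h x0"
    using sep
  proof eventually_elim
    case (elim x)
    show ?case
    proof
      assume "x \<in> A"
      then have *: "h x \<le> of_rat q \<longleftrightarrow> h x0 \<le> of_rat q" for q using elim x0 by blast
      show "h x = h x0"
      proof (rule ccontr)
        assume "h x \<noteq> h x0"
        then consider "h x < h x0" | "h x0 < h x" by linarith
        then show False
          by cases (meson * of_rat_dense not_le less_imp_le)+
      qed
    qed
  qed
  then show ?thesis by blast
qed

lemma AE_const_of_AE_invariant_real:
  fixes h :: "'a \<Rightarrow> real"
  assumes [measurable]: "h \<in> borel_measurable M" and inv: "AE x in M. h (T x) = h x"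
  shows "\<exists>c. AE x in M. h x = c"
proof -
  have "(AE x in M. x \<in> UNIV \<longrightarrow> h x \<le> t) \<or> (AE x in M. x \<in> UNIV \<longrightarrow> t < h x)" for t
  proof -
    have "prob {x \<in> space M. h x \<le> t} = 0 \<or> prob {x \<in> space M. h x \<le> t} = 1"
    proof (rule zero_one_of_AE_invariant)
      show "AE x in M. (T x \<in> {x \<in> space M. h x \<le> t}) = (x \<in> {x \<in> space M. h x \<le> t})"
        using inv AE_space by eventually_elim (use measurable_space[OF T] in auto)
    qed measurable
    then show ?thesis
    proof
      assume "prob {x \<in> space M. h x \<le> t} = 0"
      then have "AE x in M. \<not> h x \<le> t" by (subst (asm) prob_Collect_eq_0) auto
      then show ?thesis by (auto simp: not_le)
    next
      assume "prob {x \<in> space M. h x \<le> t} = 1"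
      then have "AE x in M. h x \<le> t" by (subst (asm) prob_Collect_eq_1) auto
      then show ?thesis by auto
    qed
  qed
  from AE_const_on_of_zero_one[OF this] show ?thesis by simp
qed

lemma AE_const_of_AE_invariant:
  fixes h :: "'a \<Rightarrow> complex"
  assumes [measurable]: "h \<in> borel_measurable M" and inv: "AE x in M. h (T x) = h x"
  shows "\<exists>c. AE x in M. h x = c"
proof -
  have "\<exists>c. AE x in M. Re (h x) = c" "\<exists>c. AE x in M. Im (h x) = c"
    by (rule AE_const_of_AE_invariant_real, measurable, use inv in auto)+
  then obtain a b where ab: "AE x in M. Re (h x) = a" "AE x in M. Im (h x) = b" by blast
  then have "AE x in M. h x = Complex a b" by eventually_elim (auto simp: complex_eq_iff)
  then show ?thesis by blast
qed

text \<open>The points whose backward orbit meets \<open>A\<close> form a set that contains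
  \<open>A\<close> and that \<open>T\<close> maps into itself almost everywhere.\<close>

lemma AE_backward_hits:
  assumes A [measurable]: "A \<in> sets M" and pos: "prob A > 0"
  shows "AE x in M. \<exists>k. (S ^^ k) x \<in> A"
proof -
  let ?H = "{x \<in> space M. \<exists>k. (S ^^ k) x \<in> A}"
  have "prob ?H = 0 \<or> prob ?H = 1"
  proof (rule zero_one_of_AE_subinvariant)
    show "AE x in M. x \<in> ?H \<longrightarrow> T x \<in> ?H"
      using ST AE_space
    proof eventually_elim
      case (elim x)
      have *: "(S ^^ Suc k) (T x) = (S ^^ k) x" for k
        using elim by (simp only: funpow_Suc_right comp_def)
      show ?case
      proof
        assume "x \<in> ?H"
        then obtain k where "(S ^^ Suc k) (T x) \<in> A" using * by auto
        then show "T x \<in> ?H" using measurable_space[OF T elim(2)] by blast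
      qed
    qed
  qed measurable
  moreover have "A \<subseteq> ?H" using sets.sets_into_space[OF A] by (auto intro!: exI[of _ 0])
  then have "prob A \<le> prob ?H" by (intro finite_measure_mono) auto
  ultimately have "prob ?H = 1" using pos by auto
  then show ?thesis by (subst (asm) prob_Collect_eq_1) auto
qed


lemma reversed: "ergodic_mpt M S T"
proof
  show "Defs.ergodic M S"
    unfolding ergodic_def
  proof (intro ballI impI)
    fix A assume A: "A \<in> sets M" and inv: "S -` A \<inter> space M = A"
    have *: "y \<in> A \<longleftrightarrow> S y \<in> A" if "y \<in> space M" for y using that inv by blast
    have "AE x in M. T x \<in> A \<longleftrightarrow> x \<in> A"
      using ST AE_space by eventually_elim (use * measurable_space[OF T] in auto)
    then show "prob A = 0 \<or> prob A = 1" by (rule zero_one_of_AE_invariant[OF A])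
  qed
qed (simp_all add: distr_S ST TS)

lemma AE_forward_hits:
  assumes "A \<in> sets M" "prob A > 0"
  shows "AE x in M. \<exists>k. (T ^^ k) x \<in> A"
  using ergodic_mpt.AE_backward_hits[OF reversed assms] .

text \<open>The recursion along backward orbits stops at the last visit to \<open>B\<close>, which exists almost
  everywhere by ergodicity.\<close>

lemma backward_recursion:
  assumes B [measurable]: "B \<in> sets M" and init: "init \<in> measurable M N"
    and F: "\<And>h. h \<in> measurable M N \<Longrightarrow> (\<lambda>x. F x (h (S x))) \<in> measurable M N"
  obtains W where "W \<in> measurable M N" "\<And>x. x \<in> B \<Longrightarrow> W x = init x"
    "\<And>x. x \<notin> B \<Longrightarrow> \<exists>k. (S ^^ k) x \<in> B \<Longrightarrow> W x = F x (W (S x))"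
proof -
  \<comment> \<open>\<open>it j\<close> unrolls the recursion \<open>j\<close> times. Choosing the
    depth \<open>k x\<close>, the time since the last visit to \<open>B\<close>, makes it end
    exactly at that visit.\<close>
  define it where "it = rec_nat init (\<lambda>_ h x. F x (h (S x)))"
  define k where "k = (\<lambda>x. LEAST k. (S ^^ k) x \<in> B)"
  have it: "it j \<in> measurable M N" for j
    by (induction j) (auto simp: it_def init F)
  have [measurable]: "k \<in> measurable M (count_space UNIV)"
    unfolding k_def by measurable
  show ?thesis
  proof (rule that[of "\<lambda>x. it (k x) x"])
    show "(\<lambda>x. it (k x) x) \<in> measurable M N"
      by (rule measurable_compose_countable[OF it]) auto
    show "it (k x) x = init x" if "x \<in> B" for x
    proof -
      have "k x = 0" unfolding k_def by (rule Least_eq_0) (use that in simp)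
      then show ?thesis by (simp add: it_def)
    qed
    show "it (k x) x = F x (it (k (S x)) (S x))" if x: "x \<notin> B" "\<exists>k. (S ^^ k) x \<in> B" for x
    proof -
      obtain j where "(S ^^ j) x \<in> B" using x(2) by blast
      then have "k x = Suc (LEAST j. (S ^^ Suc j) x \<in> B)"
        unfolding k_def by (rule Least_Suc) (use x(1) in simp)
      then have "k x = Suc (k (S x))" by (simp add: k_def funpow_swap1)
      then show ?thesis by (simp add: it_def)
    qed
  qed
qed

lemma prob_Un_funpow_le:
  assumes A [measurable]: "A \<in> sets M"
  shows "prob {x \<in> space M. \<exists>i<L. (T ^^ i) x \<in> A} \<le> real L * prob A"
proof -
  have "{x \<in> space M. \<exists>i<L. (T ^^ i) x \<in> A} = (\<Union>i\<in>{..<L}. (T ^^ i) -` A \<inter> space M)" by auto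
  also have "prob \<dots> \<le> (\<Sum>i<L. prob ((T ^^ i) -` A \<inter> space M))"
    by (intro finite_measure_subadditive_finite) auto
  finally show ?thesis by (simp add: prob_funpow_T)
qed

end

section \<open>Nonatomic ergodic transformations\<close>

locale nonatomic_ergodic_mpt = ergodic_mpt M T S for M :: "'a measure" and T S +
  assumes nonatomic: "\<And>A e. A \<in> sets M \<Longrightarrow> prob A > 0 \<Longrightarrow> e > 0 \<Longrightarrow>
    \<exists>B\<in>sets M. B \<subseteq> A \<and> prob B > 0 \<and> prob B < e"
begin

text \<open>\<open>B\<close> consists of the points of a small set \<open>A\<close> that do not
  return before time \<open>L\<close>. If it were null, the union of the preimages of
  \<open>A\<close> under the powers 0 to \<open>L\<close> would be subinvariant, although its
  measure is positive and, by \<open>prob A < 1 / (L + 2)\<close>, below 1.\<close>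

lemma long_return_set:
  assumes e: "e > 0"
  shows "\<exists>B\<in>sets M. prob B > 0 \<and> prob B < e \<and> (\<forall>x\<in>B. \<forall>i. 1 \<le> i \<and> i < L \<longrightarrow> (T ^^ i) x \<notin> B)"
proof -
  obtain A where A [measurable]: "A \<in> sets M" and posA: "prob A > 0"
    and small: "prob A < min e (1 / (L + 2))"
    using nonatomic[OF sets.top, of "min e (1 / (L + 2))"] e by (auto simp: prob_space)
  define B where "B = {x \<in> space M. x \<in> A \<and> (\<forall>i. 1 \<le> i \<and> i < L \<longrightarrow> (T ^^ i) x \<notin> A)}"
  have B [measurable]: "B \<in> sets M" unfolding B_def by measurable
  have "B \<subseteq> A" by (auto simp: B_def)
  have "prob B \<noteq> 0"
  proof
    assume "prob B = 0"
    then have null: "AE x in M. x \<notin> B" by (simp add: prob_eq_0)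
    let ?U = "{x \<in> space M. \<exists>i<Suc L. (T ^^ i) x \<in> A}"
    have "prob ?U = 0 \<or> prob ?U = 1"
    proof (rule zero_one_of_AE_subinvariant)
      show "AE x in M. x \<in> ?U \<longrightarrow> T x \<in> ?U"
        using null AE_space
      proof eventually_elim
        case (elim x)
        show ?case
        proof
          assume "x \<in> ?U"
          then obtain i where i: "i < Suc L" "(T ^^ i) x \<in> A" by auto
          have "\<exists>j. 1 \<le> j \<and> j < Suc L \<and> (T ^^ j) x \<in> A"
          proof (cases "i = 0")
            case True
            then show ?thesis using elim i by (auto simp: B_def)
          qed (use i in \<open>auto intro!: exI[of _ i]\<close>)
          then obtain j where j: "1 \<le> j" "j < Suc L" "(T ^^ j) x \<in> A" by blast
          then have "(T ^^ (j - 1)) (T x) \<in> A"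
            by (cases j) (auto simp: funpow_swap1)
          then show "T x \<in> ?U" using j measurable_space[OF T, of x] elim by (auto intro!: exI[of _ "j - 1"])
        qed
      qed
    qed measurable
    moreover have "prob ?U \<le> real (Suc L) * prob A" by (rule prob_Un_funpow_le) auto
    moreover have "\<dots> < 1" using small posA by (auto simp: field_simps)
    moreover have "A \<subseteq> ?U" using sets.sets_into_space[OF A] by (auto intro!: exI[of _ 0])
    then have "prob A \<le> prob ?U" by (intro finite_measure_mono) auto
    ultimately show False using posA by linarith
  qed
  moreover have "prob B \<le> prob A" using \<open>B \<subseteq> A\<close> by (intro finite_measure_mono) auto
  ultimately show ?thesis
    using B small \<open>B \<subseteq> A\<close> zero_less_measure_iff by (intro bexI[of _ B]) (auto simp: B_def)
qed

end

text \<open>The preimages \<open>C i\<close> of \<open>N\<close> intervals covering [0, 1] have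
  measure at most \<open>1 / N\<close>, and one of them meets \<open>A\<close> in positive measure.
  They are known to be measurable only for the completion, so \<open>main_part\<close> replaces each
  intersection by a set in \<open>sets M\<close> of the same measure.\<close>

lemma nonatomic_lebesgue_prob_space_small_subset:
  assumes M: "nonatomic_lebesgue_prob_space M"
    and A: "A \<in> sets M" and pos: "measure M A > 0" and e: "e > 0"
  shows "\<exists>B\<in>sets M. B \<subseteq> A \<and> measure M B > 0 \<and> measure M B < e"
proof -
  interpret prob_space M using M by (simp add: nonatomic_lebesgue_prob_space_def)
  obtain \<phi> where \<phi> [measurable]: "\<phi> \<in> measurable (completion M) (lebesgue_on {0..1::real})"
    and distr: "distr (completion M) (lebesgue_on {0..1::real}) \<phi> = lebesgue_on {0..1}"
    using M unfolding nonatomic_lebesgue_prob_space_def iso_mod_null_def by blast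
  obtain N :: nat where N: "1 / e < real N" using reals_Archimedean2 by blast
  then have N0: "real N > 0" using e by (smt (verit) divide_pos_pos)
  interpret C: prob_space "completion M"
    by (rule prob_spaceI) (simp add: emeasure_space_1)
  define I where "I = (\<lambda>i. {real i / N..real (Suc i) / N} \<inter> {0..1})"
  have I [measurable]: "I i \<in> sets (lebesgue_on {0..1})" for i
    unfolding I_def sets_restrict_space
    by (rule image_eqI[of _ _ "{real i / N..real (Suc i) / N}"]) auto
  define C where "C = (\<lambda>i. \<phi> -` I i \<inter> space M)"
  have C: "C i \<in> sets (completion M)" for i
    using measurable_sets[OF \<phi> I] by (simp add: C_def)
  have mC: "measure (completion M) (C i) \<le> 1 / N" for i
  proof -
    have "measure (completion M) (C i) = measure (distr (completion M) (lebesgue_on {0..1::real}) \<phi>) (I i)"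
      by (subst measure_distr) (simp_all add: C_def)
    also have "\<dots> = measure lebesgue (I i)"
      unfolding distr by (rule measure_restrict_space) (auto simp: I_def)
    also have "\<dots> \<le> measure lebesgue {real i / N..real (Suc i) / N}"
      by (intro measure_mono_fmeasurable) (auto simp: I_def)
    also have "\<dots> = real (Suc i) / N - real i / N"
      using N0 by (simp add: divide_right_mono)
    also have "\<dots> = 1 / N" by (simp flip: diff_divide_distrib)
    finally show ?thesis .
  qed
  define D where "D = (\<lambda>i. main_part M (A \<inter> C i))"
  have AC: "A \<inter> C i \<in> sets (completion M)" for i using A C by auto
  have D [measurable]: "D i \<in> sets M" for i unfolding D_def using main_part_sets[OF AC] .
  have Dsub: "D i \<subseteq> A \<inter> C i" for i
    using main_part_null_part_Un[OF AC, of i] unfolding D_def by blast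
  have mD: "measure M (D i) = measure (completion M) (A \<inter> C i)" for i
    unfolding measure_def by (simp add: D_def AC)
  have "A = (\<Union>i<N. A \<inter> C i)"
  proof (intro equalityI subsetI)
    fix x assume x: "x \<in> A"
    then have xs: "x \<in> space M" using sets.sets_into_space[OF A] by auto
    then have f: "\<phi> x \<in> {0..1}" using measurable_space[OF \<phi>, of x] by simp
    \<comment> \<open>The minimum assigns the endpoint \<open>\<phi> x = 1\<close> to the last
      interval.\<close>
    define i where "i = min (nat \<lfloor>real N * \<phi> x\<rfloor>) (N - 1)"
    have "i < N" using N0 by (auto simp: i_def)
    have "real i \<le> real N * \<phi> x"
    proof -
      have "real (nat \<lfloor>real N * \<phi> x\<rfloor>) \<le> real N * \<phi> x" using f by (simp add: of_nat_floor)
      then show ?thesis unfolding i_def by linarith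
    qed
    moreover have "real N * \<phi> x \<le> real (Suc i)"
    proof (cases "nat \<lfloor>real N * \<phi> x\<rfloor> \<le> N - 1")
      case True
      then show ?thesis using f unfolding i_def by linarith
    next
      case False
      then have "i = N - 1" by (simp add: i_def)
      then have "real (Suc i) = real N" using N0 by simp
      then show ?thesis using f N0 by (simp add: mult_left_le)
    qed
    ultimately have "x \<in> C i" using f N0 xs by (simp add: C_def I_def field_simps)
    then show "x \<in> (\<Union>i<N. A \<inter> C i)" using x \<open>i < N\<close> by auto
  qed auto
  then have "measure (completion M) A = measure (completion M) (\<Union>i<N. A \<inter> C i)" by simp
  also have "\<dots> \<le> (\<Sum>i<N. measure (completion M) (A \<inter> C i))"
    by (rule C.finite_measure_subadditive_finite) (use AC in auto)
  finally have "0 < (\<Sum>i<N. measure M (D i))" using pos A by (simp add: mD)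
  then obtain i where i: "measure M (D i) > 0"
    by (metis (no_types, lifting) not_le sum_nonpos)
  have "measure M (D i) \<le> measure (completion M) (C i)"
    unfolding mD by (intro C.finite_measure_mono C) auto
  also have "\<dots> \<le> 1 / N" by (rule mC)
  also have "\<dots> < e" using N N0 e by (simp add: field_simps)
  finally show ?thesis using i Dsub by (intro bexI[of _ "D i"]) auto
qed

section \<open>Inputs with decaying anticipation\<close>

text \<open>The terms tend to 0 and Gaussian integers are discrete, so the series is a finite
  sum.\<close>

lemma gauss_int_suminf:
  assumes f: "summable f" and g: "\<And>i. f i \<in> gauss_int"
  shows "suminf f \<in> gauss_int"
proof -
  have "f \<longlonglongrightarrow> 0" using f by (rule summable_LIMSEQ_zero)
  then obtain N where "\<And>i. i \<ge> N \<Longrightarrow> norm (f i) < 1"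
    using LIMSEQ_D[of f 0 1] by auto
  then have "f i = 0" if "i \<ge> N" for i using that g gauss_int_small by blast
  then have "suminf f = sum f {..<N}" by (intro suminf_finite) auto
  then show ?thesis using g by (simp add: gauss_int_sum)
qed

text \<open>\<open>c i n\<close> is the part of the input at time \<open>n\<close> that is anticipated by \<open>i\<close> steps:
  \<open>input_seq c\<close> is the resulting input, \<open>pending_seq z c\<close> the effect, in the coordinate of
  the root \<open>z\<close>, of inputs already emitted but not yet accounted for, and
  \<open>future_seq z c\<close> the bounded response of an expanding root.\<close>

definition input_seq :: "(nat \<Rightarrow> nat \<Rightarrow> complex) \<Rightarrow> nat \<Rightarrow> complex"
  where "input_seq c n = (\<Sum>i. c i (n + i))"

definition pending_seq :: "complex \<Rightarrow> (nat \<Rightarrow> nat \<Rightarrow> complex) \<Rightarrow> nat \<Rightarrow> complex"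
  where "pending_seq z c n = (\<Sum>i. \<Sum>s=1..i. z ^ (i - s) * c i (n + s))"

definition future_seq :: "complex \<Rightarrow> (nat \<Rightarrow> nat \<Rightarrow> complex) \<Rightarrow> nat \<Rightarrow> complex"
  where "future_seq z c n = - (\<Sum>k. input_seq c (n + Suc k) / z ^ Suc k)"

text \<open>The bound \<open>c_le\<close> budgets for three losses. The input at time
  \<open>n\<close> involves \<open>s = n + i\<close>, so one half of
  \<open>\<beta> ^ (2 * i)\<close> pays for \<open>1 / \<beta> ^ i\<close> and the other half makes
  the series over \<open>i\<close> geometric. The factor \<open>real i + 1\<close> pays for the
  \<open>i\<close> values that are pending at once with anticipation \<open>i\<close>.\<close>

locale decaying_inputs =
  fixes c :: "nat \<Rightarrow> nat \<Rightarrow> complex" and \<beta> \<Psi> :: real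
  assumes \<beta>: "0 < \<beta>" "\<beta> < 1"
    and c_le: "\<And>i s. s \<ge> 1 \<Longrightarrow> (real i + 1) * norm (c i s) \<le> \<beta> ^ (2 * i) * \<Psi> / \<beta> ^ s"
begin

lemma \<Psi>_nonneg: "\<Psi> \<ge> 0"
proof -
  have "0 \<le> (real 0 + 1) * norm (c 0 1)" by simp
  also have "\<dots> \<le> \<Psi> / \<beta>" using c_le[of 1 0] by simp
  finally show ?thesis using \<beta> by (simp add: field_simps)
qed

lemma norm_c_le: "s \<ge> 1 \<Longrightarrow> norm (c i s) \<le> \<beta> ^ (2 * i) * \<Psi> / \<beta> ^ s"
  using c_le[of s i] mult_right_mono[of 1 "real i + 1" "norm (c i s)"] by simp

lemma norm_input_term: "n \<ge> 1 \<Longrightarrow> norm (c i (n + i)) \<le> \<beta> ^ i * (\<Psi> / \<beta> ^ n)"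
proof -
  assume "n \<ge> 1"
  then have "norm (c i (n + i)) \<le> \<beta> ^ (2 * i) * \<Psi> / \<beta> ^ (n + i)" by (intro norm_c_le) simp
  also have "\<dots> = \<beta> ^ i * (\<Psi> / \<beta> ^ n)"
    using \<beta> unfolding mult_2 power_add by (simp add: field_simps)
  finally show ?thesis .
qed

lemma geometric_bound: "summable (\<lambda>i. \<beta> ^ i * C)" "(\<Sum>i. \<beta> ^ i * C) = C / (1 - \<beta>)"
  using \<beta> by (auto intro!: summable_mult2 simp: suminf_mult2[symmetric] suminf_geometric)

lemma summable_input: "n \<ge> 1 \<Longrightarrow> summable (\<lambda>i. norm (c i (n + i)))"
  by (rule summable_comparison_test'[OF geometric_bound(1)[of "\<Psi> / \<beta> ^ n"]])
    (use norm_input_term in \<open>simp only: real_norm_def abs_norm_cancel\<close>)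

lemma norm_input_seq: "n \<ge> 1 \<Longrightarrow> norm (input_seq c n) \<le> \<Psi> / \<beta> ^ n / (1 - \<beta>)"
proof -
  assume n: "n \<ge> 1"
  have "norm (input_seq c n) \<le> (\<Sum>i. norm (c i (n + i)))"
    unfolding input_seq_def using summable_input[OF n] by (rule summable_norm)
  also have "\<dots> \<le> (\<Sum>i. \<beta> ^ i * (\<Psi> / \<beta> ^ n))"
    by (intro suminf_le norm_input_term n summable_input geometric_bound)
  finally show ?thesis by (simp only: geometric_bound)
qed

lemma norm_pending_term:
  assumes z: "norm z \<le> 1"
  shows "norm (\<Sum>s=1..i. z ^ (i - s) * c i (n + s)) \<le> \<beta> ^ i * (\<Psi> / \<beta> ^ n)"
proof -
  have "norm (\<Sum>s=1..i. z ^ (i - s) * c i (n + s)) \<le> (\<Sum>s=1..i. \<beta> ^ i * (\<Psi> / \<beta> ^ n) / (real i + 1))"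
  proof (intro sum_norm_le)
    fix s assume s: "s \<in> {1..i}"
    have "norm (z ^ (i - s) * c i (n + s)) \<le> 1 * norm (c i (n + s))"
      unfolding norm_mult norm_power by (intro mult_right_mono power_le_one z) auto
    also have "\<dots> \<le> \<beta> ^ (2 * i) * \<Psi> / \<beta> ^ (n + s) / (real i + 1)"
    proof -
      have "0 < real i + 1" by simp
      moreover have "(real i + 1) * norm (c i (n + s)) \<le> \<beta> ^ (2 * i) * \<Psi> / \<beta> ^ (n + s)"
        by (rule c_le) (use s in simp)
      ultimately show ?thesis unfolding mult_1 by (metis pos_le_divide_eq mult.commute)
    qed
    also have "\<dots> = \<beta> ^ i * \<beta> ^ (i - s) * (\<Psi> / \<beta> ^ n) / (real i + 1)"
      using \<beta> s unfolding mult_2 power_add by (simp add: power_diff field_simps)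
    also have "\<dots> \<le> \<beta> ^ i * 1 * (\<Psi> / \<beta> ^ n) / (real i + 1)"
      using \<beta> \<Psi>_nonneg by (intro divide_right_mono mult_right_mono mult_left_mono power_le_one) auto
    finally show "norm (z ^ (i - s) * c i (n + s)) \<le> \<beta> ^ i * (\<Psi> / \<beta> ^ n) / (real i + 1)" by simp
  qed
  also have "\<dots> = real i * (\<beta> ^ i * (\<Psi> / \<beta> ^ n) / (real i + 1))" by simp
  also have "\<dots> \<le> (real i + 1) * (\<beta> ^ i * (\<Psi> / \<beta> ^ n) / (real i + 1))"
    using \<beta> \<Psi>_nonneg by (intro mult_right_mono) auto
  also have "\<dots> = \<beta> ^ i * (\<Psi> / \<beta> ^ n)" by simp
  finally show ?thesis .
qed

lemma summable_pending:
  "norm z \<le> 1 \<Longrightarrow> summable (\<lambda>i. \<Sum>s=1..i. z ^ (i - s) * c i (n + s))"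
  by (rule summable_comparison_test'[OF geometric_bound(1)[of "\<Psi> / \<beta> ^ n"]])
    (rule norm_pending_term)

lemma norm_pending_seq:
  assumes z: "norm z \<le> 1"
  shows "norm (pending_seq z c 0) \<le> \<Psi> / (1 - \<beta>)"
proof -
  have s: "summable (\<lambda>i. norm (\<Sum>s=1..i. z ^ (i - s) * c i (0 + s)))"
    by (rule summable_comparison_test'[OF geometric_bound(1)[of "\<Psi>"]])
      (use norm_pending_term[OF z, of _ 0] in simp)
  have "norm (pending_seq z c 0) \<le> (\<Sum>i. norm (\<Sum>s=1..i. z ^ (i - s) * c i (0 + s)))"
    unfolding pending_seq_def by (rule summable_norm[OF s])
  also have "\<dots> \<le> (\<Sum>i. \<beta> ^ i * \<Psi>)"
    by (intro suminf_le s geometric_bound) (use norm_pending_term[OF z, of _ 0] in simp)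
  finally show ?thesis by (simp only: geometric_bound)
qed

text \<open>One step of time multiplies everything pending by \<open>z\<close>, adds the values
  emitted now, which form the new input, and releases those that have arrived. A value arriving with
  anticipation \<open>i\<close> has been multiplied by \<open>z\<close> exactly \<open>i\<close>
  times, so the released part is a polynomial jump and cancels the jump of the solution to which the
  pending effect is added.\<close>

lemma pending_seq_Suc:
  assumes z: "norm z \<le> 1" and fin: "\<And>i. i \<ge> m \<Longrightarrow> c i (Suc n) = 0"
  shows "pending_seq z c (Suc n) = z * pending_seq z c n + input_seq c (Suc n)
    - (\<Sum>i. z ^ i * c i (Suc n))"
proof -
  have s1: "summable (\<lambda>i. z ^ i * c i (Suc n))"
    by (rule summable_finite[of "{..<m}"]) (auto simp: fin)
  have s2: "summable (\<lambda>i. c i (Suc n + i))"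
    using summable_input[of "Suc n"] by (intro summable_norm_cancel[where f="\<lambda>i. c i (Suc n + i)"]) auto
  have s3: "summable (\<lambda>i. z * (\<Sum>s=1..i. z ^ (i - s) * c i (n + s)))"
    by (intro summable_mult summable_pending z)
  have "(\<Sum>s=1..i. z ^ (i - s) * c i (Suc n + s)) =
      z * (\<Sum>s=1..i. z ^ (i - s) * c i (n + s)) + c i (Suc n + i) - z ^ i * c i (Suc n)" for i
  proof -
    have "(\<Sum>s=1..i. z ^ (i - s) * c i (Suc n + s)) + z ^ i * c i (Suc n) =
        (\<Sum>s=0..i. z ^ (i - s) * c i (Suc n + s))"
      by (simp add: sum.atLeast_Suc_atMost[of 0])
    also have "\<dots> = (\<Sum>s<i. z ^ (i - s) * c i (Suc n + s)) + c i (Suc n + i)"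
      by (simp add: atLeast0AtMost flip: lessThan_Suc_atMost)
    also have "(\<Sum>s<i. z ^ (i - s) * c i (Suc n + s)) = (\<Sum>s=1..i. z * (z ^ (i - s) * c i (n + s)))"
      by (rule sum.reindex_bij_witness[of _ "\<lambda>s. s - 1" Suc])
        (auto simp: Suc_diff_le Suc_diff_Suc simp flip: power_Suc mult.assoc)
    finally show ?thesis by (simp add: sum_distrib_left algebra_simps)
  qed
  then have "pending_seq z c (Suc n) = (\<Sum>i. z * (\<Sum>s=1..i. z ^ (i - s) * c i (n + s))
      + c i (Suc n + i) - z ^ i * c i (Suc n))"
    unfolding pending_seq_def by presburger
  also have "\<dots> = (\<Sum>i. z * (\<Sum>s=1..i. z ^ (i - s) * c i (n + s))) + (\<Sum>i. c i (Suc n + i))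
      - (\<Sum>i. z ^ i * c i (Suc n))"
    by (simp only: suminf_diff[OF summable_add[OF s3 s2] s1] suminf_add[OF s3 s2])
  also have "(\<Sum>i. z * (\<Sum>s=1..i. z ^ (i - s) * c i (n + s))) = z * pending_seq z c n"
    unfolding pending_seq_def by (rule suminf_mult) (rule summable_pending[OF z])
  finally show ?thesis by (simp add: input_seq_def)
qed

text \<open>Inputs may grow like \<open>1 / \<beta> ^ k\<close>, but the assumption bounds
  \<open>1 / norm z ^ k\<close> by \<open>\<beta> ^ (2 * k)\<close>, which leaves a factor
  \<open>\<beta> ^ k\<close> for convergence.\<close>

lemma norm_future_term:
  assumes z: "1 \<le> \<beta>\<^sup>2 * norm z"
  shows "norm (input_seq c (n + Suc k) / z ^ Suc k) \<le> \<beta> ^ k * (\<Psi> / \<beta> ^ n / (1 - \<beta>))"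
proof -
  have z0: "norm z > 0" using z by (cases "z = 0") auto
  have "1 \<le> (\<beta>\<^sup>2 * norm z) ^ Suc k" using z by (rule one_le_power)
  then have "1 / norm z ^ Suc k \<le> \<beta> ^ (2 * Suc k)"
    using z0 by (simp only: power_mult_distrib flip: power_mult) (simp add: pos_divide_le_eq)
  then have "norm (input_seq c (n + Suc k) / z ^ Suc k) \<le>
      \<Psi> / \<beta> ^ (n + Suc k) / (1 - \<beta>) * \<beta> ^ (2 * Suc k)"
    unfolding norm_divide norm_power divide_inverse[of "norm _"] inverse_eq_divide
    using \<beta> \<Psi>_nonneg by (intro mult_mono norm_input_seq) auto
  also have "\<dots> = \<beta> * (\<beta> ^ k * (\<Psi> / \<beta> ^ n / (1 - \<beta>)))"
    using \<beta> unfolding mult_2 power_add by (simp add: field_simps)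
  also have "\<dots> \<le> 1 * (\<beta> ^ k * (\<Psi> / \<beta> ^ n / (1 - \<beta>)))"
    using \<beta> \<Psi>_nonneg by (intro mult_right_mono) auto
  finally show ?thesis by simp
qed

lemma summable_future:
  assumes z: "1 \<le> \<beta>\<^sup>2 * norm z"
  shows "summable (\<lambda>k. norm (input_seq c (n + Suc k) / z ^ Suc k))"
  by (rule summable_comparison_test'[OF geometric_bound(1)[of "\<Psi> / \<beta> ^ n / (1 - \<beta>)"]])
    (simp only: real_norm_def abs_norm_cancel norm_future_term[OF z])

lemma norm_future_seq:
  assumes z: "1 \<le> \<beta>\<^sup>2 * norm z"
  shows "norm (future_seq z c 0) \<le> \<Psi> / (1 - \<beta>) / (1 - \<beta>)"
proof -
  have "norm (future_seq z c 0) \<le> (\<Sum>k. norm (input_seq c (0 + Suc k) / z ^ Suc k))"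
    unfolding future_seq_def norm_minus_cancel by (rule summable_norm[OF summable_future[OF z]])
  also have "\<dots> \<le> (\<Sum>i. \<beta> ^ i * (\<Psi> / (1 - \<beta>)))"
    by (intro suminf_le z summable_future geometric_bound) (use norm_future_term[OF z, of 0] in simp)
  finally show ?thesis by (simp only: geometric_bound)
qed

lemma future_seq_Suc:
  assumes z: "1 \<le> \<beta>\<^sup>2 * norm z"
  shows "future_seq z c (Suc n) = z * future_seq z c n + input_seq c (Suc n)"
proof -
  have z0: "z \<noteq> 0" using z by auto
  have s: "summable (\<lambda>k. input_seq c (n + Suc k) / z ^ Suc k)"
    by (rule summable_norm_cancel[OF summable_future[OF z]])
  have "z * future_seq z c n = - (z * (\<Sum>k. input_seq c (n + Suc k) / z ^ Suc k))"
    by (simp add: future_seq_def)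
  also have "(\<Sum>k. input_seq c (n + Suc k) / z ^ Suc k) =
      input_seq c (Suc n) / z + (\<Sum>k. input_seq c (n + Suc (Suc k)) / z ^ Suc (Suc k))"
    using suminf_split_head[OF s] by simp
  also have "(\<Sum>k. input_seq c (n + Suc (Suc k)) / z ^ Suc (Suc k)) =
      (\<Sum>k. 1 / z * (input_seq c (Suc n + Suc k) / z ^ Suc k))"
    by simp
  also have "\<dots> = 1 / z * (\<Sum>k. input_seq c (Suc n + Suc k) / z ^ Suc k)"
    by (rule suminf_mult) (rule summable_norm_cancel[OF summable_future[OF z]])
  finally show ?thesis using z0 by (simp add: future_seq_def algebra_simps)
qed

end

section \<open>The tower construction\<close>

text \<open>The tolerances \<open>v0 / 2 ^ (n + 2)\<close> sum to \<open>v0 / 2\<close>, so the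
  corrections together cannot cancel the starting vector. The radius 4 covers the arguments fed to
  \<open>\<kappa> n\<close>, which are differences of two vectors of size at most
  \<open>2 * v0\<close>.\<close>

locale steering_tower = ergodic_mpt M T S for M :: "'a measure" and T S +
  fixes R :: "complex set" and v0 :: real
    and \<kappa> :: "nat \<Rightarrow> nat \<Rightarrow> (complex \<Rightarrow> complex) \<Rightarrow> complex" and m :: "nat \<Rightarrow> nat"
    and H :: "nat \<Rightarrow> real" and B :: "nat \<Rightarrow> 'a set"
  assumes R: "finite R" "\<And>z. z \<in> R \<Longrightarrow> norm z \<le> 1" and v0: "0 < v0" "v0 \<le> 1"
    and \<kappa>_int: "\<And>n i w. \<kappa> n i w \<in> gauss_int"
    and \<kappa>_meas [measurable]: "\<And>n i. \<kappa> n i \<in> borel_measurable (PiM R (\<lambda>_. borel))"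
    and \<kappa>_0: "\<And>n i w. i \<ge> m n \<Longrightarrow> \<kappa> n i w = 0"
    and H: "\<And>n. H n > 0"
    and \<kappa>_le: "\<And>n i w. (\<And>z. z \<in> R \<Longrightarrow> norm (w z) \<le> 4) \<Longrightarrow> norm (\<kappa> n i w) \<le> H n"
    and \<kappa>_approx: "\<And>n w z. z \<in> R \<Longrightarrow> norm (w z - (\<Sum>i<m n. \<kappa> n i w * z ^ i)) \<le> v0 / 2 ^ (n + 2)"
    and B [measurable]: "\<And>n. B n \<in> sets M" and B_Suc: "\<And>n. B (Suc n) \<subseteq> B n"
    and B_pos: "\<And>n. prob (B n) > 0" and B_small: "\<And>n. prob (B (Suc n)) < 1 / 2 ^ n"
begin

lemma B_mono: "i \<le> j \<Longrightarrow> B j \<subseteq> B i"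
  using B_Suc by (rule lift_Suc_antimono_le)

definition hits :: "nat \<Rightarrow> 'a \<Rightarrow> bool"
  where "hits n x \<longleftrightarrow> (\<exists>k. (S ^^ k) x \<in> B n)"

lemma hits_antimono: "hits j x \<Longrightarrow> i \<le> j \<Longrightarrow> hits i x"
  using B_mono by (auto simp: hits_def)

lemma hits_S: "hits n x \<Longrightarrow> x \<notin> B n \<Longrightarrow> hits n (S x)"
proof -
  assume "hits n x" and x: "x \<notin> B n"
  then obtain k where k: "(S ^^ k) x \<in> B n" by (auto simp: hits_def)
  then obtain j where "k = Suc j" using x by (cases k) auto
  then have "(S ^^ j) (S x) \<in> B n" using k by (simp add: funpow_swap1)
  then show ?thesis by (auto simp: hits_def)
qed

lemma hits_induct [consumes 1, case_names base step]:
  assumes "hits n x" "\<And>x. x \<in> B n \<Longrightarrow> P x"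
    and "\<And>x. x \<notin> B n \<Longrightarrow> hits n x \<Longrightarrow> P (S x) \<Longrightarrow> P x"
  shows "P x"
proof -
  from assms(1) obtain k where "(S ^^ k) x \<in> B n" by (auto simp: hits_def)
  then show ?thesis
  proof (induction k arbitrary: x)
    case 0
    then show ?case using assms(2) by simp
  next
    case (Suc k)
    have "P (S x)" by (rule Suc.IH) (use Suc.prems in \<open>simp add: funpow_swap1\<close>)
    moreover have "hits n x" using Suc.prems by (auto simp: hits_def intro: exI[of _ "Suc k"])
    ultimately show ?case using assms(2,3) by blast
  qed
qed

lemma AE_hits: "AE x in M. \<forall>n. hits n x"
  unfolding hits_def AE_all_countable using AE_backward_hits[OF B B_pos] by blast

lemma AE_not_all_B: "AE x in M. \<exists>n. x \<notin> B n"
proof -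
  have "prob (\<Inter>n. B n) = 0"
  proof (rule antisym)
    have "prob (\<Inter>n. B n) \<le> e" if e: "e > 0" for e
    proof -
      obtain n where n: "(1 / 2) ^ n < e" using real_arch_pow_inv[OF e, of "1/2"] by auto
      have "prob (\<Inter>n. B n) \<le> prob (B (Suc n))" by (intro finite_measure_mono) auto
      also have "\<dots> < 1 / 2 ^ n" by (rule B_small)
      finally show ?thesis using n by (simp add: power_one_over)
    qed
    then show "prob (\<Inter>n. B n) \<le> 0" by (rule field_le_epsilon[of _ 0, simplified])
  qed simp
  then have "AE x in M. x \<notin> (\<Inter>n. B n)" by (subst (asm) prob_eq_0) auto
  then show ?thesis by simp
qed

definition jump :: "nat \<Rightarrow> ('a \<Rightarrow> complex \<Rightarrow> complex) \<Rightarrow> ('a \<Rightarrow> complex \<Rightarrow> complex) \<Rightarrow> nat \<Rightarrow> 'a \<Rightarrow> complex"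
  where "jump n V W i x = \<kappa> n i (\<lambda>z\<in>R. V x z - z * W (S x) z)"

text \<open>In the tower, \<open>V\<close> obeys the equation with polynomial jumps outside
  \<open>B n\<close> and is reset freely on \<open>B n\<close>. Passing to \<open>W\<close> pushes
  the reset down to \<open>B (Suc n)\<close>: on \<open>B n - B (Suc n)\<close> a polynomial jump
  brings \<open>W\<close> back near \<open>V\<close>, and outside \<open>B n\<close> the jumps of
  \<open>V\<close> are copied.\<close>

definition correction :: "nat \<Rightarrow> ('a \<Rightarrow> complex \<Rightarrow> complex) \<Rightarrow> ('a \<Rightarrow> complex \<Rightarrow> complex) \<Rightarrow> bool"
  where "correction n V W \<longleftrightarrow>
    (\<forall>x\<in>B (Suc n). W x = V x) \<and>
    (\<forall>x. x \<notin> B (Suc n) \<longrightarrow> hits (Suc n) x \<longrightarrow> (\<forall>z\<in>R. W x z = z * W (S x) z +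
      (if x \<in> B n then (\<Sum>i<m n. jump n V W i x * z ^ i) else V x z - z * V (S x) z)))"

lemma measurable_coord: "V \<in> measurable M (PiM R (\<lambda>_. borel)) \<Longrightarrow> z \<in> R \<Longrightarrow>
    (\<lambda>x. V x z :: complex) \<in> borel_measurable M"
  by (rule measurable_compose[OF _ measurable_component_singleton])

lemma measurable_jump:
  assumes "V \<in> measurable M (PiM R (\<lambda>_. borel))" "W \<in> measurable M (PiM R (\<lambda>_. borel))"
  shows "jump n V W i \<in> borel_measurable M"
proof -
  have [measurable]: "(\<lambda>x. V x z) \<in> borel_measurable M" "(\<lambda>x. W (S x) z) \<in> borel_measurable M"
    if "z \<in> R" for z
    using measurable_coord[OF assms(1) that] measurable_compose[OF S measurable_coord[OF assms(2) that]]
    by auto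
  have "(\<lambda>x. \<lambda>z\<in>R. V x z - z * W (S x) z) \<in> measurable M (PiM R (\<lambda>_. borel))"
    by (rule measurable_restrict) measurable
  from measurable_compose[OF this \<kappa>_meas] show ?thesis by (simp add: jump_def[abs_def])
qed

lemma correction_exists:
  assumes V: "V \<in> measurable M (PiM R (\<lambda>_. borel))"
  shows "\<exists>W. W \<in> measurable M (PiM R (\<lambda>_. borel)) \<and> correction n V W"
proof -
  define F where "F = (\<lambda>x (v::complex \<Rightarrow> complex). \<lambda>z\<in>R. z * v z +
      (if x \<in> B n then (\<Sum>i<m n. \<kappa> n i (\<lambda>z\<in>R. V x z - z * v z) * z ^ i) else V x z - z * V (S x) z))"
  obtain W where W: "W \<in> measurable M (PiM R (\<lambda>_. borel))" "\<And>x. x \<in> B (Suc n) \<Longrightarrow> W x = V x"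
    "\<And>x. x \<notin> B (Suc n) \<Longrightarrow> \<exists>k. (S ^^ k) x \<in> B (Suc n) \<Longrightarrow> W x = F x (W (S x))"
  proof (rule backward_recursion[of "B (Suc n)" V "PiM R (\<lambda>_. borel)" F])
    fix h assume h: "h \<in> measurable M (PiM R (\<lambda>_. borel :: complex measure))"
    have j: "(\<lambda>x. \<kappa> n i (\<lambda>z\<in>R. V x z - z * h (S x) z)) \<in> borel_measurable M" for i
      using measurable_jump[OF V h, of n i] by (simp add: jump_def[abs_def])
    have [measurable]: "(\<lambda>x. V x z) \<in> borel_measurable M" "(\<lambda>x. V (S x) z) \<in> borel_measurable M"
      "(\<lambda>x. h (S x) z) \<in> borel_measurable M" if "z \<in> R" for z
      using measurable_coord[OF V that] measurable_compose[OF S measurable_coord[OF V that]]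
        measurable_compose[OF S measurable_coord[OF h that]] by auto
    note [measurable] = j
    show "(\<lambda>x. F x (h (S x))) \<in> measurable M (PiM R (\<lambda>_. borel))"
      unfolding F_def by (rule measurable_restrict) measurable
  qed (use V in auto)
  have "correction n V W"
    unfolding correction_def hits_def jump_def
  proof (intro conjI ballI allI impI)
    fix x z assume "x \<notin> B (Suc n)" "\<exists>k. (S ^^ k) x \<in> B (Suc n)" and z: "z \<in> R"
    then have "W x z = F x (W (S x)) z" using W(3) by metis
    then show "W x z = z * W (S x) z + (if x \<in> B n
        then (\<Sum>i<m n. \<kappa> n i (\<lambda>z\<in>R. V x z - z * W (S x) z) * z ^ i) else V x z - z * V (S x) z)"
      using z by (simp add: F_def)
  qed (rule W(2))
  then show ?thesis using W(1) by blast
qed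

lemma tower_functions_exist:
  "\<exists>V. (\<forall>n. V n \<in> measurable M (PiM R (\<lambda>_. borel :: complex measure)) \<and> correction n (V n) (V (Suc n))) \<and>
     (\<forall>x\<in>B 0. \<forall>z\<in>R. V 0 x z = of_real v0) \<and>
     (\<forall>x. x \<notin> B 0 \<longrightarrow> hits 0 x \<longrightarrow> (\<forall>z\<in>R. V 0 x z = z * V 0 (S x) z))"
proof -
  \<comment> \<open>The prescription of the first function sits inside the invariant, guarded by
    \<open>n = 0\<close>, so that a single dependent choice yields the whole sequence.\<close>
  define P where "P = (\<lambda>(n::nat) V. V \<in> measurable M (PiM R (\<lambda>_. borel :: complex measure)) \<and> (n = 0 \<longrightarrow>
     (\<forall>x\<in>B 0. \<forall>z\<in>R. V x z = of_real v0) \<and>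
     (\<forall>x. x \<notin> B 0 \<longrightarrow> hits 0 x \<longrightarrow> (\<forall>z\<in>R. V x z = z * V (S x) z))))"
  have "\<exists>V. P 0 V"
  proof -
    obtain W where W: "W \<in> measurable M (PiM R (\<lambda>_. borel))"
      "\<And>x. x \<in> B 0 \<Longrightarrow> W x = (\<lambda>z\<in>R. of_real v0 :: complex)"
      "\<And>x. x \<notin> B 0 \<Longrightarrow> \<exists>k. (S ^^ k) x \<in> B 0 \<Longrightarrow> W x = (\<lambda>z\<in>R. z * W (S x) z)"
    proof (rule backward_recursion[of "B 0" "\<lambda>_. \<lambda>z\<in>R. of_real v0 :: complex"
          "PiM R (\<lambda>_. borel)" "\<lambda>x v. \<lambda>z\<in>R. z * v z"])
      fix h assume h: "h \<in> measurable M (PiM R (\<lambda>_. borel :: complex measure))"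
      have [measurable]: "(\<lambda>x. h (S x) z) \<in> borel_measurable M" if "z \<in> R" for z
        using measurable_compose[OF S measurable_coord[OF h that]] by auto
      show "(\<lambda>x. \<lambda>z\<in>R. z * h (S x) z) \<in> measurable M (PiM R (\<lambda>_. borel))"
        by measurable
    qed (auto simp: space_PiM)
    have PW: "P 0 W" unfolding P_def hits_def using W by auto
    show "\<exists>V. P 0 V" by (rule exI[where x=W]) (rule PW)
  qed
  moreover have "\<exists>W. P (Suc n) W \<and> correction n V W" if "P n V" for V n
    using correction_exists[of V n] that by (auto simp: P_def)
  ultimately have "\<exists>V. \<forall>n. P n (V n) \<and> correction n (V n) (V (Suc n))"
    by (rule dependent_nat_choice)
  then obtain V where V: "\<And>n. P n (V n)" "\<And>n. correction n (V n) (V (Suc n))" by blast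
  show ?thesis using V(1)[of 0] V by (intro exI[of _ V]) (auto simp: P_def)
qed

text \<open>On \<open>B n\<close> the error is made afresh, within the tolerance and independently
  of the past. Elsewhere it is multiplied by \<open>z\<close> and does not grow, and on
  \<open>B (Suc n)\<close> it is 0.\<close>

lemma correction_close:
  assumes c: "correction n V W" and x: "hits (Suc n) x" and z: "z \<in> R"
  shows "norm (W x z - V x z) \<le> v0 / 2 ^ (n + 2)"
  using x
proof (induction rule: hits_induct)
  case (base x)
  then show ?case using c v0 by (simp add: correction_def)
next
  case (step x)
  show ?case
  proof (cases "x \<in> B n")
    case True
    have "W x z - V x z = - ((\<lambda>z\<in>R. V x z - z * W (S x) z) z -
        (\<Sum>i<m n. \<kappa> n i (\<lambda>z\<in>R. V x z - z * W (S x) z) * z ^ i))"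
      using c step z True by (simp add: correction_def jump_def)
    then show ?thesis using \<kappa>_approx[OF z] by (simp only: norm_minus_cancel)
  next
    case False
    then have "W x z - V x z = z * (W (S x) z - V (S x) z)"
      using c step z by (simp add: correction_def algebra_simps)
    then have "norm (W x z - V x z) = norm z * norm (W (S x) z - V (S x) z)"
      by (simp add: norm_mult)
    also have "\<dots> \<le> 1 * norm (W (S x) z - V (S x) z)"
      using R(2)[OF z] by (intro mult_right_mono) auto
    finally show ?thesis using step.IH by simp
  qed
qed

end

section \<open>The limit of the corrected functions\<close>

locale tower_functions = steering_tower M T S R v0 \<kappa> m H B
  for M :: "'a measure" and T S R v0 \<kappa> m H B +
  fixes V :: "nat \<Rightarrow> 'a \<Rightarrow> complex \<Rightarrow> complex"
  assumes V_meas: "\<And>n. V n \<in> measurable M (PiM R (\<lambda>_. borel))"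
    and V_corr: "\<And>n. correction n (V n) (V (Suc n))"
    and V0_B: "\<And>x z. x \<in> B 0 \<Longrightarrow> z \<in> R \<Longrightarrow> V 0 x z = v0"
    and V0_S: "\<And>x z. x \<notin> B 0 \<Longrightarrow> hits 0 x \<Longrightarrow> z \<in> R \<Longrightarrow> V 0 x z = z * V 0 (S x) z"
begin

lemma V_close: "hits (Suc n) x \<Longrightarrow> z \<in> R \<Longrightarrow> norm (V (Suc n) x z - V n x z) \<le> v0 / 2 ^ (n + 2)"
  by (rule correction_close[OF V_corr])

text \<open>The reserve \<open>v0 / 2 ^ n\<close> is halved at each step, which releases more than
  the next correction consumes.\<close>

lemma norm_V: "hits n x \<Longrightarrow> z \<in> R \<Longrightarrow> norm (V n x z) \<le> 2 * v0 - v0 / 2 ^ n"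
proof (induction n)
  case 0
  from 0(1) show ?case
  proof (induction rule: hits_induct)
    case (base x)
    then show ?case using V0_B 0(2) v0 by simp
  next
    case (step x)
    have "norm (V 0 x z) \<le> 1 * norm (V 0 (S x) z)"
      unfolding V0_S[OF step.hyps 0(2)] norm_mult using R(2)[OF 0(2)] by (intro mult_right_mono) auto
    then show ?case using step.IH by simp
  qed
next
  case (Suc n)
  have "norm (V (Suc n) x z) \<le> norm (V n x z) + norm (V (Suc n) x z - V n x z)"
    using norm_triangle_ineq[of "V n x z" "V (Suc n) x z - V n x z"] by simp
  also have "\<dots> \<le> (2 * v0 - v0 / 2 ^ n) + v0 / 2 ^ (n + 2)"
    using Suc.prems hits_antimono[of "Suc n" x n] by (intro add_mono Suc.IH V_close) auto
  also have "\<dots> \<le> 2 * v0 - v0 / 2 ^ Suc n"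
    using v0 by (simp add: field_simps)
  finally show ?case .
qed

lemma norm_V_le: "hits n x \<Longrightarrow> z \<in> R \<Longrightarrow> norm (V n x z) \<le> 2 * v0"
  using norm_V[of n x z] v0 by (smt (verit) divide_nonneg_pos zero_less_power)

lemma V_near_v0:
  assumes x: "x \<in> B 0" and h: "\<And>n. hits n x" and z: "z \<in> R"
  shows "norm (V n x z - v0) \<le> v0 / 2"
proof -
  have "norm (V n x z - v0) \<le> v0 / 2 - v0 / 2 ^ Suc n"
  proof (induction n)
    case 0
    then show ?case using V0_B[OF x z] by simp
  next
    case (Suc n)
    have "norm (V (Suc n) x z - v0) \<le> norm (V n x z - v0) + norm (V (Suc n) x z - V n x z)"
      using norm_triangle_ineq[of "V n x z - v0" "V (Suc n) x z - V n x z"] by simp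
    also have "\<dots> \<le> (v0 / 2 - v0 / 2 ^ Suc n) + v0 / 2 ^ (n + 2)"
      using h z by (intro add_mono Suc.IH V_close) auto
    also have "\<dots> = v0 / 2 - v0 / 2 ^ Suc (Suc n)" by (simp add: field_simps)
    finally show ?case .
  qed
  then show ?thesis using v0 by (smt (verit) divide_nonneg_pos zero_less_power)
qed

definition level :: "'a \<Rightarrow> nat"
  where "level x = (LEAST n. x \<notin> B (Suc n))"

text \<open>The differences \<open>B n - B (Suc n)\<close> are disjoint, so a point of
  \<open>B 0\<close> outside the null intersection receives a new polynomial jump in just one
  correction, the one numbered \<open>level x\<close>. Outside \<open>B 0\<close> the value 0 is the
  true one: no jump is ever made there.\<close>

definition jumps :: "nat \<Rightarrow> 'a \<Rightarrow> complex"
  where "jumps i x = (if x \<in> B 0 \<and> (\<exists>n. x \<notin> B n)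
    then jump (level x) (V (level x)) (V (Suc (level x))) i x else 0)"

lemma level:
  assumes "x \<in> B 0" "x \<notin> B n"
  shows "x \<in> B (level x)" "x \<notin> B (Suc (level x))"
proof -
  from assms obtain k where k: "x \<notin> B (Suc k)" by (cases n) auto
  then show "x \<notin> B (Suc (level x))" unfolding level_def by (rule LeastI)
  show "x \<in> B (level x)"
  proof (cases "level x")
    case (Suc j)
    then have "j < level x" by simp
    then show ?thesis using Suc not_less_Least[of j "\<lambda>n. x \<notin> B (Suc n)"] by (simp add: level_def)
  qed (use assms in simp)
qed

lemma measurable_jumps: "jumps i \<in> borel_measurable M"
proof -
  have [measurable]: "level \<in> measurable M (count_space UNIV)"
    unfolding level_def by measurable
  have [measurable]: "(\<lambda>x. jump (level x) (V (level x)) (V (Suc (level x))) i x) \<in> borel_measurable M"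
    by (rule measurable_compose_countable[where f="\<lambda>n. jump n (V n) (V (Suc n)) i" and g=level])
      (auto intro: measurable_jump V_meas)
  show ?thesis unfolding jumps_def by measurable
qed

lemma jumps_int: "jumps i x \<in> gauss_int"
  by (simp add: jumps_def jump_def \<kappa>_int)

lemma jumps_finite: "\<exists>k. \<forall>i\<ge>k. jumps i x = 0"
  by (auto simp: jumps_def jump_def \<kappa>_0 intro!: exI[of _ "m (level x)"])

lemma jumps_outside: "x \<notin> B 0 \<Longrightarrow> jumps i x = 0"
  by (simp add: jumps_def)

lemma jumps_bound:
  assumes h: "\<And>n. hits n x" and nz: "jumps i x \<noteq> 0"
  shows "x \<in> B (level x)" "i < m (level x)" "norm (jumps i x) \<le> H (level x)"
proof -
  let ?n = "level x"
  have "x \<in> B 0 \<and> (\<exists>k. x \<notin> B k)" using nz by (auto simp: jumps_def split: if_splits)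
  then obtain k where x: "x \<in> B 0" "x \<notin> B k" by blast
  then have j: "jumps i x = jump ?n (V ?n) (V (Suc ?n)) i x" by (auto simp: jumps_def)
  note l = level[OF x]
  show "x \<in> B ?n" by (rule l)
  show "i < m ?n" using nz \<kappa>_0[of ?n i] by (cases "i < m ?n") (auto simp: j jump_def)
  show "norm (jumps i x) \<le> H ?n"
    unfolding j jump_def
  proof (rule \<kappa>_le)
    fix z assume z: "z \<in> R"
    have "norm (V ?n x z - z * V (Suc ?n) (S x) z) \<le> norm (V ?n x z) + norm z * norm (V (Suc ?n) (S x) z)"
      using norm_triangle_ineq4 by (metis norm_mult)
    also have "\<dots> \<le> 2 * v0 + 1 * (2 * v0)"
      using z h hits_S[OF h l(2)] by (intro add_mono mult_mono norm_V_le R) auto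
    finally show "norm ((\<lambda>z\<in>R. V ?n x z - z * V (Suc ?n) (S x) z) z) \<le> 4" using v0 z by simp
  qed
qed

text \<open>Corrections after number \<open>level x\<close> copy the jump made there, so the
  equation at \<open>x\<close> no longer changes. A point of \<open>B 0\<close> outside
  \<open>B k\<close> has level below \<open>k\<close>, whence the bound on \<open>N\<close>.\<close>

lemma V_step_eventually:
  assumes h: "\<And>n. hits n x" and x: "x \<notin> B k" and z: "z \<in> R" and N: "N \<ge> k"
  shows "V N x z = z * V N (S x) z + (\<Sum>i. z ^ i * jumps i x)"
proof (cases "x \<in> B 0")
  case False
  have "V N x z = z * V N (S x) z"
  proof (induction N)
    case 0
    show ?case by (rule V0_S[OF False h z])
  next
    case (Suc N)
    have "x \<notin> B N" "x \<notin> B (Suc N)" using False B_mono[of 0] by auto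
    then show ?case using V_corr[of N] Suc h z by (simp add: correction_def)
  qed
  then show ?thesis by (simp add: jumps_outside[OF False])
next
  case True
  let ?n = "level x"
  note l = level[OF True x]
  have sum: "(\<Sum>i. z ^ i * jumps i x) = (\<Sum>i<m ?n. jump ?n (V ?n) (V (Suc ?n)) i x * z ^ i)"
    using True x by (subst suminf_finite[of "{..<m ?n}"])
      (auto simp: jumps_def jump_def \<kappa>_0 mult.commute intro!: sum.cong)
  have "V N x z = z * V N (S x) z + (\<Sum>i. z ^ i * jumps i x)" if "N \<ge> Suc ?n" for N
    using that
  proof (induction N rule: dec_induct)
    case base
    then show ?case using V_corr[of ?n] l h z sum by (simp add: correction_def)
  next
    case (step N)
    have "x \<notin> B N" "x \<notin> B (Suc N)" using l(2) step.hyps B_mono[of "Suc ?n" N] B_mono[of "Suc ?n" "Suc N"] by auto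
    then show ?case using V_corr[of N] step.IH h z by (simp add: correction_def)
  qed
  moreover have "Suc ?n \<le> N"
  proof (rule ccontr)
    assume "\<not> Suc ?n \<le> N"
    then have "B ?n \<subseteq> B k" using N by (intro B_mono) simp
    then show False using l(1) x by blast
  qed
  ultimately show ?thesis by blast
qed

definition Vlim :: "complex \<Rightarrow> 'a \<Rightarrow> complex"
  where "Vlim z x = lim (\<lambda>n. V n x z)"

lemma measurable_Vlim: "z \<in> R \<Longrightarrow> Vlim z \<in> borel_measurable M"
  unfolding Vlim_def using measurable_coord[OF V_meas] by (intro borel_measurable_lim_metric) auto

lemma V_tendsto:
  assumes h: "\<And>n. hits n x" and z: "z \<in> R"
  shows "(\<lambda>n. V n x z) \<longlonglongrightarrow> Vlim z x"
proof -
  have "summable (\<lambda>n. V (Suc n) x z - V n x z)"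
  proof (rule summable_comparison_test')
    show "summable (\<lambda>n. (1 / 2) ^ n * v0)" by (intro summable_mult2 summable_geometric) auto
    show "norm (V (Suc n) x z - V n x z) \<le> (1 / 2) ^ n * v0" if "n \<ge> 0" for n
    proof -
      have "v0 / 2 ^ (n + 2) \<le> v0 / 2 ^ n" using v0 by (intro divide_left_mono power_increasing) auto
      then show ?thesis using V_close[OF h z, of n] by (simp add: power_one_over)
    qed
  qed
  then have "convergent (\<lambda>n. \<Sum>i<n. V (Suc i) x z - V i x z)" by (simp add: summable_iff_convergent)
  then have "convergent (\<lambda>n. (V n x z - V 0 x z) + V 0 x z)"
    unfolding sum_lessThan_telescope[of "\<lambda>i. V i x z"] by (intro convergent_add convergent_const)
  then show ?thesis by (simp add: Vlim_def convergent_LIMSEQ_iff)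
qed

lemma AE_Vlim_S: "AE x in M. \<forall>z\<in>R. Vlim z x = z * Vlim z (S x) + (\<Sum>i. z ^ i * jumps i x)"
  using AE_hits AE_not_all_B
proof eventually_elim
  case (elim x)
  then have h: "hits n x" for n by blast
  obtain k where k: "x \<notin> B k" using elim by blast
  have h': "hits n (S x)" for n
    using hits_antimono[OF hits_S[OF h, of "max n k"], of n] k B_mono[of k "max n k"] by auto
  show ?case
  proof
    fix z assume z: "z \<in> R"
    have "(\<lambda>N. z * V N (S x) z + (\<Sum>i. z ^ i * jumps i x)) \<longlonglongrightarrow> z * Vlim z (S x) + (\<Sum>i. z ^ i * jumps i x)"
      by (intro tendsto_intros V_tendsto h' z)
    then have "(\<lambda>N. V N x z) \<longlonglongrightarrow> z * Vlim z (S x) + (\<Sum>i. z ^ i * jumps i x)"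
      by (rule Lim_transform_eventually)
        (use V_step_eventually[OF h k z] in \<open>auto simp: eventually_sequentially intro!: exI[of _ k]\<close>)
    then show "Vlim z x = z * Vlim z (S x) + (\<Sum>i. z ^ i * jumps i x)"
      using V_tendsto[OF h z] by (rule LIMSEQ_unique[rotated])
  qed
qed

lemma AE_Vlim_T:
  "AE x in M. \<forall>z\<in>R. Vlim z (T x) = z * Vlim z x + (\<Sum>i. z ^ i * jumps i (T x))"
  using AE_T[OF AE_Vlim_S] ST by eventually_elim auto

lemma AE_Vlim_near_v0: "AE x in M. x \<in> B 0 \<longrightarrow> (\<forall>z\<in>R. norm (Vlim z x - v0) \<le> v0 / 2)"
  using AE_hits
proof eventually_elim
  case (elim x)
  show ?case
  proof (intro impI ballI)
    fix z assume x: "x \<in> B 0" and z: "z \<in> R"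
    have "(\<lambda>n. norm (V n x z - v0)) \<longlonglongrightarrow> norm (Vlim z x - v0)"
      using elim z by (intro tendsto_intros V_tendsto) auto
    then show "norm (Vlim z x - v0) \<le> v0 / 2"
      by (rule LIMSEQ_le_const2) (use V_near_v0[OF x _ z] elim in blast)
  qed
qed

end

lemma term_le_suminf:
  fixes f :: "nat \<Rightarrow> 'a :: {ordered_comm_monoid_add, linorder_topology}"
  assumes "summable f" "\<And>n. 0 \<le> f n"
  shows "f n \<le> suminf f"
  using sum_le_suminf[of f "{n}"] assms by simp

context ergodic_mpt
begin

lemma AE_imp_ex_in:
  assumes "Y \<in> sets M" "prob Y > 0" "AE x in M. P x"
  shows "\<exists>y\<in>Y. P y"
proof (rule ccontr)
  assume "\<not> ?thesis"
  then have "AE x in M. x \<notin> Y" using assms(3) by auto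
  then show False using assms(1,2) by (simp add: prob_eq_0[symmetric])
qed

lemma nn_integral_indicator_funpow:
  assumes [measurable]: "A \<in> sets M"
  shows "(\<integral>\<^sup>+x. indicator A ((T ^^ k) x) \<partial>M) = emeasure M A"
proof -
  have "(\<integral>\<^sup>+x. indicator A ((T ^^ k) x) \<partial>M) = (\<integral>\<^sup>+x. indicator A x \<partial>distr M M (T ^^ k))"
    by (rule nn_integral_distr[symmetric]) measurable
  then show ?thesis by (simp add: distr_funpow_T)
qed

end

section \<open>Choice of the nested sets and the cost of future jumps\<close>

context nonatomic_ergodic_mpt
begin

lemma nested_small_sets:
  assumes B0: "B0 \<in> sets M" "prob B0 > 0" and e: "\<And>n. e n > 0"
  obtains B where "B 0 = B0" "\<And>n. B n \<in> sets M" "\<And>n. prob (B n) > 0"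
    "\<And>n. B (Suc n) \<subseteq> B n" "\<And>n. prob (B (Suc n)) < e n"
proof -
  have "\<exists>B. \<forall>n. (B n \<in> sets M \<and> prob (B n) > 0 \<and> (n = 0 \<longrightarrow> B n = B0)) \<and>
      (B (Suc n) \<subseteq> B n \<and> prob (B (Suc n)) < e n)"
  proof (rule dependent_nat_choice)
    show "\<exists>C. C \<in> sets M \<and> prob C > 0 \<and> ((0::nat) = 0 \<longrightarrow> C = B0)" using B0 by auto
    show "\<exists>D. (D \<in> sets M \<and> prob D > 0 \<and> (Suc n = 0 \<longrightarrow> D = B0)) \<and> D \<subseteq> C \<and> prob D < e n"
      if "C \<in> sets M \<and> prob C > 0 \<and> (n = 0 \<longrightarrow> C = B0)" for C n
      using nonatomic[of C "e n"] that e by auto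
  qed
  then obtain B where "\<And>n. B n \<in> sets M \<and> prob (B n) > 0 \<and> (n = 0 \<longrightarrow> B n = B0)"
    "\<And>n. B (Suc n) \<subseteq> B n \<and> prob (B (Suc n)) < e n" by blast
  then show ?thesis by (intro that[of B]) auto
qed

text \<open>\<open>\<Psi> x\<close> is a discounted cost of all jumps in the future of
  \<open>x\<close>, large enough to dominate each single one with the decay demanded by
  \<open>decaying_inputs\<close>. On \<open>Y\<close> this cost is small while the coordinates are
  still near \<open>v0\<close>; nonconstancy will come from the combination of the two.\<close>

lemma equivariant_solution:
  fixes R :: "complex set" and \<beta> v0 \<psi> :: real
  assumes R: "finite R" "\<And>z. z \<in> R \<Longrightarrow> norm z \<le> 1"
    and nz: "\<And>z. z \<in> R \<Longrightarrow> z \<noteq> 0" and nru: "\<And>z n. z \<in> R \<Longrightarrow> n > 0 \<Longrightarrow> z ^ n \<noteq> 1"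
    and \<beta>: "0 < \<beta>" "\<beta> < 1" and v0: "0 < v0" "v0 \<le> 1" and \<psi>: "\<psi> > 0"
  obtains V :: "complex \<Rightarrow> 'a \<Rightarrow> complex" and c :: "nat \<Rightarrow> 'a \<Rightarrow> complex" and \<Psi> :: "'a \<Rightarrow> real" and Y
  where "\<And>z. z \<in> R \<Longrightarrow> V z \<in> borel_measurable M" "\<And>i. c i \<in> borel_measurable M"
    "\<And>i x. c i x \<in> gauss_int" "\<And>x. \<exists>k. \<forall>i\<ge>k. c i x = 0"
    "AE x in M. \<forall>z\<in>R. V z (T x) = z * V z x + (\<Sum>i. z ^ i * c i (T x))"
    "AE x in M. \<forall>i. \<forall>s\<ge>1. (real i + 1) * norm (c i ((T ^^ s) x)) \<le> \<beta> ^ (2 * i) * \<Psi> x / \<beta> ^ s"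
    "Y \<in> sets M" "prob Y > 0"
    "AE x in M. x \<in> Y \<longrightarrow> \<Psi> x \<le> \<psi> \<and> (\<forall>z\<in>R. norm (V z x - v0) \<le> v0 / 2)"
proof -
  define good :: "nat \<Rightarrow> (nat \<Rightarrow> (complex \<Rightarrow> complex) \<Rightarrow> complex) \<Rightarrow> nat \<Rightarrow> real \<Rightarrow> bool"
    where "good = (\<lambda>n \<kappa> m H. (\<forall>i w. \<kappa> i w \<in> gauss_int) \<and>
      (\<forall>i. \<kappa> i \<in> borel_measurable (PiM R (\<lambda>_. borel))) \<and>
      (\<forall>i w. i \<ge> m \<longrightarrow> \<kappa> i w = 0) \<and> H > 0 \<and>
      (\<forall>i w. (\<forall>z\<in>R. norm (w z) \<le> 4) \<longrightarrow> norm (\<kappa> i w) \<le> H) \<and>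
      (\<forall>w. \<forall>z\<in>R. norm (w z - (\<Sum>i<m. \<kappa> i w * z ^ i)) \<le> v0 / 2 ^ (n + 2)))"
  have "\<exists>\<kappa> m H. good n \<kappa> m H" for n
  proof -
    have d: "0 < v0 / 2 ^ (n + 2)" using v0 by simp
    show ?thesis
    proof (rule steering[OF R nz nru d])
      fix \<kappa> :: "nat \<Rightarrow> (complex \<Rightarrow> complex) \<Rightarrow> complex" and m :: nat and H :: real
      assume "\<And>i w. \<kappa> i w \<in> gauss_int" "\<And>i. \<kappa> i \<in> borel_measurable (PiM R (\<lambda>_. borel))"
        "\<And>i w. i \<ge> m \<Longrightarrow> \<kappa> i w = 0" "H > 0"
        "\<And>i w. (\<And>z. z \<in> R \<Longrightarrow> norm (w z) \<le> 4) \<Longrightarrow> norm (\<kappa> i w) \<le> H"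
        "\<And>w z. z \<in> R \<Longrightarrow> norm (w z - (\<Sum>i<m. \<kappa> i w * z ^ i)) \<le> v0 / 2 ^ (n + 2)"
      then have "good n \<kappa> m H" unfolding good_def by blast
      then show ?thesis by blast
    qed
  qed
  then obtain \<kappa> m H where "\<And>n. good n (\<kappa> n) (m n) (H n)" by metis
  note \<kappa> = this[unfolded good_def]
  \<comment> \<open>\<open>H n * (m n + 1)\<close> bounds a jump coefficient at level
    \<open>n\<close> times its \<open>i + 1\<close>. The division provides the decay
    \<open>\<beta> ^ (2 * i)\<close>, as \<open>i < m n\<close> for the nonzero
    coefficients.\<close>
  define A where "A = (\<lambda>n. H n * (real (m n) + 1) / \<beta> ^ (2 * m n))"
  have A: "A n > 0" for n using \<kappa> \<beta> by (simp add: A_def)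
  \<comment> \<open>Points of \<open>B0\<close> will not return within \<open>L\<close> steps, and
    the geometric tail of the level 0 cost after that is at most \<open>\<psi> / 4\<close>.\<close>
  obtain L where L: "\<beta> ^ L < \<psi> * (1 - \<beta>) / (4 * A 0)"
    using real_arch_pow_inv[of "\<psi> * (1 - \<beta>) / (4 * A 0)" \<beta>] \<psi> \<beta> A by auto
  obtain B0 where B0: "B0 \<in> sets M" "prob B0 > 0"
    and ret: "\<And>x i. x \<in> B0 \<Longrightarrow> 1 \<le> i \<Longrightarrow> i < Suc L \<Longrightarrow> (T ^^ i) x \<notin> B0"
    using long_return_set[of 1 "Suc L"] by auto
  \<comment> \<open>The first bound makes the intersection of the sets null. The second makes the
    costs of all levels above 0 integrate to at most \<open>\<psi> * prob B0 / 4\<close>; its factor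
    \<open>1 - \<beta>\<close> compensates the geometric series over the visiting times.\<close>
  define e where "e = (\<lambda>n. min (1 / 2 ^ n) (\<psi> * prob B0 * (1 - \<beta>) / (A (Suc n) * 2 ^ (n + 3))))"
  have e: "e n > 0" for n using \<psi> B0 \<beta> A by (simp add: e_def)
  obtain B where Bs: "B 0 = B0" "\<And>n. B n \<in> sets M" "\<And>n. prob (B n) > 0"
    "\<And>n. B (Suc n) \<subseteq> B n" "\<And>n. prob (B (Suc n)) < e n"
    using nested_small_sets[OF B0, of e] e by blast
  note [measurable] = Bs(2)
  interpret steering_tower M T S R v0 \<kappa> m H B
  proof unfold_locales
    show "prob (B (Suc n)) < 1 / 2 ^ n" for n using Bs(5)[of n] by (simp add: e_def)
  qed (use R v0 \<kappa> Bs in auto)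
  obtain V where "\<And>n. V n \<in> measurable M (PiM R (\<lambda>_. borel)) \<and> correction n (V n) (V (Suc n))"
    "\<And>x z. x \<in> B 0 \<Longrightarrow> z \<in> R \<Longrightarrow> V 0 x z = of_real v0"
    "\<And>x z. x \<notin> B 0 \<Longrightarrow> hits 0 x \<Longrightarrow> z \<in> R \<Longrightarrow> V 0 x z = z * V 0 (S x) z"
    using tower_functions_exist by blast
  then interpret tower_functions M T S R v0 \<kappa> m H B V
    by unfold_locales auto
  \<comment> \<open>The level 0 cost converges everywhere and is estimated pointwise through the
    return time. The deeper costs are known to be finite only almost everywhere, through their
    integral, hence the extended reals for \<open>\<Psi>1\<close>.\<close>
  define \<Psi>0 where "\<Psi>0 = (\<lambda>x. \<Sum>s. A 0 * \<beta> ^ Suc s * indicat_real (B 0) ((T ^^ Suc s) x))"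
  define \<Psi>1 where "\<Psi>1 = (\<lambda>x. \<Sum>n. \<Sum>s. ennreal (A (Suc n) * \<beta> ^ Suc s) * indicator (B (Suc n)) ((T ^^ Suc s) x))"
  define \<Psi> where "\<Psi> = (\<lambda>x. \<Psi>0 x + enn2real (\<Psi>1 x))"
  have [measurable]: "\<Psi>1 \<in> borel_measurable M" unfolding \<Psi>1_def by measurable
  have sgeo: "summable (\<lambda>s. C * \<beta> ^ s)" "(\<Sum>s. C * \<beta> ^ s) = C / (1 - \<beta>)" for C
    using \<beta> by (auto intro!: summable_mult simp: suminf_mult suminf_geometric)
  have s0: "summable (\<lambda>s. A 0 * \<beta> ^ Suc s * indicat_real (B 0) ((T ^^ Suc s) x))" for x
    by (rule summable_comparison_test'[OF sgeo(1)[of "A 0 * \<beta>"]])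
      (use \<beta> A[of 0] in \<open>auto simp: indicator_def\<close>)
  have int: "(\<integral>\<^sup>+x. \<Psi>1 x \<partial>M) \<le> ennreal (\<psi> * prob B0 / 4)"
  proof -
    have "(\<integral>\<^sup>+x. \<Psi>1 x \<partial>M) = (\<Sum>n. \<Sum>s. ennreal (A (Suc n) * \<beta> ^ Suc s) * emeasure M (B (Suc n)))"
      unfolding \<Psi>1_def
      by (simp add: nn_integral_suminf nn_integral_cmult nn_integral_indicator_funpow del: funpow.simps)
    also have "\<dots> \<le> (\<Sum>n. ennreal (\<psi> * prob B0 / 8 * (1 / 2) ^ n))"
    proof (intro suminf_le summableI)
      fix n
      have "(\<Sum>s. ennreal (A (Suc n) * \<beta> ^ Suc s) * emeasure M (B (Suc n))) =
          (\<Sum>s. ennreal (A (Suc n) * prob (B (Suc n)) * \<beta> * \<beta> ^ s))"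
        using A \<beta> by (simp add: emeasure_eq_measure ennreal_mult'[symmetric] less_imp_le mult_ac)
      also have "\<dots> = ennreal (A (Suc n) * prob (B (Suc n)) * \<beta> / (1 - \<beta>))"
        using A[of "Suc n"] \<beta> sgeo(1)[of "A (Suc n) * prob (B (Suc n)) * \<beta>"]
        by (subst suminf_ennreal2) (auto simp: sgeo(2) less_imp_le)
      also have "\<dots> \<le> ennreal (\<psi> * prob B0 / 8 * (1 / 2) ^ n)"
      proof (rule ennreal_leI)
        have "prob (B (Suc n)) \<le> \<psi> * prob B0 * (1 - \<beta>) / (A (Suc n) * 2 ^ (n + 3))"
          using Bs(5)[of n] by (simp add: e_def)
        then have "A (Suc n) * prob (B (Suc n)) * 1 / (1 - \<beta>) \<le> \<psi> * prob B0 / 8 * (1 / 2) ^ n"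
          using A[of "Suc n"] \<beta> by (simp add: field_simps power_add)
        moreover have "A (Suc n) * prob (B (Suc n)) * \<beta> / (1 - \<beta>) \<le> A (Suc n) * prob (B (Suc n)) * 1 / (1 - \<beta>)"
          using A[of "Suc n"] \<beta> by (intro divide_right_mono mult_left_mono) auto
        ultimately show "A (Suc n) * prob (B (Suc n)) * \<beta> / (1 - \<beta>) \<le> \<psi> * prob B0 / 8 * (1 / 2) ^ n"
          by linarith
      qed
      finally show "(\<Sum>s. ennreal (A (Suc n) * \<beta> ^ Suc s) * emeasure M (B (Suc n))) \<le>
          ennreal (\<psi> * prob B0 / 8 * (1 / 2) ^ n)" .
    qed
    also have "\<dots> = ennreal (\<Sum>n. \<psi> * prob B0 / 8 * (1 / 2) ^ n)"
      using \<psi> by (intro suminf_ennreal2 summable_mult summable_geometric) auto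
    also have "(\<Sum>n. \<psi> * prob B0 / 8 * (1 / 2) ^ n) = \<psi> * prob B0 / 4"
      by (subst suminf_mult) (auto simp: suminf_geometric)
    finally show ?thesis .
  qed
  then have "(\<integral>\<^sup>+x. \<Psi>1 x \<partial>M) \<noteq> \<infinity>" by (metis ennreal_less_top infinity_ennreal_def leD)
  then have fin: "AE x in M. \<Psi>1 x \<noteq> \<infinity>" by (intro nn_integral_PInf_AE) auto
  have le_Psi: "A n * \<beta> ^ s * indicator (B n) ((T ^^ s) x) \<le> \<Psi> x"
    if "\<Psi>1 x \<noteq> \<infinity>" and s: "s \<ge> 1" for n s x
  proof -
    obtain t where t: "s = Suc t" using s by (cases s) auto
    have 0: "0 \<le> \<Psi>0 x" unfolding \<Psi>0_def
      using A[of 0] \<beta> by (intro suminf_nonneg s0) (auto simp del: funpow.simps)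
    show ?thesis
    proof (cases n)
      case 0
      have "A 0 * \<beta> ^ Suc t * indicat_real (B 0) ((T ^^ Suc t) x) \<le> \<Psi>0 x"
        unfolding \<Psi>0_def
        by (rule term_le_suminf[OF s0]) (use A[of 0] \<beta> in \<open>auto simp del: funpow.simps\<close>)
      then show ?thesis using 0 t by (simp add: \<Psi>_def \<open>n = 0\<close> add_increasing2 del: funpow.simps)
    next
      case (Suc k)
      let ?f = "\<lambda>n s. ennreal (A (Suc n) * \<beta> ^ Suc s) * indicator (B (Suc n)) ((T ^^ Suc s) x)"
      have "?f k t \<le> (\<Sum>s. ?f k s)" by (rule term_le_suminf) auto
      also have "\<dots> \<le> (\<Sum>n. \<Sum>s. ?f n s)" by (rule term_le_suminf[of "\<lambda>n. \<Sum>s. ?f n s"]) auto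
      finally have "?f k t \<le> \<Psi>1 x" by (simp only: \<Psi>1_def)
      then have "enn2real (?f k t) \<le> enn2real (\<Psi>1 x)"
        using that(1) by (intro enn2real_mono) (auto simp: top.not_eq_extremum)
      moreover have "enn2real (?f k t) = A (Suc k) * \<beta> ^ Suc t * indicator (B (Suc k)) ((T ^^ Suc t) x)"
        using A[of "Suc k"] \<beta> by (simp add: enn2real_mult indicator_def del: funpow.simps)
      ultimately show ?thesis using 0 t Suc by (simp add: \<Psi>_def del: funpow.simps)
    qed
  qed
  define Y where "Y = {x \<in> space M. x \<in> B 0 \<and> \<Psi>1 x \<le> ennreal (\<psi> / 2)}"
  show ?thesis
  proof (rule that[of Vlim jumps \<Psi> Y])
    show "AE x in M. \<forall>i. \<forall>s\<ge>1. (real i + 1) * norm (jumps i ((T ^^ s) x)) \<le> \<beta> ^ (2 * i) * \<Psi> x / \<beta> ^ s"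
      using fin AE_all_funpow_T[OF AE_hits]
    proof eventually_elim
      case (elim x)
      show ?case
      proof (intro allI impI)
        fix i s :: nat assume s: "s \<ge> 1"
        let ?y = "(T ^^ s) x" and ?n = "level ((T ^^ s) x)"
        show "(real i + 1) * norm (jumps i ?y) \<le> \<beta> ^ (2 * i) * \<Psi> x / \<beta> ^ s"
        proof (cases "jumps i ?y = 0")
          case True
          have "0 \<le> A 0 * \<beta> ^ s * indicator (B 0) ?y" using A[of 0] \<beta> by simp
          then have "0 \<le> \<Psi> x" using le_Psi[of x s 0] elim s by linarith
          then show ?thesis using True \<beta> by simp
        next
          case False
          have h: "hits n ?y" for n using elim by blast
          note j = jumps_bound[OF h False]
          have "(real i + 1) * norm (jumps i ?y) \<le> (real (m ?n) + 1) * H ?n"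
            using j by (intro mult_mono) auto
          also have "\<dots> = \<beta> ^ (2 * m ?n) * A ?n" using \<beta> by (simp add: A_def)
          also have "\<dots> \<le> \<beta> ^ (2 * i) * A ?n"
            using j \<beta> A[of ?n] by (intro mult_right_mono power_decreasing) auto
          also have "\<dots> \<le> \<beta> ^ (2 * i) * (\<Psi> x / \<beta> ^ s)"
            using le_Psi[of x s ?n] elim s j(1) \<beta> by (intro mult_left_mono) (auto simp: field_simps)
          finally show ?thesis by simp
        qed
      qed
    qed
    show Y: "Y \<in> sets M" unfolding Y_def by measurable
    \<comment> \<open>If \<open>Y\<close> were null, \<open>\<Psi>1\<close> would be at least
      \<open>\<psi> / 2\<close> almost everywhere on \<open>B 0\<close>, and its integral at least
      twice the bound \<open>int\<close>.\<close>
    show "prob Y > 0"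
    proof (rule ccontr)
      assume "\<not> prob Y > 0"
      then have "prob Y = 0" using measure_nonneg[of M Y] by linarith
      then have "AE x in M. x \<notin> Y" using Y by (simp add: prob_eq_0)
      then have "AE x in M. ennreal (\<psi> / 2) * indicator (B 0) x \<le> \<Psi>1 x"
        using AE_space by eventually_elim (auto simp: Y_def indicator_def)
      then have "(\<integral>\<^sup>+x. ennreal (\<psi> / 2) * indicator (B 0) x \<partial>M) \<le> (\<integral>\<^sup>+x. \<Psi>1 x \<partial>M)"
        by (rule nn_integral_mono_AE)
      also note int
      also have "(\<integral>\<^sup>+x. ennreal (\<psi> / 2) * indicator (B 0) x \<partial>M) = ennreal (\<psi> / 2) * emeasure M (B 0)"
        by (rule nn_integral_cmult_indicator) (rule Bs)
      also have "\<dots> = ennreal (\<psi> / 2 * prob B0)"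
        using \<psi> by (simp add: emeasure_eq_measure Bs(1) flip: ennreal_mult')
      finally have "ennreal (\<psi> / 2 * prob B0) \<le> ennreal (\<psi> * prob B0 / 4)" .
      then show False using \<psi> B0 by (simp add: ennreal_le_iff)
    qed
    have "\<Psi>0 x \<le> \<psi> / 4" if x: "x \<in> B 0" for x
    proof -
      let ?f = "\<lambda>s. A 0 * \<beta> ^ Suc s * indicat_real (B 0) ((T ^^ Suc s) x)"
      have "(\<Sum>s<L. ?f s) = 0"
      proof (intro sum.neutral ballI)
        fix s assume "s \<in> {..<L}"
        then have "(T ^^ Suc s) x \<notin> B 0" using ret[of x "Suc s"] x Bs(1) by simp
        then show "?f s = 0" by simp
      qed
      then have "\<Psi>0 x = (\<Sum>s. ?f (s + L))"
        unfolding \<Psi>0_def using suminf_split_initial_segment[OF s0, of x L] by simp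
      also have "\<dots> \<le> (\<Sum>s. A 0 * \<beta> ^ L * \<beta> ^ s)"
      proof (intro suminf_le sgeo)
        show "summable (\<lambda>s. ?f (s + L))" using s0[of x] by (subst summable_iff_shift)
        fix s
        have "?f (s + L) \<le> A 0 * \<beta> ^ Suc (s + L) * 1"
          using A[of 0] \<beta> by (intro mult_left_mono) (auto simp: indicator_def)
        also have "\<dots> \<le> A 0 * \<beta> ^ (s + L) * 1"
          using A[of 0] \<beta> by (intro mult_right_mono mult_left_mono power_decreasing) auto
        finally show "?f (s + L) \<le> A 0 * \<beta> ^ L * \<beta> ^ s" by (simp add: power_add mult_ac)
      qed
      also have "\<dots> = A 0 * \<beta> ^ L / (1 - \<beta>)" by (rule sgeo)
      also have "\<dots> \<le> \<psi> / 4" using L A[of 0] \<beta> by (simp add: field_simps)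
      finally show ?thesis .
    qed
    moreover have "enn2real (\<Psi>1 x) \<le> \<psi> / 2" if "\<Psi>1 x \<le> ennreal (\<psi> / 2)" for x
      using that \<psi> by (intro enn2real_leI) auto
    ultimately have "\<Psi> x \<le> \<psi> / 4 + \<psi> / 2" if "x \<in> Y" for x
      using that unfolding Y_def \<Psi>_def by (intro add_mono) auto
    then have \<Psi>_le: "\<Psi> x \<le> \<psi>" if "x \<in> Y" for x
      using that \<psi> by fastforce
    have YB: "x \<in> B 0" if "x \<in> Y" for x using that by (simp add: Y_def)
    show "AE x in M. x \<in> Y \<longrightarrow> \<Psi> x \<le> \<psi> \<and> (\<forall>z\<in>R. norm (Vlim z x - v0) \<le> v0 / 2)"
      using AE_Vlim_near_v0 by eventually_elim (use \<Psi>_le YB in blast)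
  qed (fact measurable_Vlim measurable_jumps jumps_int jumps_finite AE_Vlim_T)+
qed

end

section \<open>Nonconstant solutions\<close>

lemma cpoly_diff: "cpoly (p - q) = cpoly p - cpoly q"
  by (intro poly_eqI) (simp add: coeff_map_poly)

lemma root_of_unity_imp_dvd:
  assumes "irreducible p" "poly (cpoly p) z = 0" "z ^ n = 1"
  shows "p dvd monom 1 n - 1"
  using assms
  by (intro irreducible_dvd_if_common_root[of p z]) (simp_all add: cpoly_diff map_poly_monom poly_monom)

context nonatomic_ergodic_mpt
begin

text \<open>Nonconstancy is decided at one point \<open>y\<close> of \<open>Y\<close>. There the
  inputs at times 1 to \<open>d\<close> vanish, so \<open>f ((T ^^ k) y)\<close> is the exponential
  sum of the \<open>\<alpha> z * z ^ k * u z y\<close>. If both parts of \<open>f\<close> were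
  constant modulo 1, smallness would make these values equal,
  \<open>poly (cpoly p) 1 \<noteq> 0\<close> would make them 0, and the Vandermonde argument would
  give \<open>u z y = 0\<close>. But for \<open>z\<close> in \<open>R\<close>, \<open>V z y\<close>
  is within \<open>v0 / 2\<close> of \<open>v0\<close> and the pending inputs contribute at most
  \<open>v0 / 4\<close>.\<close>

lemma nonconstant_real_solution:
  fixes p :: "int poly"
  assumes p: "irreducible p" "degree p > 0" "coeff p 0 \<noteq> 0"
    and ncyc: "\<And>n. n > 0 \<Longrightarrow> \<not> p dvd monom 1 n - 1"
    and root: "\<exists>z. poly (cpoly p) z = 0 \<and> norm z \<le> 1"
  shows "\<exists>h\<in>borel_measurable M. \<not> (\<exists>c. AE x in M. h x - c \<in> \<int>) \<and>
    (AE x in M. (\<Sum>k\<le>degree p. of_int (coeff p k) * h ((T ^^ k) x)) \<in> (\<int> :: real set))"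
proof -
  define d where "d = degree p"
  define Z where "Z = {z. poly (cpoly p) z = 0}"
  define R where "R = {z \<in> Z. norm z \<le> 1}"
  have Z: "finite Z" "card Z = d" using card_roots_cpoly[OF p(1,2)] by (auto simp: Z_def d_def)
  have R: "finite R" "\<And>z. z \<in> R \<Longrightarrow> norm z \<le> 1" "R \<subseteq> Z" using Z by (auto simp: R_def)
  have Z0: "z \<noteq> 0" if "z \<in> Z" for z
    using that p(3) by (auto simp: Z_def poly_0_coeff_0 coeff_map_poly)
  have nru: "z ^ n \<noteq> 1" if "z \<in> Z" "n > 0" for z n
    using root_of_unity_imp_dvd[OF p(1), of z n] ncyc[of n] that by (auto simp: Z_def)
  obtain \<alpha> where \<alpha>: "\<And>z. z \<in> Z \<Longrightarrow> \<alpha> z \<noteq> 0"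
    and \<alpha>_sum: "\<And>i. i < degree p \<Longrightarrow>
      of_int (lead_coeff p) * (\<Sum>z\<in>Z. \<alpha> z * z ^ i) = (if Suc i = degree p then 1 else 0)"
    using partial_fraction_weights[OF p(1,2), folded Z_def] by blast
  \<comment> \<open>The inserted 4 covers the case that no root lies outside the closed disc. Taking
    \<open>\<beta> = 1 / sqrt \<rho>\<close> then gives both \<open>\<beta> < 1\<close> and the
    bound that \<open>future_seq\<close> demands of expanding roots.\<close>
  define \<rho> where "\<rho> = Min (insert 4 (norm ` (Z - R)))"
  have \<rho>: "1 < \<rho>" "\<And>z. z \<in> Z - R \<Longrightarrow> \<rho> \<le> norm z"
    using Z(1) by (auto simp: \<rho>_def R_def)
  define \<beta> where "\<beta> = 1 / sqrt \<rho>"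
  have \<beta>: "0 < \<beta>" "\<beta> < 1" using \<rho> by (auto simp: \<beta>_def)
  have \<beta>2: "1 \<le> \<beta>\<^sup>2 * norm z" if "z \<in> Z - R" for z
    using \<rho>(1) \<rho>(2)[OF that] by (simp add: \<beta>_def power_divide)
  define C where "C = (\<Sum>z\<in>Z. norm (\<alpha> z) * (1 + norm z) ^ d)"
  have C: "C \<ge> 0" by (auto simp: C_def intro!: sum_nonneg)
  \<comment> \<open>With \<open>norm (u z y) \<le> 2 * v0\<close>, the values of \<open>f\<close> at
    times up to \<open>d\<close> stay below 1/4, so any two of them that differ by a Gaussian
    integer are equal.\<close>
  define v0 where "v0 = 1 / (16 * (C + 1))"
  have v0: "0 < v0" "v0 \<le> 1" "C * (2 * v0) < 1 / 4" using C by (auto simp: v0_def field_simps)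
  \<comment> \<open>\<open>\<beta> ^ d\<close> absorbs the growth of the input bounds up to time
    \<open>d\<close>. The square of \<open>1 - \<beta>\<close> absorbs two geometric series, one
    inside each input and one over the future inputs.\<close>
  define \<psi> where "\<psi> = v0 / 4 * (1 - \<beta>)\<^sup>2 * \<beta> ^ d"
  have \<psi>: "\<psi> > 0" using v0 \<beta> by (simp add: \<psi>_def)
  have \<psi>1: "\<psi> / \<beta> ^ k / (1 - \<beta>) / (1 - \<beta>) \<le> v0 / 4" if "k \<le> d" for k
  proof -
    have "\<psi> / \<beta> ^ k / (1 - \<beta>) / (1 - \<beta>) = v0 / 4 * (\<beta> ^ d / \<beta> ^ k)"
    proof -
      have "v0 / 4 * q\<^sup>2 * b / a / q / q = v0 / 4 * (b / a)" if "q \<noteq> 0" for a b q :: real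
        using that by (simp add: power2_eq_square)
      then show ?thesis using \<beta> by (simp add: \<psi>_def)
    qed
    also have "\<dots> \<le> v0 / 4 * 1"
      using \<beta> v0 that by (intro mult_left_mono) (auto simp: divide_le_eq_1 intro: power_decreasing)
    finally show ?thesis by simp
  qed
  have \<psi>2: "\<psi> / \<beta> ^ k / (1 - \<beta>) \<le> v0 / 4" if "k \<le> d" for k
  proof -
    have "\<psi> / \<beta> ^ k / (1 - \<beta>) * 1 \<le> \<psi> / \<beta> ^ k / (1 - \<beta>) * (1 / (1 - \<beta>))"
      using \<beta> \<psi> by (intro mult_left_mono) (auto simp: field_simps)
    then show ?thesis using \<psi>1[OF that] unfolding times_divide_eq_right mult_1_right by linarith
  qed
  obtain V c \<Psi> Y where V [measurable]: "\<And>z. z \<in> R \<Longrightarrow> V z \<in> borel_measurable M"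
    and c [measurable]: "\<And>i. c i \<in> borel_measurable M"
    and c_int: "\<And>i x. c i x \<in> gauss_int" and c_fin: "\<And>x. \<exists>k. \<forall>i\<ge>k. c i x = 0"
    and V_T: "AE x in M. \<forall>z\<in>R. V z (T x) = z * V z x + (\<Sum>i. z ^ i * c i (T x))"
    and c_le: "AE x in M. \<forall>i. \<forall>s\<ge>1. (real i + 1) * norm (c i ((T ^^ s) x)) \<le> \<beta> ^ (2 * i) * \<Psi> x / \<beta> ^ s"
    and Y: "Y \<in> sets M" "prob Y > 0"
    and Y_le: "AE x in M. x \<in> Y \<longrightarrow> \<Psi> x \<le> \<psi> \<and> (\<forall>z\<in>R. norm (V z x - v0) \<le> v0 / 2)"
    by (rule equivariant_solution[of R \<beta> v0 \<psi>])
      (use R Z0 nru \<beta> v0 \<psi> in \<open>auto simp: subset_iff\<close>)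
  define cs where "cs = (\<lambda>x i s. c i ((T ^^ s) x))"
  \<comment> \<open>Adding the pending effect trades the polynomial jumps of \<open>V z\<close> for
    the inputs that announce them. The expanding roots respond to the same inputs.\<close>
  define u where "u = (\<lambda>z x. if z \<in> R then V z x + pending_seq z (cs x) 0 else future_seq z (cs x) 0)"
  define f where "f = (\<lambda>x. \<Sum>z\<in>Z. \<alpha> z * u z x)"
  have f_meas [measurable]: "f \<in> borel_measurable M"
  proof -
    have [measurable]: "(\<lambda>x. cs x i s) \<in> borel_measurable M" for i s
      unfolding cs_def by measurable
    have [measurable]: "(\<lambda>x. input_seq (cs x) n) \<in> borel_measurable M" for n
      unfolding input_seq_def by (intro borel_measurable_suminf) measurable
    have "(\<lambda>x. pending_seq z (cs x) 0) \<in> borel_measurable M" for z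
      unfolding pending_seq_def by (intro borel_measurable_suminf) measurable
    moreover have "(\<lambda>x. future_seq z (cs x) 0) \<in> borel_measurable M" for z
      unfolding future_seq_def by (intro borel_measurable_uminus borel_measurable_suminf) measurable
    ultimately have "u z \<in> borel_measurable M" for z
      by (cases "z \<in> R") (auto simp: u_def[abs_def] intro!: borel_measurable_add V)
    then show ?thesis unfolding f_def
      by (intro borel_measurable_sum borel_measurable_times) auto
  qed
  have shift: "pending_seq z (cs ((T ^^ k) x)) 0 = pending_seq z (cs x) k"
    "future_seq z (cs ((T ^^ k) x)) 0 = future_seq z (cs x) k" for z k x
  proof -
    have "cs ((T ^^ k) x) i s = cs x i (k + s)" for i s
      by (simp add: cs_def funpow_add add.commute[of k])
    then show "pending_seq z (cs ((T ^^ k) x)) 0 = pending_seq z (cs x) k"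
      "future_seq z (cs ((T ^^ k) x)) 0 = future_seq z (cs x) k"
      by (simp_all add: pending_seq_def future_seq_def input_seq_def add.assoc)
  qed
  define good where "good = (\<lambda>x. decaying_inputs (cs x) \<beta> (\<Psi> x) \<and>
    (\<forall>k. \<forall>z\<in>R. V z (T ((T ^^ k) x)) = z * V z ((T ^^ k) x) + (\<Sum>i. z ^ i * c i (T ((T ^^ k) x)))))"
  have AE_good: "AE x in M. good x"
    using c_le AE_all_funpow_T[OF V_T]
  proof eventually_elim
    case (elim x)
    have "decaying_inputs (cs x) \<beta> (\<Psi> x)"
      by unfold_locales (use elim(1) \<beta> in \<open>auto simp: cs_def\<close>)
    then show ?case using elim(2) unfolding good_def by blast
  qed
  have u_Suc: "u z ((T ^^ Suc k) x) = z * u z ((T ^^ k) x) + input_seq (cs x) (Suc k)"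
    if g: "good x" and z: "z \<in> Z" for x z k
  proof -
    interpret decaying_inputs "cs x" \<beta> "\<Psi> x" using g by (simp add: good_def)
    show ?thesis
    proof (cases "z \<in> R")
      case True
      obtain m where m: "\<And>i. i \<ge> m \<Longrightarrow> cs x i (Suc k) = 0"
        using c_fin[of "(T ^^ Suc k) x"] by (auto simp: cs_def)
      have "V z ((T ^^ Suc k) x) = z * V z ((T ^^ k) x) + (\<Sum>i. z ^ i * cs x i (Suc k))"
        using g True by (simp add: good_def cs_def)
      then show ?thesis
        using pending_seq_Suc[OF R(2)[OF True] m] True
        by (simp only: u_def shift if_True) (simp add: algebra_simps)
    next
      case False
      then show ?thesis using future_seq_Suc[OF \<beta>2, of z k] z
        by (simp only: u_def shift if_False) auto
    qed
  qed
  have f_eq: "(\<Sum>k\<le>degree p. of_int (coeff p k) * f ((T ^^ k) x)) = input_seq (cs x) 1"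
    if g: "good x" for x
    unfolding f_def Z_def
  proof (rule partial_fraction_solution[OF p(2), of \<alpha> "\<lambda>z k. u z ((T ^^ k) x)"])
    show "of_int (lead_coeff p) * (\<Sum>z | poly (cpoly p) z = 0. \<alpha> z * z ^ i) = (if Suc i = degree p then 1 else 0)"
      if "i < degree p" for i using \<alpha>_sum[OF that] by (simp add: Z_def)
    show "u z ((T ^^ Suc k) x) = z * u z ((T ^^ k) x) + input_seq (cs x) (Suc k)"
      if "z \<in> {z. poly (cpoly p) z = 0}" for z k
      using u_Suc[OF g, of z k] that by (simp add: Z_def)
  qed
  have f_int: "(\<Sum>k\<le>degree p. of_int (coeff p k) * f ((T ^^ k) x)) \<in> gauss_int" if g: "good x" for x
  proof -
    interpret decaying_inputs "cs x" \<beta> "\<Psi> x" using g by (simp add: good_def)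
    have "input_seq (cs x) 1 \<in> gauss_int"
      unfolding input_seq_def
      by (rule gauss_int_suminf[OF summable_norm_cancel[OF summable_input]]) (auto simp: cs_def c_int)
    then show ?thesis by (simp only: f_eq[OF g])
  qed
  have Re_int: "AE x in M. (\<Sum>k\<le>degree p. of_int (coeff p k) * Re (f ((T ^^ k) x))) \<in> \<int>"
    using AE_good by eventually_elim (use f_int in \<open>auto simp: gauss_int_def\<close>)
  have Im_int: "AE x in M. (\<Sum>k\<le>degree p. of_int (coeff p k) * Im (f ((T ^^ k) x))) \<in> \<int>"
    using AE_good by eventually_elim (use f_int in \<open>auto simp: gauss_int_def\<close>)
  have "\<not> ((\<exists>c. AE x in M. Re (f x) - c \<in> \<int>) \<and> (\<exists>c. AE x in M. Im (f x) - c \<in> \<int>))"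
  proof
    assume "(\<exists>c. AE x in M. Re (f x) - c \<in> \<int>) \<and> (\<exists>c. AE x in M. Im (f x) - c \<in> \<int>)"
    then obtain a b where a: "AE x in M. Re (f x) - a \<in> \<int>" and b: "AE x in M. Im (f x) - b \<in> \<int>"
      by blast
    have "AE x in M. good x \<and> (x \<in> Y \<longrightarrow> \<Psi> x \<le> \<psi> \<and> (\<forall>z\<in>R. norm (V z x - v0) \<le> v0 / 2)) \<and>
        (\<forall>k. Re (f ((T ^^ k) x)) - a \<in> \<int>) \<and> (\<forall>k. Im (f ((T ^^ k) x)) - b \<in> \<int>)"
      using AE_all_funpow_T[OF a] AE_all_funpow_T[OF b] AE_good Y_le by eventually_elim blast
    from AE_imp_ex_in[OF Y this] obtain y where "y \<in> Y" and g: "good y" and y: "\<Psi> y \<le> \<psi>"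
      "\<And>z. z \<in> R \<Longrightarrow> norm (V z y - v0) \<le> v0 / 2"
      and ab: "\<And>k. Re (f ((T ^^ k) y)) - a \<in> \<int>" "\<And>k. Im (f ((T ^^ k) y)) - b \<in> \<int>" by blast
    interpret decaying_inputs "cs y" \<beta> "\<Psi> y" using g by (simp add: good_def)
    have input0: "input_seq (cs y) k = 0" if k: "1 \<le> k" "k \<le> d" for k
    proof (rule gauss_int_small)
      show "input_seq (cs y) k \<in> gauss_int"
        unfolding input_seq_def
        by (rule gauss_int_suminf[OF summable_norm_cancel[OF summable_input[OF k(1)]]]) (auto simp: cs_def c_int)
      have "norm (input_seq (cs y) k) \<le> \<Psi> y / \<beta> ^ k / (1 - \<beta>)" by (rule norm_input_seq[OF k(1)])
      also have "\<dots> \<le> \<psi> / \<beta> ^ k / (1 - \<beta>)" using y \<beta> by (intro divide_right_mono) auto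
      also have "\<dots> \<le> v0 / 4" by (rule \<psi>2[OF k(2)])
      finally show "norm (input_seq (cs y) k) < 1" using v0 by simp
    qed
    have u_pow: "u z ((T ^^ k) y) = z ^ k * u z y" if "k \<le> d" "z \<in> Z" for z k
      using that(1)
    proof (induction k)
      case (Suc k)
      then show ?case using u_Suc[OF g that(2), of k] input0[of "Suc k"] by (simp del: funpow.simps)
    qed simp
    have pend: "norm (pending_seq z (cs y) 0) \<le> v0 / 4" if "z \<in> R" for z
    proof -
      have "norm (pending_seq z (cs y) 0) \<le> \<Psi> y / (1 - \<beta>)" by (rule norm_pending_seq[OF R(2)[OF that]])
      also have "\<dots> \<le> \<psi> / \<beta> ^ 0 / (1 - \<beta>)" using y \<beta> by (simp add: divide_right_mono)
      also have "\<dots> \<le> v0 / 4" by (rule \<psi>2) simp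
      finally show ?thesis .
    qed
    have u_le: "norm (u z y) \<le> 2 * v0" if z: "z \<in> Z" for z
    proof (cases "z \<in> R")
      case True
      have "u z y = (V z y - v0) + pending_seq z (cs y) 0 + v0" using True by (simp add: u_def)
      also have "norm \<dots> \<le> v0 / 2 + v0 / 4 + norm (complex_of_real v0)"
        by (intro norm_triangle_mono y(2) pend True) simp
      finally show ?thesis using v0 by simp
    next
      case False
      have "norm (u z y) \<le> \<Psi> y / (1 - \<beta>) / (1 - \<beta>)"
        using norm_future_seq[OF \<beta>2] False z by (simp add: u_def)
      also have "\<dots> \<le> \<psi> / \<beta> ^ 0 / (1 - \<beta>) / (1 - \<beta>)" using y \<beta> by (simp add: divide_right_mono)
      also have "\<dots> \<le> v0 / 4" by (rule \<psi>1) simp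
      finally show ?thesis using v0 by simp
    qed
    have f_small: "norm (f ((T ^^ k) y)) < 1 / 4" if k: "k \<le> d" for k
    proof -
      have "norm (f ((T ^^ k) y)) \<le> (\<Sum>z\<in>Z. norm (\<alpha> z) * (1 + norm z) ^ d * (2 * v0))"
        unfolding f_def
      proof (intro sum_norm_le)
        fix z assume z: "z \<in> Z"
        have "norm z ^ k \<le> (1 + norm z) ^ k" by (intro power_mono) auto
        also have "\<dots> \<le> (1 + norm z) ^ d" using k by (intro power_increasing) auto
        finally show "norm (\<alpha> z * u z ((T ^^ k) y)) \<le> norm (\<alpha> z) * (1 + norm z) ^ d * (2 * v0)"
          unfolding u_pow[OF k z] norm_mult norm_power mult.assoc
          using u_le[OF z] by (intro mult_left_mono mult_mono) auto
      qed
      also have "\<dots> = C * (2 * v0)" by (simp add: C_def sum_distrib_right)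
      finally show ?thesis using v0 by simp
    qed
    have f_const: "f ((T ^^ k) y) = f y" if k: "k \<le> d" for k
    proof -
      have "(Re (f ((T ^^ k) y)) - a) - (Re (f ((T ^^ 0) y)) - a) \<in> \<int>"
        "(Im (f ((T ^^ k) y)) - b) - (Im (f ((T ^^ 0) y)) - b) \<in> \<int>"
        by (intro Ints_diff ab)+
      then have "f ((T ^^ k) y) - f y \<in> gauss_int" by (simp add: gauss_int_def)
      moreover have "norm (f ((T ^^ k) y) - f y) < 1"
        using f_small[OF k] f_small[of 0] norm_triangle_ineq4[of "f ((T ^^ k) y)" "f y"] by simp
      ultimately show ?thesis using gauss_int_small by fastforce
    qed
    have d0: "d \<ge> 1" using p(2) by (simp add: d_def)
    have "(\<Sum>k\<le>degree p. of_int (coeff p k) * f y) = (\<Sum>k\<le>degree p. of_int (coeff p k) * f ((T ^^ k) y))"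
      by (intro sum.cong) (auto simp: f_const d_def)
    also have "\<dots> = 0" using f_eq[OF g] input0[of 1] d0 by simp
    finally have "poly (cpoly p) 1 * f y = 0"
      by (simp add: poly_cpoly_altdef sum_distrib_right)
    moreover have "poly (cpoly p) 1 \<noteq> 0" using nru[of 1 1] by (auto simp: Z_def)
    ultimately have fy: "f y = 0" by simp
    obtain z where z: "z \<in> R" using root by (auto simp: R_def Z_def)
    have "\<alpha> z * u z y = 0"
    proof (rule power_sums_zero_imp_zero[OF Z(1), where w = "\<lambda>a. \<alpha> a * u a y"])
      show "z \<in> Z" using z R by auto
      fix k assume "k < card Z"
      then have k: "k \<le> d" using Z by simp
      have "(\<Sum>a\<in>Z. \<alpha> a * u a y * a ^ k) = f ((T ^^ k) y)"
        unfolding f_def using u_pow[OF k] by (intro sum.cong) auto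
      then show "(\<Sum>a\<in>Z. \<alpha> a * u a y * a ^ k) = 0" using f_const[OF k] fy by simp
    qed
    then have "u z y = 0" using \<alpha> z R by auto
    then have "(V z y - v0) + pending_seq z (cs y) 0 = - complex_of_real v0"
      using z by (simp add: u_def)
    then have "norm (complex_of_real v0) = norm ((V z y - v0) + pending_seq z (cs y) 0)"
      by (simp only: norm_minus_cancel)
    also have "\<dots> \<le> v0 / 2 + v0 / 4" by (intro norm_triangle_mono y(2) pend z)
    finally show False using v0 by simp
  qed
  then consider "\<not> (\<exists>c. AE x in M. Re (f x) - c \<in> \<int>)" | "\<not> (\<exists>c. AE x in M. Im (f x) - c \<in> \<int>)"
    by blast
  then show ?thesis
  proof cases
    case 1
    moreover have "(\<lambda>x. Re (f x)) \<in> borel_measurable M" by measurable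
    ultimately show ?thesis using Re_int by (intro bexI[of _ "\<lambda>x. Re (f x)"] conjI)
  next
    case 2
    moreover have "(\<lambda>x. Im (f x)) \<in> borel_measurable M" by measurable
    ultimately show ?thesis using Im_int by (intro bexI[of _ "\<lambda>x. Im (f x)"] conjI)
  qed
qed

end

section \<open>Circle-valued solutions\<close>

lemma abs_circle_eq_iff: "abs_circle x = abs_circle y \<longleftrightarrow> x - y \<in> \<int>"
  by (rule circle.abs_eq_iff)

lemma abs_circle_eq_0_iff: "abs_circle x = 0 \<longleftrightarrow> x \<in> \<int>"
  by (simp add: zero_circle_def abs_circle_eq_iff)

lemma abs_circle_sum: "abs_circle (sum h A) = (\<Sum>a\<in>A. abs_circle (h a))"
  by (induction A rule: infinite_finite_induct) (simp_all add: zero_circle_def plus_circle.abs_eq[symmetric])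

lemma measurable_abs_circle [measurable]: "abs_circle \<in> borel_measurable borel"
  by (rule borel_measurableI) (auto simp: open_circle_def)

text \<open>\<open>rep_circle\<close> is an arbitrary choice of representative; \<open>frac\<close>
  normalises it to [0, 1). The result is a Borel section of the projection, through which
  circle-valued functions can be tested by real thresholds.\<close>

definition circle_frac :: "circle \<Rightarrow> real"
  where "circle_frac c = frac (rep_circle c)"

lemma circle_frac_abs: "circle_frac (abs_circle x) = frac x"
proof -
  have "rep_circle (abs_circle x) - x \<in> \<int>"
    by (simp flip: abs_circle_eq_iff add: Quotient3_abs_rep[OF Quotient3_circle])
  then obtain n where "rep_circle (abs_circle x) = x + of_int n"
    by (metis Ints_cases add.commute diff_add_cancel)
  then show ?thesis by (simp add: circle_frac_def frac_def)
qed

lemma abs_circle_frac: "abs_circle (circle_frac c) = c"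
proof -
  have "abs_circle (circle_frac c) = abs_circle (rep_circle c)"
    unfolding abs_circle_eq_iff circle_frac_def by (simp add: frac_def)
  then show ?thesis by (simp add: Quotient3_abs_rep[OF Quotient3_circle])
qed

text \<open>For \<open>a \<ge> 0\<close> the superlevel set is the image of the open interval from
  \<open>a\<close> to 1. It is open because its full preimage is the union of the integer translates
  of that interval.\<close>

lemma measurable_circle_frac [measurable]: "circle_frac \<in> borel_measurable borel"
  unfolding borel_measurable_iff_greater
proof
  fix a :: real
  show "{c \<in> space borel. a < circle_frac c} \<in> sets borel"
  proof (cases "a < 0")
    case True
    then have "a < circle_frac c" for c
      using frac_ge_0[of "rep_circle c"] unfolding circle_frac_def by linarith
    then show ?thesis by simp
  next
    case False
    have "{c. a < circle_frac c} = abs_circle ` {a<..<1}"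
    proof (intro equalityI subsetI)
      fix c assume "c \<in> {c. a < circle_frac c}"
      moreover have "circle_frac c < 1" by (simp add: circle_frac_def frac_lt_1)
      ultimately show "c \<in> abs_circle ` {a<..<1}"
        using abs_circle_frac[of c] by (auto intro!: image_eqI[of _ _ "circle_frac c"])
    next
      fix c assume "c \<in> abs_circle ` {a<..<1}"
      then obtain x where "c = abs_circle x" "a < x" "x < 1" by auto
      then show "c \<in> {c. a < circle_frac c}"
        using False frac_eq[of x] by (simp add: circle_frac_abs)
    qed
    moreover have "open (abs_circle ` {a<..<1})"
    proof -
      have "abs_circle -` (abs_circle ` {a<..<1}) = (\<Union>n::int. {a + of_int n<..<1 + of_int n})"
      proof (intro equalityI subsetI)
        fix x assume "x \<in> abs_circle -` (abs_circle ` {a<..<1})"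
        then obtain y where y: "a < y" "y < 1" "x - y \<in> \<int>" by (auto simp: abs_circle_eq_iff)
        then obtain n where "x - y = of_int n" by (auto elim: Ints_cases)
        then have "x \<in> {a + of_int n<..<1 + of_int n}" using y by auto
        then show "x \<in> (\<Union>n::int. {a + of_int n<..<1 + of_int n})" by blast
      next
        fix x assume "x \<in> (\<Union>n::int. {a + of_int n<..<1 + of_int n})"
        then obtain n :: int where "a + of_int n < x" "x < 1 + of_int n" by auto
        then show "x \<in> abs_circle -` (abs_circle ` {a<..<1})"
          by (auto simp: abs_circle_eq_iff intro!: image_eqI[of _ _ "x - of_int n"])
      qed
      then show ?thesis
        by (simp only: open_circle_def) (intro open_UN ballI open_greaterThanLessThan)
    qed
    ultimately show ?thesis by simp
  qed
qed

lemma int_scale_add_left: "int_scale (a + b) x = int_scale a x + int_scale b x"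
  by transfer (simp add: algebra_simps)

lemma int_scale_add_right: "int_scale a (x + y) = int_scale a x + int_scale a y"
  by transfer (simp add: algebra_simps)

lemma int_scale_mult: "int_scale (a * b) x = int_scale a (int_scale b x)"
  by transfer (simp add: algebra_simps)

lemma int_scale_simps [simp]:
  "int_scale 0 x = 0" "int_scale 1 x = x" "int_scale (- 1) x = - x" "int_scale a 0 = 0"
  by (transfer; simp)+

lemma int_scale_sum: "int_scale a (sum h A) = (\<Sum>k\<in>A. int_scale a (h k))"
  by (induction A rule: infinite_finite_induct) (simp_all add: int_scale_add_right)

lemma poly_action_altdef:
  assumes "degree p \<le> N"
  shows "poly_action p T f x = (\<Sum>k\<le>N. int_scale (coeff p k) (f ((T ^^ k) x)))"
  unfolding poly_action_def
  by (rule sum.mono_neutral_left) (use assms in \<open>auto simp: coeff_eq_0\<close>)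

lemma poly_action_add: "poly_action (p + q) T f x = poly_action p T f x + poly_action q T f x"
proof -
  let ?N = "max (degree p) (degree q)"
  have "degree (p + q) \<le> ?N" by (rule degree_add_le_max)
  then show ?thesis
    by (simp add: poly_action_altdef[of _ ?N] int_scale_add_left sum.distrib)
qed

lemma poly_action_smult: "poly_action (smult a p) T f x = int_scale a (poly_action p T f x)"
  using degree_smult_le[of a p]
  by (simp add: poly_action_altdef[of _ "degree p"] int_scale_mult int_scale_sum)

lemma poly_action_0 [simp]: "poly_action 0 T f x = 0"
  by (simp add: poly_action_def)

lemma poly_action_pCons:
  "poly_action (pCons a p) T f x = int_scale a (f x) + poly_action p T f (T x)"
proof -
  have "poly_action (pCons a p) T f x =
      (\<Sum>k\<le>Suc (degree p). int_scale (coeff (pCons a p) k) (f ((T ^^ k) x)))"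
    by (intro poly_action_altdef degree_pCons_le)
  also have "\<dots> = int_scale a (f x) + (\<Sum>k\<le>degree p. int_scale (coeff p k) (f ((T ^^ Suc k) x)))"
    by (subst sum.atMost_Suc_shift) simp
  finally show ?thesis by (simp only: poly_action_def funpow_Suc_right comp_def)
qed

lemma poly_action_mult: "poly_action (q * p) T f x = poly_action q T (poly_action p T f) x"
proof (induction q arbitrary: x)
  case (pCons a q)
  then show ?case by (simp add: poly_action_add poly_action_smult poly_action_pCons)
qed simp

lemma poly_action_monom: "poly_action (monom a n) T f x = int_scale a (f ((T ^^ n) x))"
  by (induction n arbitrary: x)
    (simp_all add: monom_0 monom_Suc poly_action_pCons funpow_swap1)

lemma poly_action_abs_circle:
  "poly_action p T (\<lambda>x. abs_circle (h x)) x =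
    abs_circle (\<Sum>k\<le>degree p. of_int (coeff p k) * h ((T ^^ k) x))"
  by (simp add: poly_action_def abs_circle_sum int_scale.abs_eq)

section \<open>Reciprocal polynomials and time reversal\<close>

lemma cpoly_reflect_poly: "cpoly (reflect_poly p) = reflect_poly (cpoly p)"
  by (intro poly_eqI) (simp add: coeff_map_poly coeff_reflect_poly)

text \<open>Reflection is multiplicative, and an involution on polynomials with nonzero constant
  coefficient. Factors of \<open>reflect_poly p\<close> are of this kind, since their constant
  coefficients multiply to the leading coefficient of \<open>p\<close>.\<close>

lemma irreducible_reflect_poly:
  fixes p :: "'a :: {comm_ring_1, semiring_no_zero_divisors} poly"
  assumes p: "irreducible p" and p0: "coeff p 0 \<noteq> 0"
  shows "irreducible (reflect_poly p)"
proof (rule irreducibleI)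
  have unit: "a dvd 1" if "reflect_poly a dvd 1" "coeff a 0 \<noteq> 0" for a :: "'a poly"
  proof -
    from that(1) obtain c where "1 = reflect_poly a * c" by (elim dvdE)
    then have "reflect_poly 1 = reflect_poly (reflect_poly a) * reflect_poly c"
      by (metis reflect_poly_mult)
    then show ?thesis using that(2) by (metis dvd_triv_left reflect_poly_1 reflect_poly_reflect_poly)
  qed
  show "reflect_poly p \<noteq> 0" using p0 by auto
  show "\<not> reflect_poly p dvd 1"
  proof
    assume "reflect_poly p dvd 1"
    then have "p dvd 1" using unit[of p] p0 by blast
    then show False using p irreducible_not_unit by blast
  qed
  fix a b assume ab: "reflect_poly p = a * b"
  then have "coeff a 0 * coeff b 0 = lead_coeff p" by (metis coeff_0_reflect_poly coeff_mult_0)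
  moreover have "lead_coeff p \<noteq> 0" using p0 by auto
  ultimately have ab0: "coeff a 0 \<noteq> 0" "coeff b 0 \<noteq> 0" by auto
  have "p = reflect_poly a * reflect_poly b"
    using ab p0 by (metis reflect_poly_mult reflect_poly_reflect_poly)
  then have "reflect_poly a dvd 1 \<or> reflect_poly b dvd 1" using p by (rule irreducibleD[rotated])
  then show "a dvd 1 \<or> b dvd 1" using unit ab0 by blast
qed

context nonatomic_ergodic_mpt
begin

lemma reversed_nonatomic: "nonatomic_ergodic_mpt M S T"
  using reversed nonatomic by (simp add: nonatomic_ergodic_mpt_def nonatomic_ergodic_mpt_axioms_def)

lemma AE_funpow_S_funpow_T: "AE x in M. \<forall>k j. (S ^^ k) ((T ^^ (k + j)) x) = (T ^^ j) x"
  using AE_all_funpow_T[OF ST]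
proof eventually_elim
  case (elim x)
  have "(S ^^ k) ((T ^^ (k + j)) x) = (T ^^ j) x" for k j
  proof (induction k)
    case (Suc k)
    have "(S ^^ Suc k) ((T ^^ (Suc k + j)) x) = (S ^^ k) (S (T ((T ^^ (k + j)) x)))"
      by (simp add: funpow_swap1)
    then show ?case using elim Suc by simp
  qed simp
  then show ?case by blast
qed

lemma nonconstant_circle_solution:
  fixes p :: "int poly"
  assumes p: "irreducible p" "degree p > 0" "coeff p 0 \<noteq> 0"
    and ncyc: "\<And>n. n > 0 \<Longrightarrow> \<not> p dvd monom 1 n - 1"
  shows "\<exists>f\<in>measurable M (borel :: circle measure).
    \<not> (\<exists>c. AE x in M. f x = c) \<and> (AE x in M. poly_action p T f x = 0)"
proof -
  have "\<exists>h\<in>borel_measurable M. \<not> (\<exists>c. AE x in M. h x - c \<in> \<int>) \<and>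
    (AE x in M. (\<Sum>k\<le>degree p. of_int (coeff p k) * h ((T ^^ k) x)) \<in> (\<int> :: real set))"
  proof (cases "\<exists>z. poly (cpoly p) z = 0 \<and> norm z \<le> 1")
    case True
    then show ?thesis using nonconstant_real_solution[OF p ncyc] by blast
  next
    case False
    let ?d = "degree p" and ?q = "reflect_poly p"
    have "{z. poly (cpoly p) z = 0} \<noteq> {}" using card_roots_cpoly[OF p(1,2)] p(2) by (metis card.empty less_irrefl)
    then obtain z where z: "poly (cpoly p) z = 0" by blast
    have z1: "norm z > 1" using False z by auto
    have qz: "poly (cpoly ?q) (inverse z) = 0"
      using z1 z by (subst cpoly_reflect_poly, subst poly_reflect_poly_nz) auto
    have "\<exists>h\<in>borel_measurable M. \<not> (\<exists>c. AE x in M. h x - c \<in> \<int>) \<and>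
      (AE x in M. (\<Sum>k\<le>degree ?q. of_int (coeff ?q k) * h ((S ^^ k) x)) \<in> (\<int> :: real set))"
    proof (rule nonatomic_ergodic_mpt.nonconstant_real_solution[OF reversed_nonatomic])
      show "irreducible ?q" by (rule irreducible_reflect_poly[OF p(1,3)])
      show "degree ?q > 0" using p by simp
      show "coeff ?q 0 \<noteq> 0" using p by auto
      show "\<not> ?q dvd monom 1 n - 1" if "n > 0" for n
      proof
        assume "?q dvd monom 1 n - 1"
        then obtain r where r: "monom 1 n - 1 = ?q * r" by (elim dvdE)
        have "poly (cpoly (monom 1 n - 1)) (inverse z) = 0"
          unfolding r cpoly_mult using qz by simp
        then have "inverse z ^ n = 1" by (simp add: cpoly_diff map_poly_monom poly_monom)
        then have "z ^ n = 1" by (simp add: power_inverse)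
        then show False using root_of_unity_imp_dvd[OF p(1) z] ncyc[OF that] by blast
      qed
      show "\<exists>z. poly (cpoly ?q) z = 0 \<and> norm z \<le> 1"
        using qz z1 by (intro exI[of _ "inverse z"] conjI) (simp_all add: norm_inverse inverse_le_1_iff)
    qed
    then obtain h :: "'a \<Rightarrow> real" where h: "h \<in> borel_measurable M" "\<not> (\<exists>c. AE x in M. h x - c \<in> \<int>)"
      "AE x in M. (\<Sum>k\<le>?d. of_int (coeff ?q k) * h ((S ^^ k) x)) \<in> \<int>"
      using p by auto
    \<comment> \<open>The reflected polynomial in \<open>S\<close>, evaluated at
      \<open>(T ^^ ?d) x\<close>, is \<open>p\<close> in \<open>T\<close> evaluated at
      \<open>x\<close>, since \<open>S ^^ k\<close> undoes \<open>k\<close> of the \<open>?d\<close>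
      steps.\<close>
    have "AE x in M. (\<Sum>k\<le>?d. of_int (coeff p k) * h ((T ^^ k) x)) \<in> \<int>"
      using AE_funpow_T[OF h(3), of ?d] AE_funpow_S_funpow_T
    proof eventually_elim
      case (elim x)
      have "(\<Sum>k\<le>?d. of_int (coeff ?q k) * h ((S ^^ k) ((T ^^ ?d) x))) =
          (\<Sum>k\<le>?d. of_int (coeff p (?d - k)) * h ((T ^^ (?d - k)) x))"
      proof (intro sum.cong refl)
        fix k assume "k \<in> {..?d}"
        then have "k + (?d - k) = ?d" by simp
        then show "of_int (coeff ?q k) * h ((S ^^ k) ((T ^^ ?d) x)) =
            of_int (coeff p (?d - k)) * h ((T ^^ (?d - k)) x)"
          using elim(2)[rule_format, of k "?d - k"] \<open>k \<in> {..?d}\<close> by (simp add: coeff_reflect_poly)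
      qed
      also have "\<dots> = (\<Sum>k\<le>?d. of_int (coeff p k) * h ((T ^^ k) x))"
        by (rule sum.reindex_bij_witness[of _ "\<lambda>k. ?d - k" "\<lambda>k. ?d - k"]) auto
      finally show ?case using elim(1) by simp
    qed
    then show ?thesis using h by blast
  qed
  then obtain h :: "'a \<Rightarrow> real" where h: "h \<in> borel_measurable M" "\<not> (\<exists>c. AE x in M. h x - c \<in> \<int>)"
    "AE x in M. (\<Sum>k\<le>degree p. of_int (coeff p k) * h ((T ^^ k) x)) \<in> \<int>" by blast
  show ?thesis
  proof (intro bexI conjI)
    show "(\<lambda>x. abs_circle (h x)) \<in> measurable M borel"
      using measurable_compose[OF h(1) measurable_abs_circle] .
    show "\<not> (\<exists>c. AE x in M. abs_circle (h x) = c)"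
    proof
      assume "\<exists>c. AE x in M. abs_circle (h x) = c"
      then obtain c where "AE x in M. abs_circle (h x) = c" by blast
      then have "AE x in M. h x - circle_frac c \<in> \<int>"
        by eventually_elim (metis abs_circle_eq_iff abs_circle_frac)
      then show False using h(2) by blast
    qed
    show "AE x in M. poly_action p T (\<lambda>x. abs_circle (h x)) x = 0"
      using h(3) by (simp add: poly_action_abs_circle abs_circle_eq_0_iff)
  qed
qed

end

section \<open>Cyclotomic polynomials\<close>

context ergodic_mpt
begin

lemma AE_invariant_funpow:
  assumes "AE x in M. f ((T ^^ n) x) = f x"
  shows "AE x in M. \<forall>k. f ((T ^^ (n * k)) x) = f x"
  using AE_all_funpow_T[OF assms]
proof eventually_elim
  case (elim x)
  have "f ((T ^^ (n * k)) x) = f x" for k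
  proof (induction k)
    case (Suc k)
    have "f ((T ^^ (n * Suc k)) x) = f ((T ^^ n) ((T ^^ (n * k)) x))"
      by (simp add: funpow_add)
    then show ?case using elim Suc by simp
  qed simp
  then show ?case by blast
qed

definition power_invariant :: "nat \<Rightarrow> 'a set \<Rightarrow> bool"
  where "power_invariant n A \<longleftrightarrow> A \<in> sets M \<and> (AE x in M. (T ^^ n) x \<in> A \<longleftrightarrow> x \<in> A)"

text \<open>The union of the first \<open>n\<close> preimages of \<open>A\<close> is subinvariant
  under \<open>T\<close> itself, hence of full measure.\<close>

lemma power_invariant_lower_bound:
  assumes A: "power_invariant n A" "prob A > 0" and n: "n > 0"
  shows "prob A \<ge> 1 / n"
proof -
  have [measurable]: "A \<in> sets M" using A by (simp add: power_invariant_def)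
  let ?U = "{x \<in> space M. \<exists>i<n. (T ^^ i) x \<in> A}"
  have "prob ?U = 0 \<or> prob ?U = 1"
  proof (rule zero_one_of_AE_subinvariant)
    have "AE x in M. (T ^^ n) x \<in> A \<longleftrightarrow> x \<in> A" using A by (simp add: power_invariant_def)
    then show "AE x in M. x \<in> ?U \<longrightarrow> T x \<in> ?U"
      using AE_space
    proof eventually_elim
      case (elim x)
      show ?case
      proof
        assume "x \<in> ?U"
        then obtain i where i: "i < n" "(T ^^ i) x \<in> A" by auto
        obtain j where j: "j < n" "(T ^^ Suc j) x \<in> A"
        proof (cases i)
          case 0
          then show ?thesis using that[of "n - 1"] i elim n by simp
        next
          case (Suc j)
          then show ?thesis using that[of j] i by simp
        qed
        then have "(T ^^ j) (T x) \<in> A" by (simp add: funpow_swap1)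
        then show "T x \<in> ?U" using j(1) measurable_space[OF T elim(2)] by blast
      qed
    qed
  qed measurable
  moreover have "A \<subseteq> ?U"
    using sets.sets_into_space[OF \<open>A \<in> sets M\<close>] n by (auto intro!: exI[of _ 0])
  then have "prob A \<le> prob ?U" by (intro finite_measure_mono) auto
  ultimately have "prob ?U = 1" using A by linarith
  moreover have "prob ?U \<le> real n * prob A" by (rule prob_Un_funpow_le) auto
  ultimately show ?thesis using n by (simp add: field_simps)
qed

lemma power_invariant_Int: "power_invariant n A \<Longrightarrow> power_invariant n C \<Longrightarrow> power_invariant n (A \<inter> C)"
  unfolding power_invariant_def by auto

lemma power_invariant_Diff: "power_invariant n A \<Longrightarrow> power_invariant n C \<Longrightarrow> power_invariant n (A - C)"
  unfolding power_invariant_def by auto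

text \<open>A set of measure within \<open>1 / n\<close> of the infimum cannot be split: one piece
  would have at least the infimum and the other, by the lower bound, at least
  \<open>1 / n\<close>.\<close>

lemma power_invariant_atom:
  assumes n: "n > 0"
  obtains A where "power_invariant n A" "prob A > 0"
    "\<And>C. power_invariant n C \<Longrightarrow> (AE x in M. x \<in> A \<longrightarrow> x \<in> C) \<or> (AE x in M. x \<in> A \<longrightarrow> x \<notin> C)"
proof -
  define P where "P = {prob A | A. power_invariant n A \<and> prob A > 0}"
  have "AE x in M. (T ^^ n) x \<in> space M \<longleftrightarrow> x \<in> space M"
    using AE_space by eventually_elim (use measurable_space[OF funpow_T[of n]] in auto)
  then have "power_invariant n (space M)" by (simp add: power_invariant_def)
  then have ne: "P \<noteq> {}" by (auto simp: P_def prob_space intro!: exI[of _ "space M"])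
  have bdd: "bdd_below P" by (auto simp: P_def intro!: bdd_belowI[of _ 0])
  have "Inf P < Inf P + 1 / n" using n by simp
  then obtain a where "a \<in> P" "a < Inf P + 1 / n"
    using cInf_less_iff[OF ne bdd] by blast
  then obtain A where A: "power_invariant n A" "prob A > 0" "prob A < Inf P + 1 / n"
    by (auto simp: P_def)
  have As [measurable]: "A \<in> sets M" using A by (simp add: power_invariant_def)
  show ?thesis
  proof (rule that[OF A(1,2)])
    fix C assume C: "power_invariant n C"
    then have [measurable]: "C \<in> sets M" by (simp add: power_invariant_def)
    have "prob (A \<inter> C) = 0 \<or> prob (A - C) = 0"
    proof (rule ccontr)
      assume "\<not> ?thesis"
      then have pos: "prob (A \<inter> C) > 0" "prob (A - C) > 0" by (simp_all add: zero_less_measure_iff)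
      have "prob (A \<inter> C) \<in> P" using pos(1) power_invariant_Int[OF A(1) C] by (auto simp: P_def)
      then have "Inf P \<le> prob (A \<inter> C)" by (rule cInf_lower[OF _ bdd])
      moreover have "prob (A - C) \<ge> 1 / n"
        by (rule power_invariant_lower_bound[OF power_invariant_Diff[OF A(1) C] pos(2) n])
      moreover have "prob A = prob (A \<inter> C) + prob (A - C)"
        using finite_measure_Union[of "A \<inter> C" "A - C"] by (simp add: Int_Diff_Un Int_Diff_disjoint)
      ultimately show False using A(3) by linarith
    qed
    then show "(AE x in M. x \<in> A \<longrightarrow> x \<in> C) \<or> (AE x in M. x \<in> A \<longrightarrow> x \<notin> C)"
    proof
      assume "prob (A \<inter> C) = 0"
      then have "AE x in M. x \<notin> A \<inter> C" by (simp add: prob_eq_0)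
      then have "AE x in M. x \<in> A \<longrightarrow> x \<notin> C" by eventually_elim auto
      then show ?thesis ..
    next
      assume "prob (A - C) = 0"
      then have "AE x in M. x \<notin> A - C" by (simp add: prob_eq_0)
      then have "AE x in M. x \<in> A \<longrightarrow> x \<in> C" by eventually_elim auto
      then show ?thesis ..
    qed
  qed
qed

text \<open>The function is constant on an atom \<open>A\<close> of the sets invariant under \<open>T ^ n\<close>, and the first
  return time \<open>d\<close> to \<open>A\<close> is constant.\<close>

lemma power_invariant_function_structure:
  fixes f :: "'a \<Rightarrow> circle"
  assumes f [measurable]: "f \<in> measurable M borel" and n: "n > 0"
    and inv: "AE x in M. f ((T ^^ n) x) = f x"
  obtains d \<phi> A where "d > 0" "A \<in> sets M" "prob A > 0" "\<And>j. \<phi> (j + d) = \<phi> j"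
    "AE x in M. x \<in> A \<longrightarrow> (\<forall>j. f ((T ^^ j) x) = \<phi> j)" "AE x in M. \<exists>j. f x = \<phi> j"
    "koopman_eigenvalue M T (cis (2 * pi / real d))"
proof -
  obtain A where A: "power_invariant n A" "prob A > 0"
    and atom: "\<And>C. power_invariant n C \<Longrightarrow>
      (AE x in M. x \<in> A \<longrightarrow> x \<in> C) \<or> (AE x in M. x \<in> A \<longrightarrow> x \<notin> C)"
    using power_invariant_atom[OF n] by blast
  have As [measurable]: "A \<in> sets M" and A_inv: "AE x in M. (T ^^ n) x \<in> A \<longleftrightarrow> x \<in> A"
    using A by (auto simp: power_invariant_def)
  have comm: "(T ^^ j) ((T ^^ n) x) = (T ^^ n) ((T ^^ j) x)" for j x
    by (metis add.commute comp_apply funpow_add)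
  have "\<exists>c. AE x in M. x \<in> A \<longrightarrow> f ((T ^^ j) x) = c" for j
  proof -
    define h where "h = (\<lambda>x. circle_frac (f ((T ^^ j) x)))"
    have [measurable]: "h \<in> borel_measurable M" unfolding h_def by measurable
    have h_inv: "AE x in M. h ((T ^^ n) x) = h x"
      using AE_funpow_T[OF inv, of j] by eventually_elim (simp add: h_def comm)
    have "(AE x in M. x \<in> A \<longrightarrow> h x \<le> t) \<or> (AE x in M. x \<in> A \<longrightarrow> t < h x)" for t
    proof -
      have "AE x in M. (T ^^ n) x \<in> {x \<in> space M. h x \<le> t} \<longleftrightarrow> x \<in> {x \<in> space M. h x \<le> t}"
        using h_inv AE_space by eventually_elim (use measurable_space[OF funpow_T[of n]] in auto)
      then have "power_invariant n {x \<in> space M. h x \<le> t}" by (simp add: power_invariant_def)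
      from atom[OF this] show ?thesis
      proof
        assume "AE x in M. x \<in> A \<longrightarrow> x \<in> {x \<in> space M. h x \<le> t}"
        then have "AE x in M. x \<in> A \<longrightarrow> h x \<le> t" by eventually_elim auto
        then show ?thesis ..
      next
        assume "AE x in M. x \<in> A \<longrightarrow> x \<notin> {x \<in> space M. h x \<le> t}"
        then have "AE x in M. x \<in> A \<longrightarrow> t < h x" using AE_space by eventually_elim auto
        then show ?thesis ..
      qed
    qed
    then obtain c where "AE x in M. x \<in> A \<longrightarrow> h x = c" using AE_const_on_of_zero_one[of A h] by blast
    then have "AE x in M. x \<in> A \<longrightarrow> f ((T ^^ j) x) = abs_circle c"
      by eventually_elim (auto simp: h_def abs_circle_frac)
    then show ?thesis by blast
  qed
  then obtain \<phi> where "\<And>j. AE x in M. x \<in> A \<longrightarrow> f ((T ^^ j) x) = \<phi> j" by metis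
  then have "AE x in M. \<forall>j. x \<in> A \<longrightarrow> f ((T ^^ j) x) = \<phi> j" by (subst AE_all_countable) blast
  then have \<phi>: "AE x in M. x \<in> A \<longrightarrow> (\<forall>j. f ((T ^^ j) x) = \<phi> j)" by eventually_elim blast
  define D where "D = (\<lambda>j. j > 0 \<and> (AE x in M. x \<in> A \<longrightarrow> (T ^^ j) x \<in> A))"
  define d where "d = (LEAST j. D j)"
  have "D n" using n A_inv unfolding D_def by auto
  then have "D d" unfolding d_def by (rule LeastI)
  then have d: "d > 0" "AE x in M. x \<in> A \<longrightarrow> (T ^^ d) x \<in> A" by (auto simp: D_def)
  have "AE x in M. x \<in> A \<longrightarrow> (T ^^ j) x \<notin> A" if j: "0 < j" "j < d" for j
  proof -
    have "AE x in M. (T ^^ n) x \<in> {x \<in> space M. (T ^^ j) x \<in> A} \<longleftrightarrow> x \<in> {x \<in> space M. (T ^^ j) x \<in> A}"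
      using AE_funpow_T[OF A_inv, of j] AE_space
      by eventually_elim (use measurable_space[OF funpow_T[of n]] comm in auto)
    then have "power_invariant n {x \<in> space M. (T ^^ j) x \<in> A}" by (simp add: power_invariant_def)
    from atom[OF this] show ?thesis
    proof
      assume "AE x in M. x \<in> A \<longrightarrow> x \<in> {x \<in> space M. (T ^^ j) x \<in> A}"
      then have "AE x in M. x \<in> A \<longrightarrow> (T ^^ j) x \<in> A" by eventually_elim auto
      then have "D j" using j by (simp add: D_def)
      then show ?thesis using j(2) not_less_Least[of j D] by (simp add: d_def)
    next
      assume "AE x in M. x \<in> A \<longrightarrow> x \<notin> {x \<in> space M. (T ^^ j) x \<in> A}"
      then show ?thesis using AE_space by eventually_elim auto
    qed
  qed
  then have "AE x in M. \<forall>j. 0 < j \<longrightarrow> j < d \<longrightarrow> x \<in> A \<longrightarrow> (T ^^ j) x \<notin> A"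
    by (subst AE_all_countable) (auto intro: AE_I2)
  then have first: "AE x in M. x \<in> A \<longrightarrow> (T ^^ d) x \<in> A \<and> (\<forall>j. 0 < j \<longrightarrow> j < d \<longrightarrow> (T ^^ j) x \<notin> A)"
    using d(2) by eventually_elim blast
  define k where "k = (\<lambda>x. LEAST k. (T ^^ k) x \<in> A)"
  have k_meas [measurable]: "k \<in> measurable M (count_space UNIV)"
    unfolding k_def by measurable
  have hits: "AE x in M. (T ^^ k x) x \<in> A"
    using AE_forward_hits[OF As A(2)] unfolding k_def by eventually_elim (rule LeastI_ex)
  \<comment> \<open>The hitting time \<open>k\<close> drops by 1 along the orbit and jumps from 0 to
    \<open>d - 1\<close> on leaving \<open>A\<close>, so modulo \<open>d\<close> it is a backward
    rotation; the minus sign yields the eigenvalue \<open>cis (2 * pi / real d)\<close>.\<close>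
  define g where "g = (\<lambda>x. cis (- (2 * pi * real (k x) / real d)))"
  have g_meas [measurable]: "g \<in> borel_measurable M"
    unfolding g_def by (rule measurable_compose[OF k_meas]) simp
  have g_eig: "AE x in M. g (T x) = cis (2 * pi / real d) * g x"
    using hits first
  proof eventually_elim
    case (elim x)
    show ?case
    proof (cases "k x")
      case 0
      then have "x \<in> A" using elim(1) by simp
      then have "(T ^^ (d - 1)) (T x) \<in> A" "\<And>j. j < d - 1 \<Longrightarrow> (T ^^ j) (T x) \<notin> A"
        using elim(2) d(1) by (cases d; force simp: funpow_swap1)+
      then have "k (T x) = d - 1" unfolding k_def by (intro Least_equality) (auto simp: not_le[symmetric])
      then have "cis (2 * pi / real d) * g x = g (T x) * cis (2 * pi)"
        using 0 d(1) by (simp only: g_def cis_mult) (simp add: field_simps of_nat_diff)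
      then show ?thesis by simp
    next
      case (Suc m)
      have "k (T x) = m"
        unfolding k_def
      proof (rule Least_equality)
        show "(T ^^ m) (T x) \<in> A" using elim(1) Suc by (simp add: funpow_swap1)
        fix y assume "(T ^^ y) (T x) \<in> A"
        then have "(T ^^ Suc y) x \<in> A" by (simp add: funpow_swap1)
        then have "k x \<le> Suc y" unfolding k_def by (rule Least_le)
        then show "m \<le> y" using Suc by simp
      qed
      then show ?thesis using Suc d(1) by (simp add: g_def cis_mult field_simps)
    qed
  qed
  have norm_g: "norm (g x) = 1" for x by (simp add: g_def)
  show ?thesis
  proof (rule that[OF d(1) As A(2)])
    show "koopman_eigenvalue M T (cis (2 * pi / real d))"
      unfolding koopman_eigenvalue_def
    proof (intro bexI conjI)
      show "\<not> (AE x in M. g x = 0)"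
      proof
        assume "AE x in M. g x = 0"
        then have "AE x in M. False" by eventually_elim (metis norm_g norm_zero zero_neq_one)
        then show False by simp
      qed
    qed (use g_eig norm_g g_meas in auto)
    show "\<phi> (j + d) = \<phi> j" for j
    proof -
      obtain x where x: "x \<in> A" "(T ^^ d) x \<in> A" "\<forall>j. f ((T ^^ j) x) = \<phi> j"
        "\<forall>j. f ((T ^^ j) ((T ^^ d) x)) = \<phi> j"
      proof -
        have "AE x in M. x \<in> A \<longrightarrow> (T ^^ d) x \<in> A \<and> (\<forall>j. f ((T ^^ j) x) = \<phi> j) \<and>
            (\<forall>j. f ((T ^^ j) ((T ^^ d) x)) = \<phi> j)"
          using d(2) \<phi> AE_funpow_T[OF \<phi>, of d] by eventually_elim blast
        from AE_imp_ex_in[OF As A(2) this] show ?thesis using that by blast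
      qed
      have "\<phi> (j + d) = f ((T ^^ (j + d)) x)" using x by simp
      also have "\<dots> = \<phi> j" using x by (simp add: funpow_add)
      finally show ?thesis .
    qed
    show "AE x in M. x \<in> A \<longrightarrow> (\<forall>j. f ((T ^^ j) x) = \<phi> j)" by (rule \<phi>)
    show "AE x in M. \<exists>j. f x = \<phi> j"
      using hits AE_all_funpow_T[OF \<phi>] AE_invariant_funpow[OF inv]
    proof eventually_elim
      case (elim x)
      \<comment> \<open>\<open>f\<close> has the same value after \<open>n * k x\<close> steps, a
        time not earlier than the visit to \<open>A\<close> at \<open>k x\<close>, from which
        \<open>\<phi>\<close> prescribes all values.\<close>
      have "n * k x = (n * k x - k x) + k x" using n by simp
      then have "f ((T ^^ (n * k x)) x) = f ((T ^^ (n * k x - k x)) ((T ^^ k x) x))"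
        by (metis comp_apply funpow_add)
      then show ?case using elim by metis
    qed
  qed
qed

text \<open>The \<open>d\<close>-th power of the eigenfunction \<open>g\<close> is invariant, hence
  a nonzero constant \<open>w ^ d\<close>. Then \<open>g x / w\<close> is a power of a primitive
  \<open>d\<close>-th root of unity, and its exponent is the factor map.\<close>

lemma koopman_eigenvalue_rotation_factor:
  assumes d: "d > 0" and eig: "koopman_eigenvalue M T (cis (2 * pi / real d))"
  obtains \<kappa> :: "'a \<Rightarrow> nat" where "\<kappa> \<in> measurable M (count_space UNIV)"
    "AE x in M. \<forall>j. \<kappa> ((T ^^ j) x) = (\<kappa> x + j) mod d"
    "\<And>j. j < d \<Longrightarrow> \<not> (AE x in M. \<kappa> x \<noteq> j)"
proof -
  let ?z = "cis (2 * pi / real d)"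
  obtain g where g [measurable]: "g \<in> borel_measurable M" and g0: "\<not> (AE x in M. g x = 0)"
    and gT: "AE x in M. g (T x) = ?z * g x"
    using eig by (auto simp: koopman_eigenvalue_def)
  have zd: "?z ^ d = 1" unfolding Complex.DeMoivre using d by simp
  have zpow: "?z ^ k = cis (2 * pi * real k / real d)" for k unfolding Complex.DeMoivre by (simp add: mult_ac)
  have zmod: "?z ^ (k mod d) = ?z ^ k" for k
  proof -
    have "?z ^ k = ?z ^ (d * (k div d) + k mod d)" by simp
    then show ?thesis by (simp only: power_add power_mult zd power_one mult_1)
  qed
  have bij: "bij_betw (\<lambda>k. ?z ^ k) {..<d} {w. w ^ d = 1}"
    using Complex.bij_betw_roots_unity[OF d] by (simp only: zpow)
  have "AE x in M. g (T x) ^ d = g x ^ d"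
    using gT by eventually_elim (simp only: power_mult_distrib zd mult_1)
  then obtain c where c: "AE x in M. g x ^ d = c"
    using AE_const_of_AE_invariant[of "\<lambda>x. g x ^ d"] by auto
  have c0: "c \<noteq> 0"
  proof
    assume "c = 0"
    from c have "AE x in M. g x = 0" by eventually_elim (use \<open>c = 0\<close> in simp)
    then show False using g0 by blast
  qed
  obtain w where w: "c = w ^ d" using exists_complex_root[of d c] d by auto
  have w0: "w \<noteq> 0" using c0 w d by auto
  define \<kappa> where "\<kappa> = (\<lambda>x. LEAST k. g x = w * ?z ^ k)"
  have \<kappa>_meas: "\<kappa> \<in> measurable M (count_space UNIV)" unfolding \<kappa>_def by measurable
  have \<kappa>: "AE x in M. \<kappa> x < d \<and> g x = w * ?z ^ \<kappa> x"
    using c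
  proof eventually_elim
    case (elim x)
    have "(g x / w) ^ d = 1" using elim w w0 by (simp add: power_divide)
    then obtain k where k: "k < d" "g x / w = ?z ^ k"
      using bij unfolding bij_betw_def by blast
    then have eq: "g x = w * ?z ^ k" using w0 by (simp add: field_simps)
    then have "g x = w * ?z ^ \<kappa> x" unfolding \<kappa>_def by (rule LeastI)
    moreover have "\<kappa> x \<le> k" unfolding \<kappa>_def by (rule Least_le) (rule eq)
    ultimately show ?case using k by simp
  qed
  have step: "AE x in M. \<kappa> (T x) = (\<kappa> x + 1) mod d"
    using \<kappa> AE_T[OF \<kappa>] gT
  proof eventually_elim
    case (elim x)
    have "w * ?z ^ \<kappa> (T x) = ?z * g x" using elim(2,3) by argo
    also have "\<dots> = w * ?z ^ (\<kappa> x + 1)"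
      by (subst conjunct2[OF elim(1)]) (simp only: power_add power_one_right mult_ac)
    finally have "?z ^ \<kappa> (T x) = ?z ^ ((\<kappa> x + 1) mod d)" using w0 unfolding zmod by simp
    moreover have "\<kappa> (T x) \<in> {..<d}" "(\<kappa> x + 1) mod d \<in> {..<d}" using elim(2) d by auto
    ultimately show ?case using bij_betw_imp_inj_on[OF bij] by (rule inj_onD[rotated])
  qed
  have all: "AE x in M. \<forall>j. \<kappa> ((T ^^ j) x) = (\<kappa> x + j) mod d"
    using AE_all_funpow_T[OF step] \<kappa>
  proof eventually_elim
    case (elim x)
    have "\<kappa> ((T ^^ j) x) = (\<kappa> x + j) mod d" for j
    proof (induction j)
      case (Suc j)
      then show ?case using elim by (simp add: mod_Suc_eq)
    qed (use elim in simp)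
    then show ?case by blast
  qed
  show ?thesis
  proof (rule that[OF \<kappa>_meas all])
    fix j assume j: "j < d"
    show "\<not> (AE x in M. \<kappa> x \<noteq> j)"
    proof
      assume "AE x in M. \<kappa> x \<noteq> j"
      from AE_all_funpow_T[OF this] all \<kappa> have "AE x in M. False"
      proof eventually_elim
        case (elim x)
        \<comment> \<open>As \<open>\<kappa> x < d\<close>, the subtraction is not truncated, and at
          this time the orbit is at the residue \<open>j\<close>.\<close>
        have "\<kappa> x + (j + d - \<kappa> x) = j + d" using elim by simp
        then have "\<kappa> ((T ^^ (j + d - \<kappa> x)) x) = j" using elim(2) j by simp
        then show False using elim(1) by blast
      qed
      then show False by simp
    qed
  qed
qed

end

text \<open>Along orbits starting in \<open>A\<close>, \<open>f\<close> follows a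
  \<open>d\<close>-periodic sequence \<open>\<phi>\<close> annihilated by \<open>p\<close>. The
  shared eigenvalue gives \<open>T'\<close> a rotation factor \<open>\<kappa>\<close> of order
  \<open>d\<close>, and \<open>\<phi>\<close> composed with it is a solution. It is not constant,
  because every residue has positive measure and, up to a null set, \<open>f\<close> takes only
  values of \<open>\<phi>\<close>.\<close>

lemma cyclotomic_solution_transfer:
  fixes M :: "'a measure" and M' :: "'b measure" and p :: "int poly"
  assumes X: "ergodic_mpt M T S" and X': "ergodic_mpt M' T' S'"
    and spec: "rational_spectrum M T = rational_spectrum M' T'"
    and n: "n > 0" and dvd: "p dvd monom 1 n - 1"
    and f: "f \<in> measurable M (borel :: circle measure)" "\<not> (\<exists>c. AE x in M. f x = c)"
      "AE x in M. poly_action p T f x = 0"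
  shows "\<exists>f\<in>measurable M' (borel :: circle measure).
    \<not> (\<exists>c. AE x in M'. f x = c) \<and> (AE x in M'. poly_action p T' f x = 0)"
proof -
  interpret ergodic_mpt M T S by (rule X)
  interpret X': ergodic_mpt M' T' S' by (rule X')
  obtain q where "monom 1 n - 1 = p * q" using dvd by (elim dvdE)
  then have q: "monom 1 n = q * p + monom 1 0" by (simp add: diff_eq_eq mult.commute)
  have orbit0: "AE x in M. \<forall>k. poly_action p T f ((T ^^ k) x) = 0"
    by (rule AE_all_funpow_T[OF f(3)])
  have inv: "AE x in M. f ((T ^^ n) x) = f x"
    using orbit0
  proof eventually_elim
    case (elim x)
    have "f ((T ^^ n) x) = poly_action (q * p + monom 1 0) T f x"
      unfolding q[symmetric] by (simp add: poly_action_monom)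
    also have "\<dots> = poly_action q T (poly_action p T f) x + f x"
      by (simp only: poly_action_add poly_action_mult poly_action_monom funpow_0 int_scale_simps)
    also have "poly_action q T (poly_action p T f) x = 0"
      using elim by (simp add: poly_action_def[of q])
    finally show ?case by simp
  qed
  obtain d \<phi> A where d: "d > 0" and A: "A \<in> sets M" "prob A > 0"
    and per: "\<And>j. \<phi> (j + d) = \<phi> j"
    and \<phi>: "AE x in M. x \<in> A \<longrightarrow> (\<forall>j. f ((T ^^ j) x) = \<phi> j)" "AE x in M. \<exists>j. f x = \<phi> j"
    and eig: "koopman_eigenvalue M T (cis (2 * pi / real d))"
    by (rule power_invariant_function_structure[OF f(1) n inv]) (rule that; assumption)
  have per_mult: "\<phi> (j + d * k) = \<phi> j" for j k
  proof (induction k)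
    case (Suc k)
    have "j + d * Suc k = (j + d * k) + d" by simp
    then show ?case by (simp only: per Suc)
  qed simp
  have per_mod: "\<phi> (j mod d) = \<phi> j" for j
    using per_mult[of "j mod d" "j div d"] by simp
  have rec: "(\<Sum>k\<le>degree p. int_scale (coeff p k) (\<phi> (j + k))) = 0" for j
  proof -
    have "AE x in M. (\<forall>j. poly_action p T f ((T ^^ j) x) = 0) \<and> (x \<in> A \<longrightarrow> (\<forall>j. f ((T ^^ j) x) = \<phi> j))"
      using orbit0 \<phi>(1) by eventually_elim blast
    from AE_imp_ex_in[OF A this] obtain x where x: "poly_action p T f ((T ^^ j) x) = 0"
      "\<And>j. f ((T ^^ j) x) = \<phi> j" by blast
    have "f ((T ^^ k) ((T ^^ j) x)) = \<phi> (j + k)" for k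
      using x(2)[of "k + j"] unfolding funpow_add comp_apply by (simp only: add.commute)
    then show ?thesis using x(1) by (simp add: poly_action_def)
  qed
  have "cis (2 * pi / real d) ^ d = 1" unfolding Complex.DeMoivre using d by simp
  then have "cis (2 * pi / real d) \<in> rational_spectrum M T"
    unfolding rational_spectrum_def using d eig by (intro CollectI conjI exI[of _ d]) auto
  then have "koopman_eigenvalue M' T' (cis (2 * pi / real d))"
    unfolding spec by (simp add: rational_spectrum_def)
  from X'.koopman_eigenvalue_rotation_factor[OF d this]
  obtain \<kappa> :: "'b \<Rightarrow> nat" where \<kappa>: "\<kappa> \<in> measurable M' (count_space UNIV)"
    "AE x in M'. \<forall>j. \<kappa> ((T' ^^ j) x) = (\<kappa> x + j) mod d"
    "\<And>j. j < d \<Longrightarrow> \<not> (AE x in M'. \<kappa> x \<noteq> j)"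
    by blast
  show ?thesis
  proof (intro bexI conjI)
    show "(\<lambda>x. \<phi> (\<kappa> x)) \<in> measurable M' borel"
      by (rule measurable_compose[OF \<kappa>(1)]) simp
    show "AE x in M'. poly_action p T' (\<lambda>x. \<phi> (\<kappa> x)) x = 0"
      using \<kappa>(2) by eventually_elim (simp add: poly_action_def per_mod rec)
    show "\<not> (\<exists>c. AE x in M'. \<phi> (\<kappa> x) = c)"
    proof
      assume "\<exists>c. AE x in M'. \<phi> (\<kappa> x) = c"
      then obtain c where c: "AE x in M'. \<phi> (\<kappa> x) = c" by blast
      have const: "\<phi> j = c" for j
      proof (rule ccontr)
        assume ne: "\<phi> j \<noteq> c"
        have "AE x in M'. \<kappa> x \<noteq> j mod d"
          using c by eventually_elim (use ne per_mod[of j] in auto)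
        then show False using \<kappa>(3)[of "j mod d"] d by simp
      qed
      from \<phi>(2) have "AE x in M. f x = c" by eventually_elim (use const in auto)
      then show False using f(2) by blast
    qed
  qed
qed

section \<open>The inclusion between the two sets of polynomials\<close>

lemma invertible_mptE:
  assumes "nonatomic_lebesgue_prob_space M" "invertible_mpt M T" "ergodic M T"
  obtains S where "nonatomic_ergodic_mpt M T S"
proof -
  obtain S where "S \<in> measurable M M" "AE x in M. S (T x) = x" "AE x in M. T (S x) = x"
    and "T \<in> measurable M M" "distr M M T = M"
    using assms(2) by (auto simp: invertible_mpt_def iso_mod_null_def)
  moreover have "prob_space M" using assms(1) by (simp add: nonatomic_lebesgue_prob_space_def)
  ultimately have "ergodic_mpt M T S"
    using assms(3) by (intro ergodic_mpt.intro ergodic_mpt_axioms.intro) auto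
  then have "nonatomic_ergodic_mpt M T S"
    using nonatomic_lebesgue_prob_space_small_subset[OF assms(1)]
    by (intro nonatomic_ergodic_mpt.intro nonatomic_ergodic_mpt_axioms.intro) auto
  then show ?thesis by (rule that)
qed

text \<open>The class of 1 / c is killed by \<open>c\<close>, and it is nonzero because
  irreducibility forces \<open>\<bar>c\<bar> > 1\<close>. It is taken as the value on a set of
  measure strictly between 0 and 1, with 0 elsewhere.\<close>

lemma (in nonatomic_ergodic_mpt) constant_poly_solution:
  assumes "irreducible [:c:]"
  shows "\<exists>f\<in>measurable M (borel :: circle measure).
    \<not> (\<exists>a. AE x in M. f x = a) \<and> (AE x in M. poly_action [:c:] T f x = 0)"
proof -
  have c0: "c \<noteq> 0" using assms by auto
  have "\<not> c dvd 1"
    using irreducible_not_unit[OF assms] by (simp add: is_unit_const_poly_iff)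
  then have c1: "\<bar>c\<bar> > 1" using c0 by (simp add: zdvd1_eq)
  have ne: "abs_circle (1 / of_int c) \<noteq> 0"
  proof
    assume "abs_circle (1 / of_int c) = 0"
    then have "(1 / of_int c :: real) \<in> \<int>" by (simp add: abs_circle_eq_0_iff)
    moreover have "\<bar>1 / of_int c :: real\<bar> < 1" using c1 by (simp add: divide_less_eq flip: of_int_abs)
    ultimately have "1 / of_int c = (0::real)" using Ints_nonzero_abs_less1 by blast
    then show False using c0 by simp
  qed
  obtain A where A [measurable]: "A \<in> sets M" and pos: "prob A > 0" "prob A < 1"
    using nonatomic[OF sets.top, of 1] by (auto simp: prob_space)
  define f where "f = (\<lambda>x. abs_circle (indicat_real A x / of_int c))"
  show ?thesis
  proof (intro bexI conjI)
    show "f \<in> measurable M borel" unfolding f_def by measurable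
    show "\<not> (\<exists>a. AE x in M. f x = a)"
    proof
      assume "\<exists>a. AE x in M. f x = a"
      then obtain a where a: "AE x in M. f x = a" by blast
      have "prob (space M - A) > 0" using pos prob_compl[OF A] by simp
      then obtain x y where "x \<in> A" "f x = a" "y \<in> space M - A" "f y = a"
        using AE_imp_ex_in[OF A pos(1) a] AE_imp_ex_in[OF _ _ a, of "space M - A"] by auto
      then show False using ne by (simp add: f_def zero_circle_def)
    qed
    show "AE x in M. poly_action [:c:] T f x = 0"
      using c0 by (auto simp: poly_action_def f_def int_scale.abs_eq abs_circle_eq_0_iff indicator_def)
  qed
qed

lemma P_set_mono:
  fixes M :: "'a measure" and M' :: "'b measure"
  assumes X: "nonatomic_ergodic_mpt M T S" and X': "nonatomic_ergodic_mpt M' T' S'"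
    and spec: "rational_spectrum M T = rational_spectrum M' T'"
  shows "P_set M T \<subseteq> P_set M' T'"
proof
  interpret nonatomic_ergodic_mpt M T S by (rule X)
  interpret X': nonatomic_ergodic_mpt M' T' S' by (rule X')
  fix p assume "p \<in> P_set M T"
  then obtain f where p: "irreducible p"
    and f: "f \<in> measurable M (borel :: circle measure)" "\<not> (\<exists>c. AE x in M. f x = c)"
      "AE x in M. poly_action p T f x = 0"
    by (auto simp: P_set_def)
  have "\<exists>f\<in>measurable M' (borel :: circle measure).
    \<not> (\<exists>c. AE x in M'. f x = c) \<and> (AE x in M'. poly_action p T' f x = 0)"
  proof (cases "degree p = 0")
    case True
    then obtain c where "p = [:c:]" by (rule degree_eq_zeroE)
    then show ?thesis using X'.constant_poly_solution p by blast
  next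
    case False
    then have deg: "degree p > 0" by simp
    \<comment> \<open>A zero constant coefficient leaves only \<open>t\<close> and its negative. The
      equation then says that \<open>f (T x) = 0\<close> almost everywhere, and composing with
      \<open>S\<close> gives \<open>f = 0\<close> almost everywhere.\<close>
    have p0: "coeff p 0 \<noteq> 0"
    proof
      assume "coeff p 0 = 0"
      then obtain q where q: "p = pCons 0 q" by (cases p) auto
      then have "p = [:0, 1:] * q" by simp
      then have "[:0, 1:] dvd (1 :: int poly) \<or> q dvd 1" using p by (rule irreducibleD[rotated])
      moreover have "\<not> [:0, 1:] dvd (1 :: int poly)" by (simp add: is_unit_poly_iff)
      ultimately obtain c where c: "q = [:c:]" "c dvd 1" by (auto simp: is_unit_poly_iff)
      have "poly_action p T f x = int_scale c (f (T x))" for x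
        by (simp add: q c(1) poly_action_pCons)
      then have "AE x in M. int_scale c (f (T x)) = 0" using f(3) by simp
      then have "AE x in M. f (T x) = 0"
        by eventually_elim (use c(2) in \<open>auto simp: zdvd1_eq abs_if split: if_splits\<close>)
      from AE_S[OF this] TS have "AE x in M. f x = 0" by eventually_elim simp
      then show False using f(2) by blast
    qed
    show ?thesis
    proof (cases "\<exists>n>0. p dvd monom 1 n - 1")
      case True
      then show ?thesis
        using cyclotomic_solution_transfer[OF ergodic_mpt_axioms X'.ergodic_mpt_axioms spec _ _ f] by blast
    next
      case False
      then show ?thesis using X'.nonconstant_circle_solution[OF p deg p0] by blast
    qed
  qed
  then show "p \<in> P_set M' T'" using p by (auto simp: P_set_def)
qed

theorem corollary12:
  fixes M :: "'a measure" and T :: "'a \<Rightarrow> 'a"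
    and M' :: "'b measure" and T' :: "'b \<Rightarrow> 'b"
  assumes "nonatomic_lebesgue_prob_space M"
    and "nonatomic_lebesgue_prob_space M'"
    and "invertible_mpt M T" and "ergodic M T"
    and "invertible_mpt M' T'" and "ergodic M' T'"
    and "rational_spectrum M T = rational_spectrum M' T'"
  shows "P_set M T = P_set M' T'"
proof -
  obtain S S' where "nonatomic_ergodic_mpt M T S" "nonatomic_ergodic_mpt M' T' S'"
    using assms invertible_mptE by metis
  then show ?thesis using P_set_mono assms(7) by (metis subset_antisym)
qed

end
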